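(* Let $d\ge2$, and let $\Delta$ and $\Lambda$ be the operators associated with $K_3$ and $P_2$, respectively, on $\mathbb F_q^d$. If $1\le p_1,p_2,p_3\le\infty$ and $\Delta(p_1,p_2,p_3)\lesssim1$, then $\Lambda(p_1,p_2,p_3)\lesssim1$.
   Context: Conventions: $q$ ranges over powers of odd primes; when $d=2$ only those $q$ are considered for which $3$ is a nonzero square in $\mathbb F_q$. For $x\in\mathbb F_q^n$ put $\|x\|=x_1^2+\cdots+x_n^2$. For $t\in\mathbb F_q^*$, $S_t^{n-1}=\{x\in\mathbb F_q^n:\|x\|=t\}$ and $S_t=S_t^{d-1}\subset\mathbb F_q^d$; $S_t(x)$ also denotes the indicator function of $S_t$. When $d=2$ the normalizing number $|S_t^{d-2}|$ is read as $1$. For $f:\mathbb F_q^d\to\mathbb R$: $\|f\|_p=(q^{-d}\sum_x|f(x)|^p)^{1/p}$ for $1\le p<\infty$ and $\|f\|_\infty=\max_x|f(x)|$. Exponents are extended real numbers, with $1/\infty=0$. Operators: $$\Delta(f_1,f_2,f_3)=\frac{1}{q^d|S_t||S_t^{d-2}|}\sum_{x^1,x^2,x^3\in\mathbb F_q^d}S_t(x^1-x^2)S_t(x^2-x^3)S_t(x^3-x^1)\prod_{i=1}^3f_i(x^i),$$ $$\Lambda(f_1,f_2,f_3)=\frac{1}{q^d|S_t|^2}\sum_{x^1,x^2,x^3\in\mathbb F_q^d}S_t(x^1-x^2)S_t(x^2-x^3)\prod_{i=1}^3f_i(x^i).$$ For $\Phi\in\{\Delta,\Lambda\}$, $\Phi(p_1,p_2,p_3)$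 is the smallest constant such that $\Phi(f_1,f_2,f_3)\le\Phi(p_1,p_2,p_3)\prod_i\|f_i\|_{p_i}$ for all non-negative real-valued $f_i$ on $\mathbb F_q^d$. $\Phi(p_1,p_2,p_3)\lesssim1$ means there is $C\ge1$, independent of $q$ and $t$, with $\Phi(p_1,p_2,p_3)\le C$ for all such $q$ and all $t\in\mathbb F_q^*$. *)

theory Defs
  imports "HOL-Algebra.Coset" "HOL-Algebra.Ring" "HOL-Computational_Algebra.Primes"
    "HOL-Library.Extended_Real" "HOL-Library.Indicator_Function"
begin

text \<open>
  The constants in question must be uniform over all finite fields, so the fields are
  HOL-Algebra structures rather than types. Every finite field is isomorphic
  to one whose carrier is a set of natural numbers; hence quantifying over
  \<^typ>\<open>nat ring\<close> covers all of them. The space $F^n$ consists of the extensional functions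
  on $\{0,\dots,n-1\}$.
\<close>

definition vecs :: "('a, 'b) ring_scheme \<Rightarrow> nat \<Rightarrow> (nat \<Rightarrow> 'a) set" where
  "vecs F n = {..<n} \<rightarrow>\<^sub>E carrier F"

definition vec_minus :: "('a, 'b) ring_scheme \<Rightarrow> nat \<Rightarrow> (nat \<Rightarrow> 'a) \<Rightarrow> (nat \<Rightarrow> 'a) \<Rightarrow> (nat \<Rightarrow> 'a)" where
  "vec_minus F n x y = (\<lambda>i\<in>{..<n}. x i \<ominus>\<^bsub>F\<^esub> y i)"

definition sq_norm :: "('a, 'b) ring_scheme \<Rightarrow> nat \<Rightarrow> (nat \<Rightarrow> 'a) \<Rightarrow> 'a" where
  "sq_norm F n x = (\<Oplus>\<^bsub>F\<^esub>i\<in>{..<n}. x i [^]\<^bsub>F\<^esub> (2::nat))"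

text \<open>The second argument is the dimension of the ambient space: \<open>sphere F n t\<close> is $S_t^{n-1}$.\<close>

definition sphere :: "('a, 'b) ring_scheme \<Rightarrow> nat \<Rightarrow> 'a \<Rightarrow> (nat \<Rightarrow> 'a) set" where
  "sphere F n t = {x \<in> vecs F n. sq_norm F n x = t}"

definition sub_sphere_size :: "('a, 'b) ring_scheme \<Rightarrow> nat \<Rightarrow> 'a \<Rightarrow> nat" where
  "sub_sphere_size F d t = (if d = 2 then 1 else card (sphere F (d - 1) t))"

definition lp_norm :: "('a, 'b) ring_scheme \<Rightarrow> nat \<Rightarrow> ereal \<Rightarrow> ((nat \<Rightarrow> 'a) \<Rightarrow> real) \<Rightarrow> real" where
  "lp_norm F d p f =
    (if p = \<infinity> then Max ((\<lambda>x. \<bar>f x\<bar>) ` vecs F d)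
     else (1 / real (order F) ^ d * (\<Sum>x\<in>vecs F d. \<bar>f x\<bar> powr real_of_ereal p))
            powr (1 / real_of_ereal p))"

type_synonym 'a form3 =
  "((nat \<Rightarrow> 'a) \<Rightarrow> real) \<Rightarrow> ((nat \<Rightarrow> 'a) \<Rightarrow> real) \<Rightarrow> ((nat \<Rightarrow> 'a) \<Rightarrow> real) \<Rightarrow> real"

definition K3_form :: "('a, 'b) ring_scheme \<Rightarrow> nat \<Rightarrow> 'a \<Rightarrow> 'a form3" where
  "K3_form F d t f1 f2 f3 =
    1 / (real (order F) ^ d * real (card (sphere F d t)) * real (sub_sphere_size F d t)) *
    (\<Sum>x1\<in>vecs F d. \<Sum>x2\<in>vecs F d. \<Sum>x3\<in>vecs F d.
       indicat_real (sphere F d t) (vec_minus F d x1 x2) *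
       indicat_real (sphere F d t) (vec_minus F d x2 x3) *
       indicat_real (sphere F d t) (vec_minus F d x3 x1) *
       (f1 x1 * f2 x2 * f3 x3))"

definition P2_form :: "('a, 'b) ring_scheme \<Rightarrow> nat \<Rightarrow> 'a \<Rightarrow> 'a form3" where
  "P2_form F d t f1 f2 f3 =
    1 / (real (order F) ^ d * real (card (sphere F d t)) ^ 2) *
    (\<Sum>x1\<in>vecs F d. \<Sum>x2\<in>vecs F d. \<Sum>x3\<in>vecs F d.
       indicat_real (sphere F d t) (vec_minus F d x1 x2) *
       indicat_real (sphere F d t) (vec_minus F d x2 x3) *
       (f1 x1 * f2 x2 * f3 x3))"

definition bound_consts ::
    "('a, 'b) ring_scheme \<Rightarrow> nat \<Rightarrow> 'a form3 \<Rightarrow> ereal \<Rightarrow> ereal \<Rightarrow> ereal \<Rightarrow> real set" where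
  "bound_consts F d \<Phi> p1 p2 p3 = {A. \<forall>f1 f2 f3.
     (\<forall>x\<in>vecs F d. 0 \<le> f1 x \<and> 0 \<le> f2 x \<and> 0 \<le> f3 x) \<longrightarrow>
     \<Phi> f1 f2 f3 \<le> A * (lp_norm F d p1 f1 * lp_norm F d p2 f2 * lp_norm F d p3 f3)}"

definition best_const ::
    "('a, 'b) ring_scheme \<Rightarrow> nat \<Rightarrow> 'a form3 \<Rightarrow> ereal \<Rightarrow> ereal \<Rightarrow> ereal \<Rightarrow> real" where
  "best_const F d \<Phi> p1 p2 p3 = Inf (bound_consts F d \<Phi> p1 p2 p3)"

text \<open>
  The infimum is attained, so \<open>best_const\<close> is indeed the smallest admissible constant.
\<close>

lemma finite_vecs: "finite (carrier F) \<Longrightarrow> finite (vecs F d)"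
  by (simp add: vecs_def finite_PiE)

lemma lp_norm_nonneg:
  assumes "finite (vecs F d)" "vecs F d \<noteq> {}"
  shows "0 \<le> lp_norm F d p f"
proof (cases "p = \<infinity>")
  case True
  obtain x where "x \<in> vecs F d" using assms(2) by blast
  then have "\<bar>f x\<bar> \<le> Max ((\<lambda>x. \<bar>f x\<bar>) ` vecs F d)"
    using assms(1) by (intro Max_ge) auto
  then show ?thesis using True by (auto simp: lp_norm_def intro: order_trans[OF abs_ge_zero])
qed (simp add: lp_norm_def)

lemma lp_norm_one_pos:
  assumes "finite (carrier F)" "vecs F d \<noteq> {}" "carrier F \<noteq> {}"
  shows "0 < lp_norm F d p (\<lambda>_. 1)"
proof (cases "p = \<infinity>")
  case True
  have "(\<lambda>x. \<bar>1::real\<bar>) ` vecs F d = {1}" using assms(2) by auto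
  then show ?thesis using True by (simp add: lp_norm_def)
next
  case False
  have "0 < card (vecs F d)" using assms(1,2) finite_vecs card_gt_0_iff by blast
  moreover have "0 < order F" using assms(1,3) by (simp add: order_def card_gt_0_iff)
  ultimately show ?thesis using False by (simp add: lp_norm_def)
qed

lemma pointwise_le_lp_norm:
  assumes "finite (carrier F)" "carrier F \<noteq> {}" "1 \<le> p"
  shows "\<exists>M\<ge>0. \<forall>f. \<forall>x\<in>vecs F d. \<bar>f x\<bar> \<le> M * lp_norm F d p f"
proof (cases "p = \<infinity>")
  case True
  have "\<forall>f. \<forall>x\<in>vecs F d. \<bar>f x\<bar> \<le> 1 * lp_norm F d p f"
    using True finite_vecs[OF assms(1)] by (auto simp: lp_norm_def)
  then show ?thesis by (intro exI[of _ 1]) auto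
next
  case False
  define r where "r = real_of_ereal p"
  have r: "1 \<le> r" using False assms(3) unfolding r_def by (cases p) auto
  define Q where "Q = real (order F) ^ d"
  have Q: "0 < Q" using assms(1,2) by (simp add: Q_def order_def card_gt_0_iff)
  have "\<bar>f x\<bar> \<le> Q powr (1 / r) * lp_norm F d p f" if x: "x \<in> vecs F d" for f x
  proof -
    define S where "S = (\<Sum>x\<in>vecs F d. \<bar>f x\<bar> powr r)"
    have "\<bar>f x\<bar> powr r \<le> S" unfolding S_def
      using x finite_vecs[OF assms(1)] by (intro member_le_sum) auto
    then have "(\<bar>f x\<bar> powr r) powr (1 / r) \<le> S powr (1 / r)"
      using r by (intro powr_mono2) auto
    moreover have "(\<bar>f x\<bar> powr r) powr (1 / r) = \<bar>f x\<bar>" using r by (simp add: powr_powr)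
    moreover have "S powr (1 / r) = Q powr (1 / r) * (1 / Q * S) powr (1 / r)"
      using Q by (simp add: powr_mult[symmetric] S_def sum_nonneg)
    moreover have "lp_norm F d p f = (1 / Q * S) powr (1 / r)"
      using False by (simp add: lp_norm_def Q_def S_def r_def)
    ultimately show ?thesis by simp
  qed
  then show ?thesis by (intro exI[of _ "Q powr (1 / r)"]) auto
qed

lemma best_const_least:
  assumes fin: "finite (carrier F)" and ne: "carrier F \<noteq> {}"
    and p: "1 \<le> p1" "1 \<le> p2" "1 \<le> p3"
    and \<Phi>: "\<And>f1 f2 f3. \<Phi> f1 f2 f3 =
      c * (\<Sum>x1\<in>vecs F d. \<Sum>x2\<in>vecs F d. \<Sum>x3\<in>vecs F d. K x1 x2 x3 * (f1 x1 * f2 x2 * f3 x3))"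
    and c: "0 \<le> c" and K: "\<And>x1 x2 x3. 0 \<le> K x1 x2 x3"
  shows "best_const F d \<Phi> p1 p2 p3 \<in> bound_consts F d \<Phi> p1 p2 p3"
    and "A \<in> bound_consts F d \<Phi> p1 p2 p3 \<Longrightarrow> best_const F d \<Phi> p1 p2 p3 \<le> A"
proof -
  let ?B = "bound_consts F d \<Phi> p1 p2 p3"
  let ?N = "\<lambda>f1 f2 f3. lp_norm F d p1 f1 * lp_norm F d p2 f2 * lp_norm F d p3 f3"
  have fv: "finite (vecs F d)" by (rule finite_vecs[OF fin])
  have nv: "vecs F d \<noteq> {}" using ne by (simp add: vecs_def PiE_eq_empty_iff)
  have N0: "0 \<le> ?N f1 f2 f3" for f1 f2 f3 using lp_norm_nonneg[OF fv nv] by simp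
  have N1: "0 < ?N (\<lambda>_. 1) (\<lambda>_. 1) (\<lambda>_. 1)" using lp_norm_one_pos[OF fin nv ne] by simp
  have bdd: "bdd_below ?B"
  proof (rule bdd_belowI)
    fix A assume "A \<in> ?B"
    then have "\<Phi> (\<lambda>_. 1) (\<lambda>_. 1) (\<lambda>_. 1) \<le> A * ?N (\<lambda>_. 1) (\<lambda>_. 1) (\<lambda>_. 1)"
      unfolding bound_consts_def by fastforce
    then show "\<Phi> (\<lambda>_. 1) (\<lambda>_. 1) (\<lambda>_. 1) / ?N (\<lambda>_. 1) (\<lambda>_. 1) (\<lambda>_. 1) \<le> A"
      using N1 by (subst pos_divide_le_eq) auto
  qed
  obtain M1 where M1: "0 \<le> M1" "\<And>f x. x \<in> vecs F d \<Longrightarrow> \<bar>f x\<bar> \<le> M1 * lp_norm F d p1 f"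
    using pointwise_le_lp_norm[OF fin ne p(1)] by blast
  obtain M2 where M2: "0 \<le> M2" "\<And>f x. x \<in> vecs F d \<Longrightarrow> \<bar>f x\<bar> \<le> M2 * lp_norm F d p2 f"
    using pointwise_le_lp_norm[OF fin ne p(2)] by blast
  obtain M3 where M3: "0 \<le> M3" "\<And>f x. x \<in> vecs F d \<Longrightarrow> \<bar>f x\<bar> \<le> M3 * lp_norm F d p3 f"
    using pointwise_le_lp_norm[OF fin ne p(3)] by blast
  define S where "S = (\<Sum>x1\<in>vecs F d. \<Sum>x2\<in>vecs F d. \<Sum>x3\<in>vecs F d. K x1 x2 x3)"
  have "c * S * (M1 * M2 * M3) \<in> ?B"
    unfolding bound_consts_def
  proof (intro CollectI allI impI)
    fix f1 f2 f3 :: "(nat \<Rightarrow> 'a) \<Rightarrow> real"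
    assume f: "\<forall>x\<in>vecs F d. 0 \<le> f1 x \<and> 0 \<le> f2 x \<and> 0 \<le> f3 x"
    have *: "f1 x1 * f2 x2 * f3 x3 \<le> M1 * M2 * M3 * ?N f1 f2 f3"
      if "x1 \<in> vecs F d" "x2 \<in> vecs F d" "x3 \<in> vecs F d" for x1 x2 x3
    proof -
      have "f1 x1 * f2 x2 * f3 x3 \<le>
          (M1 * lp_norm F d p1 f1) * (M2 * lp_norm F d p2 f2) * (M3 * lp_norm F d p3 f3)"
        using that f M1(1) M2(1) M3(1) lp_norm_nonneg[OF fv nv]
          abs_le_D1[OF M1(2)[of x1 f1]] abs_le_D1[OF M2(2)[of x2 f2]] abs_le_D1[OF M3(2)[of x3 f3]]
        by (intro mult_mono) auto
      then show ?thesis by (simp add: mult_ac)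
    qed
    have "\<Phi> f1 f2 f3 \<le> c * (\<Sum>x1\<in>vecs F d. \<Sum>x2\<in>vecs F d. \<Sum>x3\<in>vecs F d.
        K x1 x2 x3 * (M1 * M2 * M3 * ?N f1 f2 f3))"
      unfolding \<Phi> using c K *
      by (intro mult_left_mono sum_mono) auto
    also have "\<dots> = c * S * (M1 * M2 * M3) * ?N f1 f2 f3"
      by (simp only: S_def sum_distrib_right[symmetric])
    finally show "\<Phi> f1 f2 f3 \<le> c * S * (M1 * M2 * M3) * ?N f1 f2 f3" .
  qed
  then have nonempty: "?B \<noteq> {}" by blast
  show "best_const F d \<Phi> p1 p2 p3 \<in> ?B"
    unfolding bound_consts_def
  proof (intro CollectI allI impI)
    fix f1 f2 f3 :: "(nat \<Rightarrow> 'a) \<Rightarrow> real"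
    assume f: "\<forall>x\<in>vecs F d. 0 \<le> f1 x \<and> 0 \<le> f2 x \<and> 0 \<le> f3 x"
    have A: "\<Phi> f1 f2 f3 \<le> A * ?N f1 f2 f3" if "A \<in> ?B" for A
      using that f unfolding bound_consts_def by blast
    show "\<Phi> f1 f2 f3 \<le> best_const F d \<Phi> p1 p2 p3 * ?N f1 f2 f3"
    proof (cases "?N f1 f2 f3 = 0")
      case True
      then show ?thesis using A nonempty by fastforce
    next
      case False
      then have N: "0 < ?N f1 f2 f3" using N0[of f1 f2 f3] by linarith
      have "\<Phi> f1 f2 f3 / ?N f1 f2 f3 \<le> best_const F d \<Phi> p1 p2 p3"
        unfolding best_const_def
        using A N by (intro cInf_greatest nonempty) (subst pos_divide_le_eq, auto)
      then show ?thesis using N by (subst (asm) pos_divide_le_eq) auto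
    qed
  qed
  show "best_const F d \<Phi> p1 p2 p3 \<le> A" if "A \<in> ?B"
    unfolding best_const_def using that bdd by (rule cInf_lower)
qed

lemma K3_best_const_least:
  assumes "finite (carrier F)" "carrier F \<noteq> {}" "1 \<le> p1" "1 \<le> p2" "1 \<le> p3"
  shows "best_const F d (K3_form F d t) p1 p2 p3 \<in> bound_consts F d (K3_form F d t) p1 p2 p3"
    and "A \<in> bound_consts F d (K3_form F d t) p1 p2 p3 \<Longrightarrow>
      best_const F d (K3_form F d t) p1 p2 p3 \<le> A"
  by (rule best_const_least[OF assms K3_form_def]; simp)+

lemma P2_best_const_least:
  assumes "finite (carrier F)" "carrier F \<noteq> {}" "1 \<le> p1" "1 \<le> p2" "1 \<le> p3"
  shows "best_const F d (P2_form F d t) p1 p2 p3 \<in> bound_consts F d (P2_form F d t) p1 p2 p3"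
    and "A \<in> bound_consts F d (P2_form F d t) p1 p2 p3 \<Longrightarrow>
      best_const F d (P2_form F d t) p1 p2 p3 \<le> A"
  by (rule best_const_least[OF assms P2_form_def]; simp)+

definition admissible_field :: "('a, 'b) ring_scheme \<Rightarrow> nat \<Rightarrow> bool" where
  "admissible_field F d \<longleftrightarrow> field F \<and>
     (\<exists>p k. prime (p::nat) \<and> odd p \<and> 1 \<le> k \<and> order F = p ^ k) \<and>
     (d = 2 \<longrightarrow> (let three = \<one>\<^bsub>F\<^esub> \<oplus>\<^bsub>F\<^esub> \<one>\<^bsub>F\<^esub> \<oplus>\<^bsub>F\<^esub> \<one>\<^bsub>F\<^esub>
        in three \<noteq> \<zero>\<^bsub>F\<^esub> \<and> (\<exists>a\<in>carrier F. a [^]\<^bsub>F\<^esub> (2::nat) = three)))"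

definition lesssim_one ::
    "(nat ring \<Rightarrow> nat \<Rightarrow> nat \<Rightarrow> nat form3) \<Rightarrow> nat \<Rightarrow> ereal \<Rightarrow> ereal \<Rightarrow> ereal \<Rightarrow> bool" where
  "lesssim_one \<Phi> d p1 p2 p3 \<longleftrightarrow>
     (\<exists>C\<ge>1. \<forall>F. admissible_field F d \<longrightarrow>
        (\<forall>t\<in>carrier F - {\<zero>\<^bsub>F\<^esub>}. best_const F d (\<Phi> F d t) p1 p2 p3 \<le> C))"

end

theory Submission
  imports Defs "HOL-Analysis.Convex" "HOL-Library.Discrete_Functions" "HOL-Number_Theory.Cong"
begin

text \<open>
  Write \<open>u\<^sub>i = 1 / p\<^sub>i\<close>. Testing $\Delta$ on the indicators of a point and twice of the unit
  sphere around it, over the prime fields in which \<open>3\<close> is a square, forces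
  \<open>d u\<^sub>1 + u\<^sub>2 + u\<^sub>3 \<le> d\<close> and its cyclic variants. Conversely these three inequalities already
  bound $\Lambda$ over every field.

  The point is the endpoint estimate $L^{(d+1)/d} \to L^{d+1}$ for the spherical averages \<open>A\<close>.
  It is usually derived from Weil's bound on Kloosterman sums; here elementary counting suffices:
  two distinct spheres of the same radius meet in at most $|S_t|^2 / q^d + O(q^a)$ points, where
  \<open>a = (d - 1) div 2\<close>, and hence the number of pairs in \<open>E \<times> F\<close> at distance \<open>t\<close> exceeds
  \<open>|S\<^sub>t| |E| |F| / q\<^sup>d\<close> by at most
  $O(q^{(d-1)/2} (|E| |F|)^{1/2} + q^{a/2} (|E| |F| \min(|E|, |F|))^{1/2})$.
  Decomposing functions into dyadic blocks by the rank (not the size) of their values turns this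
  into the strong-type endpoint bound via a Schur test.

  If \<open>F \<ge> 1\<close> has bounded mean, then so has \<open>G = (A F\<^sup>\<delta>)\<^sup>d\<^sup>+\<^sup>1\<close> with \<open>\<delta> = d / (d + 1)\<close>, and
  \<open>A F\<^sup>u \<le> G\<^sup>u\<^sup>/\<^sup>d\<close> for \<open>u \<le> \<delta>\<close>. Substituting \<open>f\<^sub>i \<le> \<parallel>f\<^sub>i\<parallel> F\<^sub>i\<^bsup>u\<^sub>i\<^esup>\<close> in $\Lambda$, every factor becomes a power
  of a function with bounded mean, the exponents adding up to at most \<open>1\<close>.
\<close>

section \<open>Dyadic blocks and power sums\<close>

text \<open>Everything has to be uniform in the field, so the analysis is done for an abstract
  regular graph, and every constant in it depends on \<open>d\<close> alone.

  Blocks of prescribed cardinality are what yields a strong-type bound: after normalization the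
  excess edge count of blocks \<open>k\<close> and \<open>l\<close> is controlled by
  \<open>(k, l)\<close> only, and decays geometrically away from two transversal lines, one of
  constant \<open>k + l\<close> and the diagonal. Each gives a kernel with bounded row sums.

  Functions are kept at least 1, so that powers increase with the exponent: Hoelder's inequality
  reduces to estimating a product by a sum, and the whole polytope of exponents is reached without
  interpolation.

  The counting rests on one fact: adding two squares to a quadratic form convolves its counts with
  those of a conic, which are constant off 0. The deviation from uniformity therefore obeys a
  two-step recurrence with a sign. Two spheres of equal radius intersect in a hyperplane section of
  one of them, whose size is recovered from the counts in the full space.\<close>

lemma sum_of_bool_eq_card: "finite W \<Longrightarrow> (\<Sum>y\<in>W. of_bool (P y) :: real) = real (card {y \<in> W. P y})"
  by (simp add: sum.If_cases of_bool_def Int_def)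

text \<open>Exponent bookkeeping: with \<open>x = d - 1\<close> and \<open>y = d\<close> it says
  \<open>(d - 1) / (d + 1) + (d - 1) * \<delta> = d - 1\<close>, the homogeneity behind the power of
  \<open>q\<close> in the bilinear bound.\<close>

lemma convex_fraction_eq: "x / (y + 1) + x * (y / (y + 1)) = x" if "0 \<le> y" for x y :: real
proof -
  have "x / (y + 1) + x * (y / (y + 1)) = x * (y + 1) / (y + 1)"
    by (simp add: add_divide_distrib distrib_left)
  then show ?thesis using that by simp
qed

text \<open>Stands in for Hoelder's inequality. Both bases are at least 1, so each may be enlarged
  to the sum; once the exponents add up to at most 1, \<open>powr_le_self\<close> turns the result
  into the sum itself, whose mean is controlled.\<close>

lemma powr_mult_le:
  fixes a b s t :: real
  assumes "1 \<le> a" "1 \<le> b" "0 \<le> s" "0 \<le> t"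
  shows "a powr s * b powr t \<le> (a + b) powr (s + t)"
proof -
  have "a powr s * b powr t \<le> (a + b) powr s * (a + b) powr t"
    using assms by (intro mult_mono powr_mono2) auto
  then show ?thesis by (simp add: powr_add)
qed

lemma powr_le_self: "1 \<le> a \<Longrightarrow> s \<le> 1 \<Longrightarrow> a powr s \<le> a" for a s :: real
  using powr_mono[of s 1 a] by simp

text \<open>Concavity of \<open>s powr \<theta>\<close>, obtained from the weighted AM-GM inequality
  of each \<open>f x\<close> against the mean \<open>\<mu>\<close>. A vanishing sum is treated apart
  because \<open>\<mu>\<close> must be positive to be divided out.\<close>

lemma sum_powr_le:
  fixes f :: "'a \<Rightarrow> real"
  assumes fin: "finite W" and f: "\<And>x. x \<in> W \<Longrightarrow> 0 \<le> f x" and \<theta>: "0 \<le> \<theta>" "\<theta> \<le> 1"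
  shows "(\<Sum>x\<in>W. f x powr \<theta>) \<le> real (card W) powr (1 - \<theta>) * (\<Sum>x\<in>W. f x) powr \<theta>"
proof (cases "(\<Sum>x\<in>W. f x) = 0")
  case True
  then have "f x = 0" if "x \<in> W" for x using that fin f by (simp add: sum_nonneg_eq_0_iff)
  then show ?thesis using True by simp
next
  case False
  define S where "S = (\<Sum>x\<in>W. f x)"
  define n where "n = real (card W)"
  have S: "0 < S" using False f by (simp add: S_def sum_nonneg less_le)
  have "W \<noteq> {}" using False by auto
  then have n: "0 < n" using fin by (simp add: n_def card_gt_0_iff)
  define \<mu> where "\<mu> = S / n"
  have \<mu>: "0 < \<mu>" using S n by (simp add: \<mu>_def)
  have "f x powr \<theta> * \<mu> powr (1 - \<theta>) \<le> \<theta> * f x + (1 - \<theta>) * \<mu>" if "x \<in> W" for x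
    using Youngs_inequality_0[of \<theta> "1 - \<theta>" "f x" \<mu>] \<theta> f[OF that] \<mu>
    by (cases "f x = 0") auto
  then have "(\<Sum>x\<in>W. f x powr \<theta> * \<mu> powr (1 - \<theta>)) \<le> (\<Sum>x\<in>W. \<theta> * f x + (1 - \<theta>) * \<mu>)"
    by (rule sum_mono)
  also have "\<dots> = \<theta> * S + (1 - \<theta>) * (n * \<mu>)"
    by (simp add: sum.distrib S_def n_def sum_distrib_left)
  also have "n * \<mu> = S" using n by (simp add: \<mu>_def)
  finally have "(\<Sum>x\<in>W. f x powr \<theta>) * \<mu> powr (1 - \<theta>) \<le> S"
    by (simp flip: sum_distrib_right add: algebra_simps)
  then have "(\<Sum>x\<in>W. f x powr \<theta>) \<le> S / \<mu> powr (1 - \<theta>)" using \<mu> by (simp add: pos_le_divide_eq)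
  also have "S / \<mu> powr (1 - \<theta>) = S powr 1 * n powr (1 - \<theta>) / S powr (1 - \<theta>)"
    using S n by (simp add: \<mu>_def powr_divide)
  also have "\<dots> = n powr (1 - \<theta>) * (S powr 1 / S powr (1 - \<theta>))" by simp
  also have "S powr 1 / S powr (1 - \<theta>) = S powr \<theta>" using S by (subst powr_diff[symmetric]) simp
  finally show ?thesis by (simp add: S_def n_def)
qed

text \<open>On either side of the centre the distance is injective in \<open>k\<close>, so each half
  is a subseries of the geometric series.\<close>

lemma sum_powr_abs_diff_int_le:
  fixes \<rho> :: real
  assumes "0 < \<rho>" "\<rho> < 1"
  shows "(\<Sum>k<K. \<rho> ^ nat \<bar>int k - i\<bar>) \<le> 2 / (1 - \<rho>)"
proof -
  have geo: "(\<Sum>j\<in>J. \<rho> ^ j) \<le> 1 / (1 - \<rho>)" if "finite J" for J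
  proof -
    have "(\<Sum>j\<in>J. \<rho> ^ j) \<le> (\<Sum>j. \<rho> ^ j)"
      using assms that by (intro sum_le_suminf summable_geometric) auto
    then show ?thesis using suminf_geometric[of \<rho>] assms by simp
  qed
  let ?A = "{k\<in>{..<K}. i \<le> int k}" and ?B = "{k\<in>{..<K}. int k < i}"
  have "(\<Sum>k\<in>?A. \<rho> ^ nat \<bar>int k - i\<bar>) = (\<Sum>j\<in>(\<lambda>k. nat \<bar>int k - i\<bar>) ` ?A. \<rho> ^ j)"
    by (subst sum.reindex) (auto simp: inj_on_def)
  then have 1: "(\<Sum>k\<in>?A. \<rho> ^ nat \<bar>int k - i\<bar>) \<le> 1 / (1 - \<rho>)" using geo by simp
  have "(\<Sum>k\<in>?B. \<rho> ^ nat \<bar>int k - i\<bar>) = (\<Sum>j\<in>(\<lambda>k. nat \<bar>int k - i\<bar>) ` ?B. \<rho> ^ j)"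
    by (subst sum.reindex) (auto simp: inj_on_def)
  then have 2: "(\<Sum>k\<in>?B. \<rho> ^ nat \<bar>int k - i\<bar>) \<le> 1 / (1 - \<rho>)" using geo by simp
  have U: "{..<K} = ?A \<union> ?B" and dis: "?A \<inter> ?B = {}" and finA: "finite ?A" and finB: "finite ?B"
    by auto
  have "(\<Sum>k<K. \<rho> ^ nat \<bar>int k - i\<bar>) =
      (\<Sum>k\<in>?A. \<rho> ^ nat \<bar>int k - i\<bar>) + (\<Sum>k\<in>?B. \<rho> ^ nat \<bar>int k - i\<bar>)"
    using sum.union_disjoint[OF finA finB dis, of "\<lambda>k. \<rho> ^ nat \<bar>int k - i\<bar>"]
    by (simp only: U[symmetric])
  then show ?thesis using 1 2 by linarith
qed

text \<open>Rounding the real centre \<open>c\<close> down to an integer changes each distance by at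
  most 1, which costs the factor \<open>2 powr \<epsilon>\<close>.\<close>

lemma sum_powr_abs_diff_le:
  fixes c \<epsilon> :: real
  assumes "0 < \<epsilon>"
  shows "(\<Sum>k<K. 2 powr (- \<epsilon> * \<bar>real k - c\<bar>)) \<le> 2 powr \<epsilon> * (2 / (1 - 2 powr - \<epsilon>))"
proof -
  define \<rho> where "\<rho> = 2 powr - \<epsilon>"
  have \<rho>: "0 < \<rho>" "\<rho> < 1" using assms by (auto simp: \<rho>_def powr_less_one)
  have "2 powr (- \<epsilon> * \<bar>real k - c\<bar>) \<le> 2 powr \<epsilon> * \<rho> ^ nat \<bar>int k - \<lfloor>c\<rfloor>\<bar>" for k
  proof -
    have "real (nat \<bar>int k - \<lfloor>c\<rfloor>\<bar>) = \<bar>real k - real_of_int \<lfloor>c\<rfloor>\<bar>" by simp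
    also have "\<dots> \<le> \<bar>real k - c\<bar> + 1" using floor_correct[of c] by linarith
    finally have "\<epsilon> * real (nat \<bar>int k - \<lfloor>c\<rfloor>\<bar>) \<le> \<epsilon> * (\<bar>real k - c\<bar> + 1)"
      using assms by (intro mult_left_mono) auto
    then have "- \<epsilon> * \<bar>real k - c\<bar> \<le> \<epsilon> + - \<epsilon> * real (nat \<bar>int k - \<lfloor>c\<rfloor>\<bar>)"
      by (simp add: algebra_simps)
    then have "2 powr (- \<epsilon> * \<bar>real k - c\<bar>) \<le> 2 powr (\<epsilon> + - \<epsilon> * real (nat \<bar>int k - \<lfloor>c\<rfloor>\<bar>))"
      by (intro powr_mono) auto
    also have "\<dots> = 2 powr \<epsilon> * (2 powr - \<epsilon>) powr real (nat \<bar>int k - \<lfloor>c\<rfloor>\<bar>)"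
      by (simp only: powr_add powr_powr)
    also have "(2 powr - \<epsilon>) powr real (nat \<bar>int k - \<lfloor>c\<rfloor>\<bar>) = \<rho> ^ nat \<bar>int k - \<lfloor>c\<rfloor>\<bar>"
      unfolding \<rho>_def by (rule powr_realpow) simp
    finally show ?thesis .
  qed
  then have "(\<Sum>k<K. 2 powr (- \<epsilon> * \<bar>real k - c\<bar>)) \<le> (\<Sum>k<K. 2 powr \<epsilon> * \<rho> ^ nat \<bar>int k - \<lfloor>c\<rfloor>\<bar>)"
    by (rule sum_mono)
  also have "\<dots> = 2 powr \<epsilon> * (\<Sum>k<K. \<rho> ^ nat \<bar>int k - \<lfloor>c\<rfloor>\<bar>)" by (simp add: sum_distrib_left)
  also have "\<dots> \<le> 2 powr \<epsilon> * (2 / (1 - \<rho>))"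
    using sum_powr_abs_diff_int_le[OF \<rho>] by (intro mult_left_mono) auto
  finally show ?thesis by (simp add: \<rho>_def)
qed

lemma exists_antimono_enumeration:
  fixes F :: "'a \<Rightarrow> real"
  assumes "finite V"
  shows "\<exists>h. bij_betw h {..<card V} V \<and> (\<forall>i j. i \<le> j \<longrightarrow> j < card V \<longrightarrow> F (h j) \<le> F (h i))"
proof -
  obtain xs0 where xs0: "set xs0 = V" "distinct xs0" using finite_distinct_list[OF assms] by blast
  define xs where "xs = sort_key (\<lambda>x. - F x) xs0"
  have xs: "set xs = V" "distinct xs" "sorted (map (\<lambda>x. - F x) xs)" using xs0 by (auto simp: xs_def)
  have len: "length xs = card V" using xs distinct_card by metis
  have "bij_betw ((!) xs) {..<card V} V" using bij_betw_nth[OF xs(2)] len xs(1) by auto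
  moreover have "F (xs ! j) \<le> F (xs ! i)" if "i \<le> j" "j < card V" for i j
    using sorted_nth_mono[OF xs(3) that(1)] that len by simp
  ultimately show ?thesis by blast
qed

text \<open>Block \<open>k\<close> holds the ranks from \<open>2 ^ k - 1\<close> to
  \<open>2 ^ (k + 1) - 2\<close> in decreasing order of \<open>F\<close>, and \<open>c k\<close> is
  the value at its lowest rank. The last property holds for all monotone \<open>\<phi>\<close> with
  the same \<open>c\<close>; it is needed both for the identity and for the power
  \<open>\<delta>\<close>.\<close>

lemma dyadic_blocks:
  fixes F :: "'a \<Rightarrow> real"
  assumes fin: "finite V" and ne: "V \<noteq> {}" and F: "\<And>x. x \<in> V \<Longrightarrow> 0 \<le> F x"
  obtains K :: nat and blk :: "'a \<Rightarrow> nat" and c :: "nat \<Rightarrow> real" where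
    "\<And>x. x \<in> V \<Longrightarrow> blk x < K" "\<And>x. x \<in> V \<Longrightarrow> F x \<le> c (blk x)"
    "\<And>k. card {x \<in> V. blk x = k} \<le> 2 ^ k" "\<And>k. k < K \<Longrightarrow> 2 ^ k \<le> card V"
    "\<And>k. k < K \<Longrightarrow> 0 \<le> c k"
    "\<forall>\<phi>. mono_on {0..} \<phi> \<and> 0 \<le> \<phi> 0 \<longrightarrow>
       (\<Sum>k<K. 2 ^ k * \<phi> (c k)) \<le> (3::real) * (\<Sum>x\<in>V. \<phi> (F x))"
proof -
  define m where "m = card V"
  have m: "0 < m" using fin ne by (simp add: m_def card_gt_0_iff)
  obtain h where h: "bij_betw h {..<m} V" and mono: "\<And>i j. i \<le> j \<Longrightarrow> j < m \<Longrightarrow> F (h j) \<le> F (h i)"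
    using exists_antimono_enumeration[OF fin, of F] by (auto simp: m_def)
  define g where "g = the_inv_into {..<m} h"
  have g: "bij_betw g V {..<m}" unfolding g_def using h by (rule bij_betw_the_inv_into)
  have hg: "h (g x) = x" if "x \<in> V" for x
    using that h unfolding g_def by (metis f_the_inv_into_f_bij_betw)
  have gm: "g x < m" if "x \<in> V" for x using g that by (auto simp: bij_betw_def)
  have hV: "h i \<in> V" if "i < m" for i using h that by (auto simp: bij_betw_def)
  define blk where "blk = (\<lambda>x. floor_log (Suc (g x)))"
  define K where "K = Suc (floor_log m)"
  define c where "c = (\<lambda>k. F (h (2 ^ k - 1)))"
  have pow_le: "2 ^ k \<le> m" if "k < K" for k
  proof -
    have "(2::nat) ^ k \<le> 2 ^ floor_log m" using that by (intro power_increasing) (auto simp: K_def)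
    also have "\<dots> \<le> m" using floor_log_exp2_le[OF m] .
    finally show ?thesis .
  qed
  have idx: "2 ^ k - 1 < m" if "k < K" for k
  proof -
    have "(0::nat) < 2 ^ k" by simp
    then show ?thesis using pow_le[OF that] by linarith
  qed
  show ?thesis
  proof
    fix x assume x: "x \<in> V"
    show "blk x < K" using gm[OF x] by (auto simp: blk_def K_def less_Suc_eq_le intro: floor_log_le_iff)
    have "2 ^ blk x \<le> Suc (g x)" unfolding blk_def by (rule floor_log_exp2_le) simp
    then have "2 ^ blk x - 1 \<le> g x" by linarith
    then show "F x \<le> c (blk x)" using mono[OF _ gm[OF x]] hg[OF x] by (force simp: c_def)
  next
    fix k
    let ?B = "{x \<in> V. blk x = k}"
    have "g ` ?B \<subseteq> {2 ^ k - 1..<2 ^ Suc k - 1}"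
    proof
      fix i assume "i \<in> g ` ?B"
      then obtain x where "i = g x" "floor_log (Suc i) = k" by (auto simp: blk_def)
      moreover have "2 ^ floor_log (Suc i) \<le> Suc i" by (rule floor_log_exp2_le) simp
      moreover have "Suc i < 2 * 2 ^ floor_log (Suc i)" by (rule floor_log_exp2_gt)
      ultimately show "i \<in> {2 ^ k - 1..<2 ^ Suc k - 1}" by auto
    qed
    then have "card (g ` ?B) \<le> card {2 ^ k - 1..<2 ^ Suc k - (1::nat)}" by (intro card_mono) auto
    moreover have "card (g ` ?B) = card ?B"
      using g by (intro card_image) (auto simp: bij_betw_def inj_on_def)
    ultimately show "card ?B \<le> 2 ^ k" by auto
  next
    fix k assume "k < K"
    then show "2 ^ k \<le> card V" using pow_le by (simp add: m_def)
    show "0 \<le> c k" using idx[OF \<open>k < K\<close>] F hV by (simp add: c_def)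
  next
    show "\<forall>\<phi>. mono_on {0..} \<phi> \<and> 0 \<le> \<phi> 0 \<longrightarrow>
      (\<Sum>k<K. 2 ^ k * \<phi> (c k)) \<le> (3::real) * (\<Sum>x\<in>V. \<phi> (F x))"
    proof (intro allI impI, elim conjE)
      fix \<phi> :: "real \<Rightarrow> real"
      assume \<phi>_mono: "mono_on {0..} \<phi>" and \<phi>_0: "0 \<le> \<phi> 0"
      have \<phi>: "\<phi> s \<le> \<phi> t" if "0 \<le> s" "s \<le> t" for s t
        using \<phi>_mono that by (auto simp: mono_on_def)
      have \<phi>0: "0 \<le> \<phi> s" if "0 \<le> s" for s using \<phi>[of 0 s] \<phi>_0 that by simp
      define w where "w = (\<lambda>i. \<phi> (F (h i)))"
      have w0: "0 \<le> w i" if "i < m" for i using that F hV \<phi>0 by (simp add: w_def)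
      have wm: "w j \<le> w i" if "i \<le> j" "j < m" for i j
        using that F hV mono \<phi> by (simp add: w_def)
      \<comment> \<open>Block \<open>n + 1\<close> is charged to block \<open>n\<close>, whose
        \<open>2 ^ n\<close> values are all at least \<open>w (2 ^ (n + 1) - 1)\<close>. Only the
        top value is left over; hence the factor \<open>3 = 1 + 2\<close>.\<close>
      have *: "(\<Sum>k\<le>n. 2 ^ k * w (2 ^ k - 1)) \<le> w 0 + 2 * (\<Sum>j<2 ^ n - 1. w j)" if "n < K" for n
        using that
      proof (induction n)
        case 0
        then show ?case by simp
      next
        case (Suc n)
        have split: "{..<2 ^ Suc n - (1::nat)} = {..<2 ^ n - 1} \<union> {2 ^ n - 1..<2 ^ Suc n - 1}" by auto
        have c: "card {2 ^ n - 1..<2 ^ Suc n - (1::nat)} = 2 ^ n" by auto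
        have "(\<Sum>j\<in>{2 ^ n - 1..<2 ^ Suc n - (1::nat)}. w (2 ^ Suc n - 1))
            \<le> (\<Sum>j\<in>{2 ^ n - 1..<2 ^ Suc n - (1::nat)}. w j)"
          using idx[OF Suc.prems] by (intro sum_mono wm) auto
        then have "2 ^ n * w (2 ^ Suc n - 1) \<le> (\<Sum>j\<in>{2 ^ n - 1..<2 ^ Suc n - (1::nat)}. w j)"
          by (simp only: sum_constant c of_nat_power of_nat_numeral)
        moreover have "(\<Sum>j<2 ^ Suc n - (1::nat). w j) = (\<Sum>j<2 ^ n - 1. w j) +
            (\<Sum>j\<in>{2 ^ n - 1..<2 ^ Suc n - (1::nat)}. w j)"
          unfolding split by (rule sum.union_disjoint) auto
        ultimately show ?case using Suc by simp
    qed
    have "(\<Sum>k<K. 2 ^ k * \<phi> (c k)) = (\<Sum>k\<le>floor_log m. 2 ^ k * w (2 ^ k - 1))"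
      unfolding K_def lessThan_Suc_atMost by (simp add: c_def w_def)
    also have "\<dots> \<le> w 0 + 2 * (\<Sum>j<2 ^ floor_log m - 1. w j)" by (rule *) (simp add: K_def)
    also have "w 0 \<le> (\<Sum>j<m. w j)" using m w0 by (intro member_le_sum) auto
    also have "(\<Sum>j<2 ^ floor_log m - 1. w j) \<le> (\<Sum>j<m. w j)"
      using idx[of "floor_log m"] w0 by (intro sum_mono2) (auto simp: K_def)
    finally have "(\<Sum>k<K. 2 ^ k * \<phi> (c k)) \<le> 3 * (\<Sum>j<m. w j)" by simp
    also have "(\<Sum>j<m. w j) = (\<Sum>x\<in>V. \<phi> (F x))"
      unfolding w_def by (rule sum.reindex_bij_betw[OF h])
    finally show "(\<Sum>k<K. 2 ^ k * \<phi> (c k)) \<le> 3 * (\<Sum>x\<in>V. \<phi> (F x))" .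
    qed
  qed
qed

section \<open>Averages over the neighbourhoods of a pseudorandom graph\<close>

text \<open>The only facts about spheres that the analysis uses. \<open>D\<^sup>2 / q ^ d\<close> is
  the number of common neighbours expected in a random graph of degree \<open>D\<close>; the
  exponent \<open>(d - 1) div 2\<close> of the deviation is that of the error in the number of
  points on a sphere.\<close>

locale distance_graph =
  fixes V :: "'v set" and R :: "'v \<Rightarrow> 'v \<Rightarrow> bool" and q D :: real and d :: nat
  assumes finite_V: "finite V" and card_V: "real (card V) = q ^ d"
    and q_ge_3: "3 \<le> q" and d_ge_2: "2 \<le> d"
    and sym: "\<And>x y. \<lbrakk>x \<in> V; y \<in> V; R x y\<rbrakk> \<Longrightarrow> R y x"
    and degree: "\<And>x. x \<in> V \<Longrightarrow> real (card {y \<in> V. R x y}) = D"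
    and degree_ge: "q ^ (d - 1) / 2 \<le> D" and degree_le: "D \<le> 2 * q ^ (d - 1)"
    and codegree_le: "\<And>x y. \<lbrakk>x \<in> V; y \<in> V; x \<noteq> y\<rbrakk> \<Longrightarrow>
      real (card {z \<in> V. R x z \<and> R y z}) \<le> D\<^sup>2 / q ^ d + 4 * q ^ ((d - 1) div 2)"
begin

section \<open>Edge counts between two sets of vertices\<close>

definition edges :: "'v set \<Rightarrow> 'v set \<Rightarrow> real" where
  "edges E F = (\<Sum>x\<in>E. \<Sum>y\<in>F. of_bool (R x y))"

text \<open>Reciprocal of the endpoint exponent \<open>(d + 1) / d\<close>, which is also the
  exponent dual to \<open>d + 1\<close>; hence both entries of the bilinear form carry the same
  power.\<close>

definition \<delta> :: real where "\<delta> = real d / (real d + 1)"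

lemma q_pos: "0 < q" and q_ge_1: "1 \<le> q"
  using q_ge_3 by auto

lemma sym_iff: "x \<in> V \<Longrightarrow> y \<in> V \<Longrightarrow> R x y \<longleftrightarrow> R y x"
  using sym by blast

lemma edges_commute: "E \<subseteq> V \<Longrightarrow> F \<subseteq> V \<Longrightarrow> edges E F = edges F E"
  unfolding edges_def by (subst sum.swap) (intro sum.cong refl, simp add: sym_iff subset_iff)

lemma edges_le_card: "finite E \<Longrightarrow> finite F \<Longrightarrow> edges E F \<le> real (card E) * real (card F)"
proof -
  have "edges E F \<le> (\<Sum>x\<in>E. \<Sum>y\<in>F. 1)" unfolding edges_def by (intro sum_mono) simp
  then show ?thesis by simp
qed

lemma sum_adjacent: "x \<in> V \<Longrightarrow> (\<Sum>y\<in>V. of_bool (R x y)) = D"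
  by (simp only: sum_of_bool_eq_card[OF finite_V] degree)

text \<open>Second moment method: the number \<open>T y\<close> of neighbours of \<open>y\<close> in
  \<open>E\<close> has mean \<open>\<mu>\<close>, the codegree bound controls its variance over
  \<open>V\<close>, and Cauchy-Schwarz restricts to \<open>F\<close>. The error is not symmetric in
  \<open>E\<close> and \<open>F\<close>; taking the smaller set as \<open>E\<close> gives the better
  bound.\<close>

lemma edges_mixing:
  assumes E: "E \<subseteq> V" and F: "F \<subseteq> V"
  shows "edges E F \<le> D * (real (card E) * real (card F)) / q ^ d +
    sqrt (real (card F) * (D * real (card E) + 4 * q ^ ((d - 1) div 2) * (real (card E))\<^sup>2))"
proof -
  define \<kappa> where "\<kappa> = 4 * q ^ ((d - 1) div 2)"
  have \<kappa>: "0 \<le> \<kappa>" using q_pos by (simp add: \<kappa>_def)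
  have Q: "0 < q ^ d" using q_pos by simp
  have fin: "finite E" "finite F" using E F finite_V finite_subset by auto
  define n where "n = real (card E)"
  define T where "T = (\<lambda>y. \<Sum>x\<in>E. of_bool (R x y) :: real)"
  define \<mu> where "\<mu> = D * n / q ^ d"
  have sumT: "(\<Sum>y\<in>V. T y) = D * n"
  proof -
    have "(\<Sum>y\<in>V. T y) = (\<Sum>x\<in>E. \<Sum>y\<in>V. of_bool (R x y))" unfolding T_def by (rule sum.swap)
    also have "\<dots> = (\<Sum>x\<in>E. D)" using E by (intro sum.cong refl sum_adjacent) auto
    finally show ?thesis by (simp add: n_def)
  qed
  have codeg: "(\<Sum>y\<in>V. of_bool (R x y) * of_bool (R x' y)) \<le>
      D\<^sup>2 / q ^ d + \<kappa> + (if x' = x then D else 0)" if "x \<in> E" "x' \<in> E" for x x'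
  proof -
    have eq: "(\<Sum>y\<in>V. of_bool (R x y) * of_bool (R x' y)) = real (card {y \<in> V. R x y \<and> R x' y})"
      using sum_of_bool_eq_card[OF finite_V, of "\<lambda>y. R x y \<and> R x' y"] by (simp add: of_bool_conj)
    show ?thesis
    proof (cases "x' = x")
      case True
      then show ?thesis using eq degree[of x] that E \<kappa> Q by auto
    next
      case False
      then show ?thesis using eq codegree_le[of x x'] that E by (auto simp: \<kappa>_def)
    qed
  qed
  have "(\<Sum>y\<in>V. (T y)\<^sup>2) = (\<Sum>y\<in>V. \<Sum>x\<in>E. \<Sum>x'\<in>E. of_bool (R x y) * of_bool (R x' y))"
    by (simp add: T_def power2_eq_square sum_product)
  also have "\<dots> = (\<Sum>x\<in>E. \<Sum>y\<in>V. \<Sum>x'\<in>E. of_bool (R x y) * of_bool (R x' y))"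
    by (rule sum.swap)
  also have "\<dots> = (\<Sum>x\<in>E. \<Sum>x'\<in>E. \<Sum>y\<in>V. of_bool (R x y) * of_bool (R x' y))"
    by (intro sum.cong refl sum.swap)
  also have "\<dots> \<le> (\<Sum>x\<in>E. \<Sum>x'\<in>E. D\<^sup>2 / q ^ d + \<kappa> + (if x' = x then D else 0))"
    by (intro sum_mono codeg)
  also have "\<dots> = (\<Sum>x\<in>E. n * (D\<^sup>2 / q ^ d + \<kappa>) + D)"
    using fin by (intro sum.cong refl) (simp add: sum.distrib n_def)
  also have "\<dots> = n\<^sup>2 * (D\<^sup>2 / q ^ d + \<kappa>) + D * n"
    by (simp add: n_def power2_eq_square algebra_simps)
  finally have sumT2: "(\<Sum>y\<in>V. (T y)\<^sup>2) \<le> n\<^sup>2 * (D\<^sup>2 / q ^ d + \<kappa>) + D * n" .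
  \<comment> \<open>The quadratic main terms cancel exactly, because the codegree hypothesis is
    centred at \<open>D\<^sup>2 / q ^ d\<close> and \<open>card V = q ^ d\<close>; only the diagonal
    and the deviation remain.\<close>
  have "(\<Sum>y\<in>V. (T y - \<mu>)\<^sup>2) = (\<Sum>y\<in>V. (T y)\<^sup>2) - 2 * \<mu> * (\<Sum>y\<in>V. T y) + real (card V) * \<mu>\<^sup>2"
    by (simp add: power2_diff sum.distrib sum_subtractf sum_distrib_left[symmetric] sum_distrib_right[symmetric] algebra_simps)
  also have "\<dots> = (\<Sum>y\<in>V. (T y)\<^sup>2) - n\<^sup>2 * (D\<^sup>2 / q ^ d)"
    unfolding sumT card_V \<mu>_def using Q by (simp add: field_simps power2_eq_square)
  also have "\<dots> \<le> D * n + \<kappa> * n\<^sup>2" using sumT2 by (simp add: algebra_simps)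
  finally have var: "(\<Sum>y\<in>V. (T y - \<mu>)\<^sup>2) \<le> D * n + \<kappa> * n\<^sup>2" .
  have "edges E F = (\<Sum>y\<in>F. T y)" unfolding edges_def T_def by (rule sum.swap)
  also have "\<dots> = real (card F) * \<mu> + (\<Sum>y\<in>F. 1 * (T y - \<mu>))" by (simp add: sum_subtractf)
  also have "(\<Sum>y\<in>F. 1 * (T y - \<mu>)) \<le> sqrt ((\<Sum>y\<in>F. 1\<^sup>2) * (\<Sum>y\<in>F. (T y - \<mu>)\<^sup>2))"
    by (rule real_le_rsqrt) (rule Cauchy_Schwarz_ineq_sum)
  also have "\<dots> \<le> sqrt (real (card F) * (D * n + \<kappa> * n\<^sup>2))"
  proof -
    have "(\<Sum>y\<in>F. (T y - \<mu>)\<^sup>2) \<le> (\<Sum>y\<in>V. (T y - \<mu>)\<^sup>2)"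
      by (rule sum_mono2[OF finite_V F]) simp
    then show ?thesis using var by (intro real_sqrt_le_mono) (simp add: mult_left_mono)
  qed
  finally show ?thesis by (simp add: \<mu>_def n_def \<kappa>_def mult_ac)
qed

text \<open>Blocks are known only through upper bounds for their size, so the mixing bound is made
  monotone in these. The square root is split so that each error term can be compared with its own
  part of the dyadic kernel.\<close>

lemma edges_le_of_card_le:
  assumes E: "E \<subseteq> V" and F: "F \<subseteq> V" and m: "real (card E) \<le> m" and n: "real (card F) \<le> n"
  shows "edges E F \<le> 2 * (m * n) / q + 2 * (q powr (real (d - 1) / 2) * (m * n) powr (1 / 2)) +
    2 * (q powr (real ((d - 1) div 2) / 2) * (m * n powr (1 / 2)))"
proof -
  have m0: "0 \<le> m" "0 \<le> n" using m n order_trans[OF of_nat_0_le_iff] by auto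
  have D0: "0 \<le> D" using degree_ge q_pos by (smt (verit) divide_nonneg_pos zero_less_power)
  have qd: "q ^ d = q * q ^ (d - 1)" using d_ge_2 by (cases d) auto
  define X where "X = 2 * q ^ (d - 1) * (m * n)"
  define Y where "Y = 4 * q ^ ((d - 1) div 2) * (m\<^sup>2 * n)"
  have XY: "0 \<le> X" "0 \<le> Y" using q_pos m0 by (auto simp: X_def Y_def)
  have "D * (real (card E) * real (card F)) / q ^ d \<le> 2 * q ^ (d - 1) * (m * n) / q ^ d"
    using m n m0 degree_le D0 q_pos by (intro divide_right_mono mult_mono) auto
  also have "\<dots> = 2 * (m * n) / q" using q_pos by (simp add: qd)
  finally have 1: "D * (real (card E) * real (card F)) / q ^ d \<le> 2 * (m * n) / q" .
  have "real (card F) * (D * real (card E) + 4 * q ^ ((d - 1) div 2) * (real (card E))\<^sup>2)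
      \<le> n * (2 * q ^ (d - 1) * m + 4 * q ^ ((d - 1) div 2) * m\<^sup>2)"
    using m n m0 degree_le D0 q_pos by (intro mult_mono add_mono power_mono) auto
  also have "\<dots> = X + Y" by (simp add: X_def Y_def algebra_simps)
  finally have "sqrt (real (card F) * (D * real (card E) + 4 * q ^ ((d - 1) div 2) * (real (card E))\<^sup>2))
      \<le> sqrt (X + Y)" by (rule real_sqrt_le_mono)
  also have "\<dots> \<le> sqrt X + sqrt Y" using XY by (rule sqrt_add_le_add_sqrt)
  also have "sqrt X \<le> 2 * (q powr (real (d - 1) / 2) * (m * n) powr (1 / 2))"
  proof -
    have "sqrt X = sqrt 2 * (sqrt (q ^ (d - 1)) * sqrt (m * n))" by (simp add: X_def real_sqrt_mult)
    also have "sqrt (q ^ (d - 1)) = q powr (real (d - 1) / 2)"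
      using q_pos by (simp add: powr_half_sqrt[symmetric] powr_powr flip: powr_realpow)
    also have "sqrt (m * n) = (m * n) powr (1 / 2)" using m0 by (simp add: powr_half_sqrt)
    finally show ?thesis using sqrt2_less_2 m0 by (simp add: mult_right_mono)
  qed
  also have "sqrt Y = 2 * (q powr (real ((d - 1) div 2) / 2) * (m * n powr (1 / 2)))"
  proof -
    have "sqrt Y = 2 * (sqrt (q ^ ((d - 1) div 2)) * (m * sqrt n))"
      using m0 by (simp add: Y_def real_sqrt_mult)
    also have "sqrt (q ^ ((d - 1) div 2)) = q powr (real ((d - 1) div 2) / 2)"
      using q_pos by (simp add: powr_half_sqrt[symmetric] powr_powr flip: powr_realpow)
    also have "sqrt n = n powr (1 / 2)" using m0 by (simp add: powr_half_sqrt)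
    finally show ?thesis .
  qed
  finally show ?thesis using edges_mixing[OF E F] 1 by linarith
qed

text \<open>Decay rate of the kernel in \<open>k + l\<close>. It may exceed neither
  \<open>1 - \<delta> = 2 * \<epsilon>\<close>, for small sets, nor
  \<open>\<delta> - 1 / 2 = 1 / 2 - 2 * \<epsilon>\<close>, for large ones; for \<open>d = 2\<close>
  the latter equals \<open>\<epsilon> = 1 / 6\<close>.\<close>

definition \<epsilon> :: real where "\<epsilon> = 1 / (real d + 1) / 2"

lemma epsilon_pos: "0 < \<epsilon>" and epsilon_le: "\<epsilon> \<le> 1 / 6"
  using d_ge_2 by (auto simp: \<epsilon>_def field_simps)

lemma two_epsilon: "2 * \<epsilon> = 1 / (real d + 1)"
  by (simp only: \<epsilon>_def mult_2 field_sum_of_halves)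

lemma delta_eq: "\<delta> = 1 - 2 * \<epsilon>"
  by (simp add: \<delta>_def two_epsilon diff_divide_eq_iff)

text \<open>For \<open>d = 2\<close> this rests on the upper bound for \<open>w\<close>, for \<open>d \<ge> 3\<close> on the lower one.\<close>

lemma mixing_error_le:
  assumes z: "q ^ (d - 1) \<le> w" and w: "w \<le> q ^ d * q ^ d"
  shows "q powr (real ((d - 1) div 2) / 2) * w powr (3 / 4)
    \<le> q powr (real (d - 1) / real (d + 1)) * w powr \<delta>"
proof (cases "d = 2")
  case True
  have w0: "0 < w" using z q_pos by (smt (verit) zero_less_power)
  \<comment> \<open>\<open>1 / 12\<close> is \<open>3 / 4 - \<delta>\<close> for
    \<open>d = 2\<close>, and \<open>(q powr 4) powr (1 / 12)\<close> is exactly the factor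
    \<open>q powr (1 / 3)\<close> available on the right.\<close>
  have "w powr (1 / 12) \<le> (q powr 4) powr (1 / 12)"
    using w w0 q_pos True by (intro powr_mono2) (auto simp: powr_numeral power_add[symmetric])
  also have "\<dots> = q powr (1 / 3)" by (simp add: powr_powr)
  finally have "w powr (1 / 12) * w powr (2 / 3) \<le> q powr (1 / 3) * w powr (2 / 3)"
    by (intro mult_right_mono) auto
  moreover have "w powr (1 / 12) * w powr (2 / 3) = w powr (3 / 4)"
    by (simp add: powr_add[symmetric])
  ultimately have "1 * w powr (3 / 4) \<le> q powr (1 / 3) * w powr (2 / 3)" by simp
  moreover have "\<delta> = 2 / 3" unfolding \<delta>_def using True by simp
  moreover have "real (d - 1) / real (d + 1) = 1 / 3"
    "q powr (real ((d - 1) div 2) / 2) = 1"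
    using True q_pos by auto
  ultimately show ?thesis by (simp only:)
next
  case False
  then have d3: "3 \<le> d" using d_ge_2 by simp
  have w0: "0 < w" using z q_pos by (smt (verit) zero_less_power)
  have e: "\<delta> - 3 / 4 = (real d - 3) / (4 * (real d + 1))" by (simp add: \<delta>_def field_simps)
  have e0: "0 \<le> \<delta> - 3 / 4" unfolding e using d3 by simp
  have "(q powr real (d - 1)) powr (\<delta> - 3 / 4) \<le> w powr (\<delta> - 3 / 4)"
    using z q_pos e0 by (intro powr_mono2) (auto simp: powr_realpow)
  then have *: "q powr (real (d - 1) * (\<delta> - 3 / 4)) * w powr (3 / 4) \<le> w powr (\<delta> - 3 / 4) * w powr (3 / 4)"
    by (intro mult_right_mono) (auto simp: powr_powr)
  \<comment> \<open>The right-hand side equals \<open>(d - 1) / 4\<close>, so the rounding in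
    \<open>(d - 1) div 2\<close> is all that separates the two sides.\<close>
  have exps: "real ((d - 1) div 2) / 2 \<le> real (d - 1) / real (d + 1) + real (d - 1) * (\<delta> - 3 / 4)"
  proof -
    have "real ((d - 1) div 2) / 2 \<le> real (d - 1) / 4" by linarith
    also have "\<dots> = real (d - 1) / real (d + 1) + real (d - 1) * (\<delta> - 3 / 4)"
    proof -
      have "real (d + 1) = real d + 1" by simp
      then show ?thesis unfolding \<delta>_def right_diff_distrib
        using convex_fraction_eq[of "real d" "real (d - 1)"] by (simp only:) linarith
    qed
    finally show ?thesis .
  qed
  have "q powr (real ((d - 1) div 2) / 2) \<le>
      q powr (real (d - 1) / real (d + 1) + real (d - 1) * (\<delta> - 3 / 4))"
    using exps q_ge_1 by (intro powr_mono) auto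
  then have "q powr (real ((d - 1) div 2) / 2) * w powr (3 / 4) \<le>
      q powr (real (d - 1) / real (d + 1)) * (q powr (real (d - 1) * (\<delta> - 3 / 4)) * w powr (3 / 4))"
    by (simp add: powr_add mult_right_mono flip: mult.assoc)
  also have "\<dots> \<le> q powr (real (d - 1) / real (d + 1)) * (w powr (\<delta> - 3 / 4) * w powr (3 / 4))"
    using * by (intro mult_left_mono) auto
  finally show ?thesis by (simp add: powr_add[symmetric])
qed

text \<open>Dyadic scale at which the trivial count \<open>m * n\<close> and the mixing term
  \<open>sqrt (q ^ (d - 1) * m * n)\<close> coincide, that is,
  \<open>m * n = q ^ (d - 1)\<close>.\<close>

definition \<nu> :: real where "\<nu> = log 2 (q ^ (d - 1))"

text \<open>With \<open>z = m * n / q ^ (d - 1)\<close> the endpoint size is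
  \<open>q ^ (d - 1) * z powr \<delta>\<close>. The trivial count carries the power 1 of
  \<open>z\<close> and is used for \<open>z \<le> 1\<close>; the mixing term carries the power
  \<open>1 / 2\<close> and is used for \<open>1 \<le> z\<close>. Either way a factor decaying in the
  distance of \<open>k + l\<close> from \<open>\<nu>\<close> is left over. The remaining error
  decays in \<open>\<bar>k - l\<bar>\<close>.\<close>

lemma edges_dyadic_ordered:
  assumes E: "E \<subseteq> V" and F: "F \<subseteq> V" and k: "card E \<le> 2 ^ k" and l: "card F \<le> 2 ^ l"
    and kV: "2 ^ k \<le> card V" and lV: "2 ^ l \<le> card V" and kl: "k \<le> l"
  shows "edges E F \<le> 2 * (2 ^ k * 2 ^ l) / q +
    2 * (q powr (real (d - 1) / real (d + 1)) * (2 ^ k * 2 ^ l) powr \<delta> *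
      (2 powr (- \<epsilon> * \<bar>real k + real l - \<nu>\<bar>) + 2 powr (- (1 / 4) * \<bar>real k - real l\<bar>)))"
proof -
  define m n w P where "m = (2::real) ^ k" and "n = (2::real) ^ l" and "w = m * n"
    and "P = q powr (real (d - 1) / real (d + 1))"
  have kV': "m \<le> q ^ d" using kV card_V by (metis m_def of_nat_le_iff of_nat_numeral of_nat_power)
  have lV': "n \<le> q ^ d" using lV card_V by (metis n_def of_nat_le_iff of_nat_numeral of_nat_power)
  have Em: "real (card E) \<le> m" using k by (metis m_def of_nat_le_iff of_nat_numeral of_nat_power)
  have Fn: "real (card F) \<le> n" using l by (metis n_def of_nat_le_iff of_nat_numeral of_nat_power)
  have m0: "0 < m" "0 < n" "0 < w" by (auto simp: m_def n_def w_def)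
  have P0: "0 < P" using q_pos by (simp add: P_def)
  define z where "z = w / q ^ (d - 1)"
  have z0: "0 < z" using m0 q_pos by (simp add: z_def)
  have wz: "w = q powr real (d - 1) * z" using q_pos by (simp add: z_def powr_realpow)
  have w2: "w = 2 powr (real k + real l)" by (simp add: w_def m_def n_def powr_add powr_realpow)
  have q2: "q ^ (d - 1) = 2 powr \<nu>"
    unfolding \<nu>_def by (rule powr_log_cancel[symmetric]) (use q_pos in auto)
  have z2: "z = 2 powr (real k + real l - \<nu>)" by (simp only: z_def q2 w2 powr_diff)
  have Pw: "P * w powr \<delta> = q powr real (d - 1) * z powr \<delta>"
  proof -
    have "P * w powr \<delta> = q powr (real (d - 1) / real (d + 1) + real (d - 1) * \<delta>) * z powr \<delta>"
      using q_pos z0 by (simp add: wz powr_mult powr_powr P_def powr_add)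
    also have "real (d - 1) / real (d + 1) + real (d - 1) * \<delta> = real (d - 1)"
      using convex_fraction_eq[of "real d" "real (d - 1)"] by (simp add: \<delta>_def add.commute)
    finally show ?thesis .
  qed
  have fin: "finite E" "finite F" using E F finite_V finite_subset by auto
  show ?thesis
  proof (cases "z \<le> 1")
    case True
    then have neg: "real k + real l - \<nu> \<le> 0"
      unfolding z2 using powr_le_cancel_iff[of 2 "real k + real l - \<nu>" 0] by simp
    have "edges E F \<le> real (card E) * real (card F)" using fin by (rule edges_le_card)
    also have "\<dots> \<le> w" unfolding w_def using Em Fn m0 by (intro mult_mono) auto
    also have "w = q powr real (d - 1) * (z powr \<delta> * z powr (1 - \<delta>))"
      using z0 by (subst wz) (simp add: powr_add[symmetric])
    also have "z powr (1 - \<delta>) \<le> z powr \<epsilon>"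
      using True z0 epsilon_pos by (intro powr_mono') (auto simp: delta_eq)
    also have "z powr \<epsilon> = 2 powr (- \<epsilon> * \<bar>real k + real l - \<nu>\<bar>)"
    proof -
      have "(real k + real l - \<nu>) * \<epsilon> = - \<epsilon> * \<bar>real k + real l - \<nu>\<bar>"
        using neg by (simp add: algebra_simps)
      then show ?thesis by (simp only: z2 powr_powr)
    qed
    finally have "edges E F \<le> P * w powr \<delta> * 2 powr (- \<epsilon> * \<bar>real k + real l - \<nu>\<bar>)"
      using Pw by (simp add: mult_left_mono mult.assoc)
    also have "\<dots> \<le> 2 * (P * w powr \<delta> *
        (2 powr (- \<epsilon> * \<bar>real k + real l - \<nu>\<bar>) + 2 powr (- (1 / 4) * \<bar>real k - real l\<bar>)))"
      using P0 by (simp add: algebra_simps)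
    finally show ?thesis using m0 q_pos
      unfolding P_def[symmetric] m_def[symmetric] n_def[symmetric] w_def[symmetric]
      by (smt (verit) divide_nonneg_pos)
  next
    case False
    then have z1: "1 \<le> z" by simp
    then have pos: "0 \<le> real k + real l - \<nu>"
      unfolding z2 using powr_le_cancel_iff[of 2 0 "real k + real l - \<nu>"] by simp
    have "q powr (real (d - 1) / 2) * w powr (1 / 2) = q powr real (d - 1) * z powr (1 / 2)"
      using q_pos z0 by (simp add: wz powr_mult powr_powr powr_add[symmetric])
    also have "z powr (1 / 2) \<le> z powr (\<delta> - \<epsilon>)"
      using z1 epsilon_le by (intro powr_mono) (auto simp: delta_eq)
    also have "\<dots> = z powr \<delta> * 2 powr (- \<epsilon> * \<bar>real k + real l - \<nu>\<bar>)"
      using pos z0 by (simp add: z2 powr_powr algebra_simps flip: powr_add)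
    finally have X: "q powr (real (d - 1) / 2) * w powr (1 / 2) \<le>
        P * w powr \<delta> * 2 powr (- \<epsilon> * \<bar>real k + real l - \<nu>\<bar>)"
      using Pw q_pos by (simp add: mult.assoc mult_left_mono)
    \<comment> \<open>This is \<open>(m * n) powr (3 / 4) * (m / n) powr (1 / 4)\<close>; since
      \<open>m \<le> n\<close>, the last factor is the gain off the diagonal.\<close>
    have "m * n powr (1 / 2) = w powr (3 / 4) * 2 powr (- (1 / 4) * \<bar>real k - real l\<bar>)"
    proof -
      have "m * n powr (1 / 2) = 2 powr (real k + real l * (1 / 2))"
        by (simp add: m_def n_def powr_powr powr_add flip: powr_realpow)
      also have "real k + real l * (1 / 2) =
          (real k + real l) * (3 / 4) + (- (1 / 4) * \<bar>real k - real l\<bar>)"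
      proof -
        have "\<bar>real k - real l\<bar> = real l - real k" using kl by simp
        then show ?thesis by (simp only:) (simp add: field_simps)
      qed
      finally have "m * n powr (1 / 2) =
          2 powr ((real k + real l) * (3 / 4)) * 2 powr (- (1 / 4) * \<bar>real k - real l\<bar>)"
        by (simp only: powr_add)
      moreover have "w powr (3 / 4) = 2 powr ((real k + real l) * (3 / 4))" by (simp only: w2 powr_powr)
      ultimately show ?thesis by (simp only:)
    qed
    moreover have "q powr (real ((d - 1) div 2) / 2) * w powr (3 / 4) \<le> P * w powr \<delta>"
      unfolding P_def
    proof (rule mixing_error_le)
      show "q ^ (d - 1) \<le> w" using z1 q_pos by (simp add: z_def)
      show "w \<le> q ^ d * q ^ d" unfolding w_def using kV' lV' m0 q_pos by (intro mult_mono) auto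
    qed
    ultimately have Y: "q powr (real ((d - 1) div 2) / 2) * (m * n powr (1 / 2)) \<le>
        P * w powr \<delta> * 2 powr (- (1 / 4) * \<bar>real k - real l\<bar>)"
      by (metis (no_types, opaque_lifting) mult.assoc mult_right_mono powr_ge_zero)
    show ?thesis
      using edges_le_of_card_le[OF E F Em Fn] X Y
      unfolding P_def[symmetric] m_def[symmetric] n_def[symmetric] w_def[symmetric]
      by (simp add: algebra_simps)
  qed
qed

lemma edges_dyadic:
  assumes E: "E \<subseteq> V" and F: "F \<subseteq> V" and k: "card E \<le> 2 ^ k" and l: "card F \<le> 2 ^ l"
    and kV: "2 ^ k \<le> card V" and lV: "2 ^ l \<le> card V"
  shows "edges E F \<le> 2 * (2 ^ k * 2 ^ l) / q +
    2 * (q powr (real (d - 1) / real (d + 1)) * (2 ^ k * 2 ^ l) powr \<delta> *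
      (2 powr (- \<epsilon> * \<bar>real k + real l - \<nu>\<bar>) + 2 powr (- (1 / 4) * \<bar>real k - real l\<bar>)))"
proof (cases "k \<le> l")
  case True
  then show ?thesis using edges_dyadic_ordered assms by blast
next
  case False
  then have "l \<le> k" by simp
  from edges_dyadic_ordered[OF F E l k lV kV this] edges_commute[OF E F]
  show ?thesis by (simp add: add.commute abs_minus_commute mult.commute)
qed

section \<open>Schur test and the bilinear endpoint bound\<close>

definition schur :: real where
  "schur = 2 powr \<epsilon> * (2 / (1 - 2 powr - \<epsilon>)) + 2 powr (1 / 4) * (2 / (1 - 2 powr - (1 / 4)))"

definition kern :: "nat \<Rightarrow> nat \<Rightarrow> real" where
  "kern k l = 2 powr (- \<epsilon> * \<bar>real k + real l - \<nu>\<bar>) + 2 powr (- (1 / 4) * \<bar>real k - real l\<bar>)"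

lemma kern_nonneg: "0 \<le> kern k l"
  by (simp add: kern_def)

lemma kern_commute: "kern k l = kern l k"
  by (simp add: kern_def add.commute abs_minus_commute)

text \<open>In \<open>k\<close> the two summands are centred at \<open>\<nu> - l\<close> and at
  \<open>l\<close>. The centre \<open>\<nu> - l\<close> depends on \<open>q\<close>, the bound does
  not: \<open>schur\<close> is a function of \<open>d\<close> alone.\<close>

lemma sum_kern_le: "(\<Sum>k<K. kern k l) \<le> schur"
proof -
  have "0 < \<epsilon>" by (simp add: \<epsilon>_def)
  from sum_powr_abs_diff_le[OF this, of "\<nu> - real l" K]
  have "(\<Sum>k<K. 2 powr (- \<epsilon> * \<bar>real k + real l - \<nu>\<bar>)) \<le> 2 powr \<epsilon> * (2 / (1 - 2 powr - \<epsilon>))"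
    by (simp add: algebra_simps)
  moreover have "(\<Sum>k<K. 2 powr (- (1 / 4) * \<bar>real k - real l\<bar>)) \<le>
      2 powr (1 / 4) * (2 / (1 - 2 powr - (1 / 4)))"
    by (rule sum_powr_abs_diff_le) simp
  ultimately show ?thesis by (simp add: kern_def schur_def sum.distrib)
qed

lemma schur_nonneg: "0 \<le> schur"
  using sum_kern_le[where K = 0] by simp

text \<open>By \<open>2 * a * b \<le> a\<^sup>2 + b\<^sup>2\<close> the sum splits into weighted row
  and column sums of \<open>kern\<close>, both bounded by \<open>schur\<close> because the kernel is
  symmetric.\<close>

lemma schur_test:
  assumes "\<And>k. k < K \<Longrightarrow> 0 \<le> a k" "\<And>l. l < L \<Longrightarrow> 0 \<le> b l"
  shows "(\<Sum>k<K. \<Sum>l<L. a k * b l * kern k l) \<le> schur * ((\<Sum>k<K. (a k)\<^sup>2) + (\<Sum>l<L. (b l)\<^sup>2)) / 2"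
proof -
  have "(\<Sum>k<K. \<Sum>l<L. a k * b l * kern k l) \<le>
      (\<Sum>k<K. \<Sum>l<L. (a k)\<^sup>2 / 2 * kern k l + (b l)\<^sup>2 / 2 * kern k l)"
  proof (intro sum_mono)
    fix k l
    have "a k * b l \<le> (a k)\<^sup>2 / 2 + (b l)\<^sup>2 / 2" using sum_squares_bound[of "a k" "b l"] by simp
    from mult_right_mono[OF this kern_nonneg[of k l]]
    show "a k * b l * kern k l \<le> (a k)\<^sup>2 / 2 * kern k l + (b l)\<^sup>2 / 2 * kern k l"
      by (simp add: distrib_right)
  qed
  also have "\<dots> = (\<Sum>k<K. (a k)\<^sup>2 / 2 * (\<Sum>l<L. kern k l)) + (\<Sum>k<K. \<Sum>l<L. (b l)\<^sup>2 / 2 * kern k l)"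
    by (simp add: sum.distrib sum_distrib_left)
  also have "(\<Sum>k<K. \<Sum>l<L. (b l)\<^sup>2 / 2 * kern k l) = (\<Sum>l<L. (b l)\<^sup>2 / 2 * (\<Sum>k<K. kern k l))"
    by (subst sum.swap) (simp add: sum_distrib_left)
  also have "(\<Sum>k<K. (a k)\<^sup>2 / 2 * (\<Sum>l<L. kern k l)) \<le> (\<Sum>k<K. (a k)\<^sup>2 / 2 * schur)"
    using sum_kern_le by (intro sum_mono mult_left_mono) (subst kern_commute, auto)
  also have "(\<Sum>l<L. (b l)\<^sup>2 / 2 * (\<Sum>k<K. kern k l)) \<le> (\<Sum>l<L. (b l)\<^sup>2 / 2 * schur)"
    using sum_kern_le by (intro sum_mono mult_left_mono) auto
  finally show ?thesis
    by (simp add: sum_distrib_left sum_distrib_right sum_divide_distrib algebra_simps add_divide_distrib)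
qed

lemma delta_bounds: "0 < \<delta>" "1 / 2 \<le> \<delta>" "\<delta> \<le> 1"
  using epsilon_pos epsilon_le by (auto simp: delta_eq)

text \<open>Uses \<open>1 \<le> 2 * \<delta>\<close>: each summand \<open>s\<close> of the
  hypothesis is at most 3, so \<open>(s / 3) powr (2 * \<delta>) \<le> s / 3\<close>, and the square
  is at most \<open>3 * s\<close>. This passage from summability to square summability is what lets
  the Schur test apply.\<close>

lemma sum_dyadic_squares_le:
  fixes c :: "nat \<Rightarrow> real"
  assumes c: "\<And>k. k < K \<Longrightarrow> 0 \<le> c k" and s: "(\<Sum>k<K. 2 ^ k * c k) \<le> 3"
  shows "(\<Sum>k<K. ((2 ^ k * c k) powr \<delta>)\<^sup>2) \<le> 9"
proof -
  have "((2 ^ k * c k) powr \<delta>)\<^sup>2 \<le> 3 * (2 ^ k * c k)" if k: "k < K" for k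
  proof -
    define s where "s = 2 ^ k * c k"
    have s0: "0 \<le> s" using c[OF k] by (simp add: s_def)
    have "s \<le> (\<Sum>k<K. 2 ^ k * c k)" unfolding s_def
      using k c by (intro member_le_sum) auto
    then have s3: "s / 3 \<le> 1" using s by simp
    have "(s powr \<delta>)\<^sup>2 = (3 * (s / 3)) powr (2 * \<delta>)"
      using s0 by (simp add: power2_eq_square powr_add[symmetric])
    also have "\<dots> = 3 powr (2 * \<delta>) * (s / 3) powr (2 * \<delta>)" by (rule powr_mult)
    also have "\<dots> \<le> 3 powr 2 * (s / 3) powr 1"
      using delta_bounds s0 s3 by (intro mult_mono powr_mono powr_mono') auto
    also have "\<dots> = 3 * s" using s0 by simp
    finally show ?thesis by (simp add: s_def)
  qed
  then have "(\<Sum>k<K. ((2 ^ k * c k) powr \<delta>)\<^sup>2) \<le> (\<Sum>k<K. 3 * (2 ^ k * c k))" by (intro sum_mono) auto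
  also have "\<dots> \<le> 9" using s by (simp add: sum_distrib_left[symmetric])
  finally show ?thesis .
qed

text \<open>The first 18 is \<open>2 * 3 * 3\<close>, from the density term with a factor 3 for each
  block sum; the second is \<open>2 * 9\<close>, from the Schur test with both square sums at most
  9.\<close>

definition B_const :: real where "B_const = 18 + 18 * schur"

lemma bilinear_normalized:
  assumes F: "\<And>x. x \<in> V \<Longrightarrow> 0 \<le> F x" and H: "\<And>x. x \<in> V \<Longrightarrow> 0 \<le> H x"
    and sF: "(\<Sum>x\<in>V. F x) = 1" and sH: "(\<Sum>x\<in>V. H x) = 1"
  shows "(\<Sum>x\<in>V. \<Sum>y\<in>V. of_bool (R x y) * (F x powr \<delta> * H y powr \<delta>))
    \<le> B_const * q powr (real (d - 1) / real (d + 1))"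
proof -
  define P where "P = q powr (real (d - 1) / real (d + 1))"
  have P0: "0 \<le> P" by (simp add: P_def)
  have ne: "V \<noteq> {}" using sF by auto
  obtain K f c where f: "\<And>x. x \<in> V \<Longrightarrow> f x < K" "\<And>x. x \<in> V \<Longrightarrow> F x \<le> c (f x)"
    "\<And>k. card {x \<in> V. f x = k} \<le> 2 ^ k" "\<And>k. k < K \<Longrightarrow> 2 ^ k \<le> card V" "\<And>k. k < K \<Longrightarrow> 0 \<le> c k"
    and fphi: "\<forall>\<phi>. mono_on {0..} \<phi> \<and> 0 \<le> \<phi> 0 \<longrightarrow>
       (\<Sum>k<K. 2 ^ k * \<phi> (c k)) \<le> (3::real) * (\<Sum>x\<in>V. \<phi> (F x))"
    by (rule dyadic_blocks[OF finite_V ne F that])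
  obtain L h e where h: "\<And>x. x \<in> V \<Longrightarrow> h x < L" "\<And>x. x \<in> V \<Longrightarrow> H x \<le> e (h x)"
    "\<And>k. card {x \<in> V. h x = k} \<le> 2 ^ k" "\<And>k. k < L \<Longrightarrow> 2 ^ k \<le> card V" "\<And>k. k < L \<Longrightarrow> 0 \<le> e k"
    and hphi: "\<forall>\<phi>. mono_on {0..} \<phi> \<and> 0 \<le> \<phi> 0 \<longrightarrow>
       (\<Sum>k<L. 2 ^ k * \<phi> (e k)) \<le> (3::real) * (\<Sum>x\<in>V. \<phi> (H x))"
    by (rule dyadic_blocks[OF finite_V ne H that])
  define A where "A = (\<lambda>k. {x \<in> V. f x = k})"
  define B where "B = (\<lambda>k. {x \<in> V. h x = k})"
  have sumA: "(\<Sum>k<K. \<Sum>x\<in>A k. g x) = (\<Sum>x\<in>V. g x)" for g :: "'v \<Rightarrow> real"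
    unfolding A_def using finite_V f(1) by (intro sum.group) auto
  have sumB: "(\<Sum>k<L. \<Sum>x\<in>B k. g x) = (\<Sum>x\<in>V. g x)" for g :: "'v \<Rightarrow> real"
    unfolding B_def using finite_V h(1) by (intro sum.group) auto
  define a where "a = (\<lambda>k. (2 ^ k * c k) powr \<delta>)"
  define b where "b = (\<lambda>k. (2 ^ k * e k) powr \<delta>)"
  have "(\<Sum>x\<in>V. \<Sum>y\<in>V. of_bool (R x y) * (F x powr \<delta> * H y powr \<delta>)) =
      (\<Sum>k<K. \<Sum>x\<in>A k. \<Sum>l<L. \<Sum>y\<in>B l. of_bool (R x y) * (F x powr \<delta> * H y powr \<delta>))"
    by (simp only: sumA sumB)
  also have "\<dots> = (\<Sum>k<K. \<Sum>l<L. \<Sum>x\<in>A k. \<Sum>y\<in>B l. of_bool (R x y) * (F x powr \<delta> * H y powr \<delta>))"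
    by (intro sum.cong refl sum.swap)
  also have "\<dots> \<le> (\<Sum>k<K. \<Sum>l<L. c k powr \<delta> * e l powr \<delta> * edges (A k) (B l))"
  proof (intro sum_mono)
    fix k l
    have "(\<Sum>x\<in>A k. \<Sum>y\<in>B l. of_bool (R x y) * (F x powr \<delta> * H y powr \<delta>)) \<le>
        (\<Sum>x\<in>A k. \<Sum>y\<in>B l. of_bool (R x y) * (c k powr \<delta> * e l powr \<delta>))"
    proof (intro sum_mono mult_left_mono mult_mono powr_mono2)
      fix x y assume "x \<in> A k" "y \<in> B l"
      then show "F x \<le> c k" "0 \<le> F x" "H y \<le> e l" "0 \<le> H y"
        using f(2)[of x] F[of x] h(2)[of y] H[of y] by (auto simp: A_def B_def)
    qed (use delta_bounds in auto)
    also have "\<dots> = c k powr \<delta> * e l powr \<delta> * edges (A k) (B l)"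
      by (simp add: edges_def sum_distrib_left mult_ac)
    finally show "(\<Sum>x\<in>A k. \<Sum>y\<in>B l. of_bool (R x y) * (F x powr \<delta> * H y powr \<delta>)) \<le>
        c k powr \<delta> * e l powr \<delta> * edges (A k) (B l)" .
  qed
  also have "\<dots> \<le> (\<Sum>k<K. \<Sum>l<L. 2 / q * ((2 ^ k * c k powr \<delta>) * (2 ^ l * e l powr \<delta>)) +
      2 * P * (a k * b l * kern k l))"
  proof (intro sum_mono)
    fix k l assume "k \<in> {..<K}" "l \<in> {..<L}"
    then have kl: "k < K" "l < L" by auto
    have "edges (A k) (B l) \<le> 2 * (2 ^ k * 2 ^ l) / q + 2 * (P * (2 ^ k * 2 ^ l) powr \<delta> * kern k l)"
      unfolding P_def kern_def
      using kl f(3,4) h(3,4) by (intro edges_dyadic) (auto simp: A_def B_def)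
    then have "c k powr \<delta> * e l powr \<delta> * edges (A k) (B l) \<le> c k powr \<delta> * e l powr \<delta> *
        (2 * (2 ^ k * 2 ^ l) / q + 2 * (P * (2 ^ k * 2 ^ l) powr \<delta> * kern k l))"
      by (intro mult_left_mono) auto
    also have "\<dots> = 2 / q * ((2 ^ k * c k powr \<delta>) * (2 ^ l * e l powr \<delta>)) +
      2 * P * (a k * b l * kern k l)"
      using f(5)[OF kl(1)] h(5)[OF kl(2)] by (simp add: a_def b_def powr_mult algebra_simps)
    finally show "c k powr \<delta> * e l powr \<delta> * edges (A k) (B l) \<le>
      2 / q * ((2 ^ k * c k powr \<delta>) * (2 ^ l * e l powr \<delta>)) + 2 * P * (a k * b l * kern k l)" .
  qed
  \<comment> \<open>The density term is a product of a sum over \<open>k\<close> and a sum over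
    \<open>l\<close>, so it is handled by concavity without any decay; only the excess goes through
    the Schur test.\<close>
  also have "\<dots> = 2 / q * ((\<Sum>k<K. 2 ^ k * c k powr \<delta>) * (\<Sum>l<L. 2 ^ l * e l powr \<delta>)) +
      2 * P * (\<Sum>k<K. \<Sum>l<L. a k * b l * kern k l)"
    by (simp only: sum_product sum.distrib) (simp only: sum_distrib_left)
  also have "\<dots> \<le> 18 * P + 2 * P * (9 * schur)"
  proof (rule add_mono)
    have le: "(\<Sum>x\<in>V. g x powr \<delta>) \<le> q powr (real d * (1 - \<delta>))"
      if "\<And>x. x \<in> V \<Longrightarrow> 0 \<le> g x" "(\<Sum>x\<in>V. g x) = 1" for g
      using sum_powr_le[of V g \<delta>] finite_V that delta_bounds card_V q_pos
      by (simp add: powr_powr flip: powr_realpow)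
    have mono_powr: "mono_on {0..} (\<lambda>s. s powr \<delta>) \<and> 0 \<le> (0::real) powr \<delta>"
      using delta_bounds by (auto simp: mono_on_def intro: powr_mono2)
    have "(\<Sum>k<K. 2 ^ k * c k powr \<delta>) \<le> 3 * (\<Sum>x\<in>V. F x powr \<delta>)"
      using fphi[rule_format, OF mono_powr] by simp
    then have 1: "(\<Sum>k<K. 2 ^ k * c k powr \<delta>) \<le> 3 * q powr (real d * (1 - \<delta>))"
      using le[of F] F sF by auto
    have "(\<Sum>k<L. 2 ^ k * e k powr \<delta>) \<le> 3 * (\<Sum>x\<in>V. H x powr \<delta>)"
      using hphi[rule_format, OF mono_powr] by simp
    then have 2: "(\<Sum>k<L. 2 ^ k * e k powr \<delta>) \<le> 3 * q powr (real d * (1 - \<delta>))"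
      using le[of H] H sH by auto
    have "2 / q * ((\<Sum>k<K. 2 ^ k * c k powr \<delta>) * (\<Sum>l<L. 2 ^ l * e l powr \<delta>)) \<le>
        2 / q * ((3 * q powr (real d * (1 - \<delta>))) * (3 * q powr (real d * (1 - \<delta>))))"
      using 1 2 q_pos by (intro mult_left_mono mult_mono) (auto intro!: sum_nonneg)
    also have "\<dots> = 18 * (q powr (real d * (1 - \<delta>) + real d * (1 - \<delta>)) / q powr 1)"
      using q_pos by (simp only: powr_add powr_one[OF less_imp_le]) simp
    also have "q powr (real d * (1 - \<delta>) + real d * (1 - \<delta>)) / q powr 1 =
        q powr (real d * (1 - \<delta>) + real d * (1 - \<delta>) - 1)" by (rule powr_diff[symmetric])
    \<comment> \<open>Both factors contribute \<open>d * (1 - \<delta>) = d / (d + 1)\<close>; after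
      division by \<open>q\<close> the power of \<open>q\<close> is the same as in the Schur
      part.\<close>
    also have "real d * (1 - \<delta>) + real d * (1 - \<delta>) - 1 = real (d - 1) / real (d + 1)"
    proof -
      have "1 - \<delta> = 1 / (real d + 1)" by (simp add: delta_eq two_epsilon)
      then have e: "real d * (1 - \<delta>) = real d / (real d + 1)" by simp
      show ?thesis unfolding e using d_ge_2 by (simp add: of_nat_diff divide_simps)
    qed
    finally show "2 / q * ((\<Sum>k<K. 2 ^ k * c k powr \<delta>) * (\<Sum>l<L. 2 ^ l * e l powr \<delta>)) \<le> 18 * P"
      by (simp add: P_def)
    have "(\<Sum>k<K. (a k)\<^sup>2) \<le> 9" unfolding a_def
      using fphi[rule_format, of "\<lambda>s. s"] sF f(5) by (intro sum_dyadic_squares_le) (auto simp: mono_on_def)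
    moreover have "(\<Sum>k<L. (b k)\<^sup>2) \<le> 9" unfolding b_def
      using hphi[rule_format, of "\<lambda>s. s"] sH h(5) by (intro sum_dyadic_squares_le) (auto simp: mono_on_def)
    ultimately have "schur * ((\<Sum>k<K. (a k)\<^sup>2) + (\<Sum>l<L. (b l)\<^sup>2)) / 2 \<le> schur * (9 + 9) / 2"
      using schur_nonneg by (intro divide_right_mono mult_left_mono add_mono) auto
    moreover have "(\<Sum>k<K. \<Sum>l<L. a k * b l * kern k l) \<le>
        schur * ((\<Sum>k<K. (a k)\<^sup>2) + (\<Sum>l<L. (b l)\<^sup>2)) / 2"
      by (rule schur_test) (auto simp: a_def b_def)
    ultimately show "2 * P * (\<Sum>k<K. \<Sum>l<L. a k * b l * kern k l) \<le> 2 * P * (9 * schur)"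
      using P0 by (intro mult_left_mono) auto
  qed
  finally show ?thesis by (simp add: P_def B_const_def algebra_simps)
qed

lemma bilinear:
  assumes F: "\<And>x. x \<in> V \<Longrightarrow> 0 \<le> F x" and H: "\<And>x. x \<in> V \<Longrightarrow> 0 \<le> H x"
  shows "(\<Sum>x\<in>V. \<Sum>y\<in>V. of_bool (R x y) * (F x powr \<delta> * H y powr \<delta>))
    \<le> B_const * q powr (real (d - 1) / real (d + 1)) * ((\<Sum>x\<in>V. F x) powr \<delta> * (\<Sum>x\<in>V. H x) powr \<delta>)"
proof (cases "(\<Sum>x\<in>V. F x) = 0 \<or> (\<Sum>x\<in>V. H x) = 0")
  case True
  then have "(\<forall>x\<in>V. F x = 0) \<or> (\<forall>x\<in>V. H x = 0)"
    using finite_V F H by (simp add: sum_nonneg_eq_0_iff)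
  then have "(\<Sum>x\<in>V. \<Sum>y\<in>V. of_bool (R x y) * (F x powr \<delta> * H y powr \<delta>)) = 0"
    by (auto intro!: sum.neutral)
  then show ?thesis using True by auto
next
  case False
  define s t where "s = (\<Sum>x\<in>V. F x)" and "t = (\<Sum>x\<in>V. H x)"
  have st: "0 < s" "0 < t" using False F H by (auto simp: s_def t_def less_le sum_nonneg)
  have "(\<Sum>x\<in>V. \<Sum>y\<in>V. of_bool (R x y) * ((F x / s) powr \<delta> * (H y / t) powr \<delta>))
    \<le> B_const * q powr (real (d - 1) / real (d + 1))"
    using st F H by (intro bilinear_normalized)
      (auto simp: sum_divide_distrib[symmetric] s_def[symmetric] t_def[symmetric])
  moreover have "(\<Sum>x\<in>V. \<Sum>y\<in>V. of_bool (R x y) * ((F x / s) powr \<delta> * (H y / t) powr \<delta>)) =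
      (\<Sum>x\<in>V. \<Sum>y\<in>V. of_bool (R x y) * (F x powr \<delta> * H y powr \<delta>)) / (s powr \<delta> * t powr \<delta>)"
    using F H st by (simp add: sum_divide_distrib powr_divide)
  ultimately show ?thesis using st by (simp add: s_def[symmetric] t_def[symmetric] divide_le_eq)
qed

section \<open>Spherical averages at the endpoint\<close>

definition avg :: "('v \<Rightarrow> real) \<Rightarrow> 'v \<Rightarrow> real" where
  "avg f y = (\<Sum>x\<in>V. of_bool (R x y) * f x) / D"

text \<open>\<open>2 ^ (d + 1)\<close> comes from \<open>q ^ (d - 1) / 2 \<le> D\<close>, the rest
  from raising the bilinear bound to the power \<open>d + 1\<close>.\<close>

definition avg_const :: "real \<Rightarrow> real" where
  "avg_const M = (2 * B_const) ^ (d + 1) * M ^ d"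

lemma B_const_pos: "0 < B_const"
  using schur_nonneg by (simp add: B_const_def)

lemma D_pos: "0 < D"
  using degree_ge q_pos by (smt (verit) divide_pos_pos zero_less_power)

lemma avg_mono: "(\<And>x. x \<in> V \<Longrightarrow> f x \<le> g x) \<Longrightarrow> avg f y \<le> avg g y"
  unfolding avg_def using D_pos by (intro divide_right_mono sum_mono mult_left_mono) auto

lemma sum_neighbours: "(\<Sum>x\<in>V. of_bool (R x y) * f x) = (\<Sum>x\<in>{x \<in> V. R x y}. f x)" for f :: "'v \<Rightarrow> real"
  by (simp add: sum.inter_filter[OF finite_V] of_bool_def if_distrib[of "\<lambda>c. c * _"] cong: if_cong)

lemma card_neighbours: "y \<in> V \<Longrightarrow> real (card {x \<in> V. R x y}) = D"
proof -
  assume y: "y \<in> V"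
  then have "{x \<in> V. R x y} = {x \<in> V. R y x}" using sym_iff by blast
  then show ?thesis using degree[OF y] by simp
qed

text \<open>Jensen's inequality on the \<open>D\<close> neighbours of \<open>y\<close>.\<close>

lemma avg_powr_le_powr_avg:
  assumes F: "\<And>x. x \<in> V \<Longrightarrow> 0 \<le> F x" and y: "y \<in> V" and \<theta>: "0 \<le> \<theta>" "\<theta> \<le> 1"
  shows "avg (\<lambda>x. F x powr \<theta>) y \<le> avg F y powr \<theta>"
proof -
  let ?W = "{x \<in> V. R x y}"
  have "(\<Sum>x\<in>?W. F x powr \<theta>) \<le> D powr (1 - \<theta>) * (\<Sum>x\<in>?W. F x) powr \<theta>"
    using sum_powr_le[of ?W F \<theta>] F \<theta> finite_V card_neighbours[OF y] by simp
  then have "avg (\<lambda>x. F x powr \<theta>) y \<le> D powr (1 - \<theta>) * (\<Sum>x\<in>?W. F x) powr \<theta> / D"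
    unfolding avg_def sum_neighbours using D_pos by (intro divide_right_mono) auto
  also have "D powr (1 - \<theta>) = D / D powr \<theta>" using D_pos by (simp add: powr_diff)
  also have "D / D powr \<theta> * (\<Sum>x\<in>?W. F x) powr \<theta> / D = (\<Sum>x\<in>?W. F x) powr \<theta> / D powr \<theta>"
    using D_pos by simp
  also have "\<dots> = avg F y powr \<theta>"
    unfolding avg_def sum_neighbours using D_pos by (simp add: powr_divide)
  finally show ?thesis .
qed

lemma avg_ge_1:
  assumes F: "\<And>x. x \<in> V \<Longrightarrow> 1 \<le> F x" and y: "y \<in> V"
  shows "1 \<le> avg F y"
proof -
  have "(\<Sum>x\<in>{x \<in> V. R x y}. 1) \<le> (\<Sum>x\<in>{x \<in> V. R x y}. F x)" using F by (intro sum_mono) auto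
  then show ?thesis unfolding avg_def sum_neighbours using card_neighbours[OF y] D_pos by simp
qed

text \<open>Duality with \<open>H = U ^ (d + 1)\<close>: then
  \<open>H powr \<delta> = U ^ d\<close>, so the bilinear form reproduces \<open>t\<close>, the sum
  of \<open>H\<close>, and its bound becomes an inequality for \<open>t\<close> alone.\<close>

lemma sum_avg_endpoint_le:
  assumes F: "\<And>x. x \<in> V \<Longrightarrow> 0 \<le> F x" and s: "(\<Sum>x\<in>V. F x) \<le> M * q ^ d"
  shows "(\<Sum>y\<in>V. avg (\<lambda>x. F x powr \<delta>) y ^ (d + 1)) \<le> avg_const M * q ^ d"
proof -
  define P where "P = q powr (real (d - 1) / real (d + 1))"
  define U where "U = (\<lambda>y. \<Sum>x\<in>V. of_bool (R x y) * F x powr \<delta>)"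
  define t where "t = (\<Sum>y\<in>V. U y ^ (d + 1))"
  define s' where "s' = (\<Sum>x\<in>V. F x)"
  have U0: "0 \<le> U y" for y by (simp add: U_def sum_nonneg)
  have t0: "0 \<le> t" using U0 by (simp add: t_def sum_nonneg)
  have s0: "0 \<le> s'" using F by (simp add: s'_def sum_nonneg)
  have root: "(x powr \<delta>) ^ (d + 1) = x ^ d" if "0 \<le> x" for x
  proof (cases "x = 0")
    case False
    then have "(x powr \<delta>) ^ (d + 1) = x powr (\<delta> * real (d + 1))"
      using that by (subst powr_realpow[symmetric]) (auto simp: powr_powr)
    also have "\<delta> * real (d + 1) = real d" by (simp add: \<delta>_def add.commute)
    finally show ?thesis using False that by (simp add: powr_realpow)
  qed (use d_ge_2 in auto)
  have Upow: "(U y ^ (d + 1)) powr \<delta> = U y ^ d" for y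
  proof (cases "U y = 0")
    case False
    then have "(U y ^ (d + 1)) powr \<delta> = (U y powr real (d + 1)) powr \<delta>"
      using U0[of y] by (subst powr_realpow) auto
    also have "\<dots> = U y powr real d" by (simp only: powr_powr) (simp add: \<delta>_def add.commute)
    finally show ?thesis using False U0[of y] by (simp add: powr_realpow)
  qed (use d_ge_2 in auto)
  have "t = (\<Sum>y\<in>V. (\<Sum>x\<in>V. of_bool (R x y) * F x powr \<delta>) * U y ^ d)" by (simp add: t_def U_def)
  also have "\<dots> = (\<Sum>y\<in>V. \<Sum>x\<in>V. of_bool (R x y) * (F x powr \<delta> * (U y ^ (d + 1)) powr \<delta>))"
    by (simp only: Upow sum_distrib_right mult.assoc)
  also have "\<dots> = (\<Sum>x\<in>V. \<Sum>y\<in>V. of_bool (R x y) * (F x powr \<delta> * (U y ^ (d + 1)) powr \<delta>))"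
    by (rule sum.swap)
  also have "\<dots> \<le> B_const * P * (s' powr \<delta> * t powr \<delta>)"
    unfolding P_def s'_def t_def using F U0 by (intro bilinear) auto
  finally have le: "t \<le> B_const * P * (s' powr \<delta> * t powr \<delta>)" .
  have bound: "t \<le> B_const ^ (d + 1) * q ^ (d - 1) * s' ^ d"
  proof (cases "t = 0")
    case True
    then show ?thesis using B_const_pos q_pos s0 by simp
  next
    case False
    then have tp: "0 < t" using t0 by simp
    \<comment> \<open>Raising to the power \<open>d + 1\<close> makes all exponents integral, and
      \<open>t ^ d\<close> cancels.\<close>
    have "t * t ^ d = t ^ (d + 1)" by simp
    also have "\<dots> \<le> (B_const * P * (s' powr \<delta> * t powr \<delta>)) ^ (d + 1)"
      using le t0 by (intro power_mono) auto
    also have "\<dots> = B_const ^ (d + 1) * P ^ (d + 1) * (s' powr \<delta>) ^ (d + 1) * (t powr \<delta>) ^ (d + 1)"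
      by (simp only: power_mult_distrib mult.assoc)
    also have "\<dots> = B_const ^ (d + 1) * q ^ (d - 1) * s' ^ d * t ^ d"
    proof -
      have "P ^ (d + 1) = P powr real (d + 1)" using q_pos by (subst powr_realpow) (auto simp: P_def)
      also have "\<dots> = q powr real (d - 1)"
        unfolding P_def powr_powr by simp
      also have "\<dots> = q ^ (d - 1)" using q_pos by (simp add: powr_realpow)
      finally show ?thesis using root[OF s0] root[OF t0] by (simp only:)
    qed
    finally show ?thesis using tp by simp
  qed
  have "(\<Sum>y\<in>V. avg (\<lambda>x. F x powr \<delta>) y ^ (d + 1)) = t / D ^ (d + 1)"
    unfolding avg_def t_def U_def by (simp only: power_divide sum_divide_distrib[symmetric])
  also have "\<dots> \<le> B_const ^ (d + 1) * q ^ (d - 1) * (M * q ^ d) ^ d / (q ^ (d - 1) / 2) ^ (d + 1)"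
  proof (rule frac_le)
    have "B_const ^ (d + 1) * q ^ (d - 1) * s' ^ d \<le> B_const ^ (d + 1) * q ^ (d - 1) * (M * q ^ d) ^ d"
      using s s0 B_const_pos q_pos by (intro mult_left_mono power_mono) (auto simp: s'_def)
    then show "t \<le> B_const ^ (d + 1) * q ^ (d - 1) * (M * q ^ d) ^ d" using bound by linarith
    show "0 \<le> B_const ^ (d + 1) * q ^ (d - 1) * (M * q ^ d) ^ d"
      using B_const_pos q_pos s s0 by (auto simp: s'_def)
    show "0 < (q ^ (d - 1) / 2) ^ (d + 1)" using q_pos by simp
    show "(q ^ (d - 1) / 2) ^ (d + 1) \<le> D ^ (d + 1)"
      using degree_ge q_pos by (intro power_mono) auto
  qed
  also have "\<dots> = avg_const M * (q ^ (d - 1) * (q ^ d) ^ d / (q ^ (d - 1)) ^ (d + 1))"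
    by (simp add: avg_const_def power_mult_distrib power_divide field_simps)
  \<comment> \<open>Power count: \<open>(d - 1) + d * d = d + (d - 1) * (d + 1)\<close>.\<close>
  also have "q ^ (d - 1) * (q ^ d) ^ d / (q ^ (d - 1)) ^ (d + 1) = q ^ d"
  proof -
    obtain e where e: "d = Suc e" using d_ge_2 by (cases d) auto
    have "q ^ (d - 1) * (q ^ d) ^ d = q ^ d * (q ^ (d - 1)) ^ (d + 1)"
      unfolding e power_mult[symmetric] power_add[symmetric] by (rule arg_cong[of _ _ "(^) q"]) simp
    then show ?thesis using q_pos by (simp only:) simp
  qed
  finally show ?thesis .
qed

text \<open>One \<open>G\<close> serves all \<open>u \<le> \<delta>\<close> at once, since Jensen's
  inequality reduces the exponent \<open>u\<close> to the endpoint. \<open>G\<close> is again at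
  least 1 with bounded mean, so the estimate can be iterated.\<close>

lemma avg_powr_le:
  assumes F: "\<And>x. x \<in> V \<Longrightarrow> 1 \<le> F x" and s: "(\<Sum>x\<in>V. F x) \<le> M * q ^ d"
  obtains G where "\<And>y. y \<in> V \<Longrightarrow> 1 \<le> G y" "(\<Sum>y\<in>V. G y) \<le> avg_const M * q ^ d"
    "\<And>u y. \<lbrakk>0 \<le> u; u \<le> \<delta>; y \<in> V\<rbrakk> \<Longrightarrow> avg (\<lambda>x. F x powr u) y \<le> G y powr (u / d)"
proof
  let ?A = "avg (\<lambda>x. F x powr \<delta>)"
  have A: "1 \<le> ?A y" if "y \<in> V" for y
    using that F delta_bounds by (intro avg_ge_1 ge_one_powr_ge_zero) auto
  show "1 \<le> ?A y ^ (d + 1)" if "y \<in> V" for y using A[OF that] by (rule one_le_power)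
  show "(\<Sum>y\<in>V. ?A y ^ (d + 1)) \<le> avg_const M * q ^ d"
    using F s by (intro sum_avg_endpoint_le) (auto intro: order_trans[OF zero_le_one])
  fix u y assume u: "0 \<le> u" "u \<le> \<delta>" and y: "y \<in> V"
  have "avg (\<lambda>x. F x powr u) y = avg (\<lambda>x. (F x powr \<delta>) powr (u / \<delta>)) y"
    using delta_bounds by (simp add: powr_powr)
  also have "\<dots> \<le> ?A y powr (u / \<delta>)"
    using u y delta_bounds by (intro avg_powr_le_powr_avg) auto
  also have "u / \<delta> = real (d + 1) * (u / d)" using d_ge_2 by (simp add: \<delta>_def field_simps)
  also have "?A y powr (real (d + 1) * (u / d)) = (?A y ^ (d + 1)) powr (u / d)"
    using A[OF y] by (subst powr_powr[symmetric], subst powr_realpow) auto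
  finally show "avg (\<lambda>x. F x powr u) y \<le> (?A y ^ (d + 1)) powr (u / d)" .
qed

section \<open>Weighted paths of length two\<close>

definition path_sum :: "('v \<Rightarrow> real) \<Rightarrow> ('v \<Rightarrow> real) \<Rightarrow> ('v \<Rightarrow> real) \<Rightarrow> real" where
  "path_sum f1 f2 f3 = (\<Sum>x1\<in>V. \<Sum>x2\<in>V. \<Sum>x3\<in>V.
     of_bool (R x1 x2) * of_bool (R x2 x3) * (f1 x1 * f2 x2 * f3 x3))"

lemma path_sum_commute: "path_sum f1 f2 f3 = path_sum f3 f2 f1"
proof -
  have "path_sum f1 f2 f3 = (\<Sum>x3\<in>V. \<Sum>x1\<in>V. \<Sum>x2\<in>V.
      of_bool (R x1 x2) * of_bool (R x2 x3) * (f1 x1 * f2 x2 * f3 x3))"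
    unfolding path_sum_def by (subst sum.swap[where A = V and B = V, of "\<lambda>x2 x3. _ x2 x3"]) (rule sum.swap)
  also have "\<dots> = (\<Sum>x3\<in>V. \<Sum>x2\<in>V. \<Sum>x1\<in>V.
      of_bool (R x1 x2) * of_bool (R x2 x3) * (f1 x1 * f2 x2 * f3 x3))"
    by (intro sum.cong refl sum.swap)
  also have "\<dots> = path_sum f3 f2 f1"
    unfolding path_sum_def by (intro sum.cong refl) (auto simp: sym_iff)
  finally show ?thesis .
qed

text \<open>Evaluation inwards from \<open>x3\<close>, for the case that the exponent at
  \<open>x1\<close> is too large to be averaged. The alternative \<open>path_sum_eq_centre\<close>
  averages both ends onto the centre.\<close>

lemma path_sum_eq_nested:
  "path_sum f1 f2 f3 = D\<^sup>2 * (\<Sum>x\<in>V. f1 x * avg (\<lambda>y. f2 y * avg f3 y) x)"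
proof -
  have "D\<^sup>2 * (\<Sum>x\<in>V. f1 x * avg (\<lambda>y. f2 y * avg f3 y) x) =
      (\<Sum>x\<in>V. \<Sum>y\<in>V. \<Sum>z\<in>V. of_bool (R y x) * of_bool (R z y) * (f1 x * f2 y * f3 z))"
    using D_pos by (simp add: avg_def sum_distrib_left sum_distrib_right sum_divide_distrib
      power2_eq_square field_simps)
  also have "\<dots> = path_sum f1 f2 f3"
    unfolding path_sum_def by (intro sum.cong refl) (auto simp: sym_iff)
  finally show ?thesis by simp
qed

lemma path_sum_eq_centre: "path_sum f1 f2 f3 = D\<^sup>2 * (\<Sum>y\<in>V. f2 y * avg f1 y * avg f3 y)"
proof -
  have "D\<^sup>2 * (\<Sum>y\<in>V. f2 y * avg f1 y * avg f3 y) =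
      (\<Sum>y\<in>V. \<Sum>x\<in>V. \<Sum>z\<in>V. of_bool (R x y) * of_bool (R z y) * (f1 x * f2 y * f3 z))"
    using D_pos by (simp add: avg_def sum_distrib_left sum_distrib_right sum_divide_distrib
      power2_eq_square field_simps)
  also have "\<dots> = (\<Sum>x\<in>V. \<Sum>y\<in>V. \<Sum>z\<in>V. of_bool (R x y) * of_bool (R z y) * (f1 x * f2 y * f3 z))"
    by (rule sum.swap)
  also have "\<dots> = path_sum f1 f2 f3"
    unfolding path_sum_def by (intro sum.cong refl) (auto simp: sym_iff)
  finally show ?thesis by simp
qed

text \<open>\<open>2 + 2 * avg_const 2\<close> serves the evaluation at the centre,
  \<open>2 + avg_const (2 + avg_const 2)\<close> the nested one, where averaging is iterated.
  Neither the graph nor \<open>q\<close> enters, which is why the constant takes only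
  \<open>d\<close> as an argument outside the locale.\<close>

definition path_const :: real where
  "path_const = 2 + 2 * avg_const 2 + avg_const (2 + avg_const 2)"

lemma avg_const_nonneg: "0 \<le> M \<Longrightarrow> 0 \<le> avg_const M"
  using B_const_pos by (simp add: avg_const_def)

text \<open>Averaging divides an end exponent below \<open>\<delta>\<close> by \<open>d\<close>, so
  the total exponent at the centre is \<open>u2 + u1 / d + u3 / d\<close>; that this is at most 1 is
  the inequality \<open>le\<close>.\<close>

lemma path_sum_le_centre:
  assumes F1: "\<And>x. x \<in> V \<Longrightarrow> 1 \<le> F1 x" "(\<Sum>x\<in>V. F1 x) \<le> 2 * q ^ d"
    and F2: "\<And>x. x \<in> V \<Longrightarrow> 1 \<le> F2 x" "(\<Sum>x\<in>V. F2 x) \<le> 2 * q ^ d"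
    and F3: "\<And>x. x \<in> V \<Longrightarrow> 1 \<le> F3 x" "(\<Sum>x\<in>V. F3 x) \<le> 2 * q ^ d"
    and u: "0 \<le> u1" "0 \<le> u2" "0 \<le> u3" and le: "u1 + real d * u2 + u3 \<le> real d"
    and u1: "u1 \<le> \<delta>" and u3: "u3 \<le> \<delta>"
  shows "path_sum (\<lambda>x. F1 x powr u1) (\<lambda>x. F2 x powr u2) (\<lambda>x. F3 x powr u3) \<le> path_const * (D\<^sup>2 * q ^ d)"
proof -
  obtain G1 where G1: "\<And>y. y \<in> V \<Longrightarrow> 1 \<le> G1 y" "(\<Sum>y\<in>V. G1 y) \<le> avg_const 2 * q ^ d"
    "\<And>u y. \<lbrakk>0 \<le> u; u \<le> \<delta>; y \<in> V\<rbrakk> \<Longrightarrow> avg (\<lambda>x. F1 x powr u) y \<le> G1 y powr (u / d)"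
    using avg_powr_le[OF F1] by blast
  obtain G3 where G3: "\<And>y. y \<in> V \<Longrightarrow> 1 \<le> G3 y" "(\<Sum>y\<in>V. G3 y) \<le> avg_const 2 * q ^ d"
    "\<And>u y. \<lbrakk>0 \<le> u; u \<le> \<delta>; y \<in> V\<rbrakk> \<Longrightarrow> avg (\<lambda>x. F3 x powr u) y \<le> G3 y powr (u / d)"
    using avg_powr_le[OF F3] by blast
  have e: "u2 + u1 / d + u3 / d \<le> 1" using le d_ge_2 by (simp add: field_simps)
  have "F2 y powr u2 * avg (\<lambda>x. F1 x powr u1) y * avg (\<lambda>x. F3 x powr u3) y \<le> F2 y + G1 y + G3 y"
    if y: "y \<in> V" for y
  proof -
    have nn: "0 \<le> avg (\<lambda>x. F1 x powr u1) y" "0 \<le> avg (\<lambda>x. F3 x powr u3) y" using D_pos by (simp_all add: avg_def sum_nonneg)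
    have "F2 y powr u2 * avg (\<lambda>x. F1 x powr u1) y * avg (\<lambda>x. F3 x powr u3) y \<le>
        F2 y powr u2 * G1 y powr (u1 / d) * G3 y powr (u3 / d)"
      using G1(3)[OF u(1) u1 y] G3(3)[OF u(3) u3 y] nn by (intro mult_mono) auto
    also have "\<dots> \<le> (F2 y + G1 y) powr (u2 + u1 / d) * G3 y powr (u3 / d)"
      using F2(1)[OF y] G1(1)[OF y] u by (intro mult_right_mono powr_mult_le) auto
    also have "\<dots> \<le> (F2 y + G1 y + G3 y) powr (u2 + u1 / d + u3 / d)"
      using F2(1)[OF y] G1(1)[OF y] G3(1)[OF y] u by (intro powr_mult_le) auto
    also have "\<dots> \<le> F2 y + G1 y + G3 y"
      using F2(1)[OF y] G1(1)[OF y] G3(1)[OF y] e by (intro powr_le_self) auto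
    finally show ?thesis .
  qed
  then have "(\<Sum>y\<in>V. F2 y powr u2 * avg (\<lambda>x. F1 x powr u1) y * avg (\<lambda>x. F3 x powr u3) y) \<le>
      (\<Sum>y\<in>V. F2 y + G1 y + G3 y)" by (rule sum_mono)
  also have "\<dots> \<le> (2 + 2 * avg_const 2) * q ^ d"
    using F2(2) G1(2) G3(2) by (simp add: sum.distrib algebra_simps)
  also have "\<dots> \<le> path_const * q ^ d"
    using avg_const_nonneg[of "2 + avg_const 2"] avg_const_nonneg[of 2] q_pos
    by (intro mult_right_mono) (auto simp: path_const_def)
  finally show ?thesis unfolding path_sum_eq_centre
    using D_pos by (simp add: mult.left_commute[of path_const] mult_left_mono)
qed

text \<open>An exponent \<open>u1\<close> above \<open>\<delta>\<close> is out of reach of the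
  averaging estimate, so the other two functions are carried to \<open>x1\<close>. Each step divides
  by \<open>d\<close>: \<open>u3\<close> becomes \<open>u3 / d\<close> at \<open>x2\<close>, and
  \<open>w = u2 + u3 / d\<close> becomes \<open>w / d\<close> at \<open>x1\<close>.\<close>

lemma path_sum_le_end:
  assumes F1: "\<And>x. x \<in> V \<Longrightarrow> 1 \<le> F1 x" "(\<Sum>x\<in>V. F1 x) \<le> 2 * q ^ d"
    and F2: "\<And>x. x \<in> V \<Longrightarrow> 1 \<le> F2 x" "(\<Sum>x\<in>V. F2 x) \<le> 2 * q ^ d"
    and F3: "\<And>x. x \<in> V \<Longrightarrow> 1 \<le> F3 x" "(\<Sum>x\<in>V. F3 x) \<le> 2 * q ^ d"
    and u: "0 \<le> u1" "0 \<le> u2" "0 \<le> u3" and le: "real d * u1 + u2 + u3 \<le> real d"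
    and u1: "\<delta> \<le> u1"
  shows "path_sum (\<lambda>x. F1 x powr u1) (\<lambda>x. F2 x powr u2) (\<lambda>x. F3 x powr u3) \<le> path_const * (D\<^sup>2 * q ^ d)"
proof -
  have "real d * \<delta> \<le> real d * u1" using u1 by (intro mult_left_mono) auto
  \<comment> \<open>The endpoint satisfies \<open>d * (1 - \<delta>) = \<delta>\<close>, so a large
    \<open>u1\<close> forces the exponents of both averages below \<open>\<delta>\<close>.\<close>
  moreover have "real d - real d * \<delta> = \<delta>" by (simp add: \<delta>_def field_simps)
  ultimately have u23: "u2 + u3 \<le> \<delta>" using le by linarith
  have u3d: "u3 / d \<le> u3" using divide_left_mono[of 1 "real d" u3] u d_ge_2 by simp
  define w where "w = u2 + u3 / d"
  have w: "0 \<le> w" "w \<le> \<delta>" using u u23 u3d by (auto simp: w_def)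
  have e: "u1 + w / d \<le> 1"
  proof -
    have "real d * u1 + w \<le> real d" using le u3d by (simp add: w_def)
    then show ?thesis using d_ge_2 by (simp add: field_simps)
  qed
  obtain G3 where G3: "\<And>y. y \<in> V \<Longrightarrow> 1 \<le> G3 y" "(\<Sum>y\<in>V. G3 y) \<le> avg_const 2 * q ^ d"
    "\<And>u y. \<lbrakk>0 \<le> u; u \<le> \<delta>; y \<in> V\<rbrakk> \<Longrightarrow> avg (\<lambda>x. F3 x powr u) y \<le> G3 y powr (u / d)"
    using avg_powr_le[OF F3] by blast
  define H where "H = (\<lambda>y. F2 y + G3 y)"
  have H1: "1 \<le> H y" if "y \<in> V" for y using F2(1)[OF that] G3(1)[OF that] by (simp add: H_def)
  have H2: "(\<Sum>y\<in>V. H y) \<le> (2 + avg_const 2) * q ^ d"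
    using F2(2) G3(2) by (simp add: H_def sum.distrib algebra_simps)
  obtain G where G: "\<And>y. y \<in> V \<Longrightarrow> 1 \<le> G y" "(\<Sum>y\<in>V. G y) \<le> avg_const (2 + avg_const 2) * q ^ d"
    "\<And>u y. \<lbrakk>0 \<le> u; u \<le> \<delta>; y \<in> V\<rbrakk> \<Longrightarrow> avg (\<lambda>x. H x powr u) y \<le> G y powr (u / d)"
    using avg_powr_le[OF H1 H2] by blast
  have inner: "F2 y powr u2 * avg (\<lambda>x. F3 x powr u3) y \<le> H y powr w" if y: "y \<in> V" for y
  proof -
    have "F2 y powr u2 * avg (\<lambda>x. F3 x powr u3) y \<le> F2 y powr u2 * G3 y powr (u3 / d)"
      using G3(3)[OF u(3) _ y] u u23 by (intro mult_left_mono) auto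
    also have "\<dots> \<le> H y powr w" unfolding H_def w_def
      using F2(1)[OF y] G3(1)[OF y] u by (intro powr_mult_le) auto
    finally show ?thesis .
  qed
  have "F1 x powr u1 * avg (\<lambda>y. F2 y powr u2 * avg (\<lambda>x. F3 x powr u3) y) x \<le> F1 x + G x"
    if x: "x \<in> V" for x
  proof -
    have "avg (\<lambda>y. F2 y powr u2 * avg (\<lambda>x. F3 x powr u3) y) x \<le> avg (\<lambda>y. H y powr w) x"
      by (intro avg_mono inner)
    also have "\<dots> \<le> G x powr (w / d)" using w x by (rule G(3))
    finally have "F1 x powr u1 * avg (\<lambda>y. F2 y powr u2 * avg (\<lambda>x. F3 x powr u3) y) x \<le>
        F1 x powr u1 * G x powr (w / d)" by (intro mult_left_mono) auto
    also have "\<dots> \<le> (F1 x + G x) powr (u1 + w / d)"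
      using F1(1)[OF x] G(1)[OF x] u w by (intro powr_mult_le) auto
    also have "\<dots> \<le> F1 x + G x" using F1(1)[OF x] G(1)[OF x] e by (intro powr_le_self) auto
    finally show ?thesis .
  qed
  then have "(\<Sum>x\<in>V. F1 x powr u1 * avg (\<lambda>y. F2 y powr u2 * avg (\<lambda>x. F3 x powr u3) y) x) \<le>
      (\<Sum>x\<in>V. F1 x + G x)" by (rule sum_mono)
  also have "\<dots> \<le> (2 + avg_const (2 + avg_const 2)) * q ^ d"
    using F1(2) G(2) by (simp add: sum.distrib algebra_simps)
  also have "\<dots> \<le> path_const * q ^ d"
    using avg_const_nonneg[of 2] q_pos by (intro mult_right_mono) (auto simp: path_const_def)
  finally show ?thesis unfolding path_sum_eq_nested
    using D_pos by (simp add: mult.left_commute[of path_const] mult_left_mono)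
qed

theorem path_sum_le:
  assumes F1: "\<And>x. x \<in> V \<Longrightarrow> 1 \<le> F1 x" "(\<Sum>x\<in>V. F1 x) \<le> 2 * q ^ d"
    and F2: "\<And>x. x \<in> V \<Longrightarrow> 1 \<le> F2 x" "(\<Sum>x\<in>V. F2 x) \<le> 2 * q ^ d"
    and F3: "\<And>x. x \<in> V \<Longrightarrow> 1 \<le> F3 x" "(\<Sum>x\<in>V. F3 x) \<le> 2 * q ^ d"
    and u: "0 \<le> u1" "0 \<le> u2" "0 \<le> u3" and le: "real d * u1 + u2 + u3 \<le> real d"
      "u1 + real d * u2 + u3 \<le> real d" "u1 + u2 + real d * u3 \<le> real d"
  shows "path_sum (\<lambda>x. F1 x powr u1) (\<lambda>x. F2 x powr u2) (\<lambda>x. F3 x powr u3) \<le> path_const * (D\<^sup>2 * q ^ d)"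
proof -
  consider "\<delta> \<le> u1" | "\<delta> \<le> u3" | "u1 \<le> \<delta>" "u3 \<le> \<delta>" by linarith
  then show ?thesis
  proof cases
    case 1
    then show ?thesis using path_sum_le_end[OF F1 F2 F3 u le(1)] by blast
  next
    case 2
    have "real d * u3 + u2 + u1 \<le> real d" using le(3) by simp
    from path_sum_le_end[OF F3 F2 F1 u(3,2,1) this 2] show ?thesis by (subst path_sum_commute)
  next
    case 3
    then show ?thesis using path_sum_le_centre[OF F1 F2 F3 u le(2)] by blast
  qed
qed

end

section \<open>Points on spheres over a finite field\<close>

lemma (in monoid) pow_2_eq: "a \<in> carrier G \<Longrightarrow> a [^] (2::nat) = a \<otimes> a"
  by (simp add: numeral_2_eq_2)

locale odd_finite_field = field R for R (structure) +
  assumes finite_carrier: "finite (carrier R)" and two_neq_0: "\<one> \<oplus> \<one> \<noteq> \<zero>"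
begin

definition q :: real where "q = real (order R)"

lemma q_pos: "0 < q"
  using finite_carrier by (auto simp: q_def order_def card_gt_0_iff)

lemma sum_const_carrier: "(\<Sum>a\<in>carrier R. c) = q * c" for c :: real
  by (simp add: q_def order_def)

section \<open>Counting square roots\<close>

lemma sum_of_bool_inj:
  assumes "inj_on g (carrier R)" "\<And>a. a \<in> carrier R \<Longrightarrow> g a \<in> carrier R" "u \<in> carrier R"
  shows "(\<Sum>a\<in>carrier R. of_bool (g a = u)) = (1::real)"
proof -
  have "g ` carrier R = carrier R"
    using assms finite_carrier by (intro endo_inj_surj) auto
  then obtain a0 where a0: "a0 \<in> carrier R" "g a0 = u" using assms(3) by (metis imageE)
  have "(\<Sum>a\<in>carrier R. of_bool (g a = u)) = (\<Sum>a\<in>{a0}. of_bool (g a = u) :: real)"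
    using assms(1) a0 finite_carrier by (intro sum.mono_neutral_right) (auto dest: inj_onD)
  then show ?thesis using a0 by simp
qed

lemma sum_reindex_carrier:
  assumes "inj_on g (carrier R)" "\<And>a. a \<in> carrier R \<Longrightarrow> g a \<in> carrier R"
  shows "(\<Sum>a\<in>carrier R. f (g a)) = (\<Sum>a\<in>carrier R. f a :: real)"
proof -
  have "g ` carrier R = carrier R"
    using assms finite_carrier by (intro endo_inj_surj) auto
  then show ?thesis using sum.reindex[OF assms(1), of f] by simp
qed

lemma sum_shift: "c \<in> carrier R \<Longrightarrow> (\<Sum>a\<in>carrier R. f (c \<oplus> a)) = (\<Sum>a\<in>carrier R. f a :: real)"
  by (rule sum_reindex_carrier) (auto intro!: inj_onI)

lemma double_inj: "a \<in> carrier R \<Longrightarrow> b \<in> carrier R \<Longrightarrow> a \<oplus> a = b \<oplus> b \<Longrightarrow> a = b"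
proof -
  assume ab: "a \<in> carrier R" "b \<in> carrier R" "a \<oplus> a = b \<oplus> b"
  then have "(\<one> \<oplus> \<one>) \<otimes> a = (\<one> \<oplus> \<one>) \<otimes> b" by (simp add: l_distr)
  then show "a = b" using ab two_neq_0 by (simp add: m_lcancel)
qed

text \<open>\<open>roots u - 1\<close> is the value of the quadratic character at \<open>u\<close>,
  including 0 at \<open>\<zero>\<close>.\<close>

definition roots :: "'a \<Rightarrow> real" where
  "roots u = (\<Sum>a\<in>carrier R. of_bool (a \<otimes> a = u))"

definition hyperbola :: "'a \<Rightarrow> real" where
  "hyperbola u = (\<Sum>a\<in>carrier R. \<Sum>b\<in>carrier R. of_bool (a \<otimes> a \<ominus> b \<otimes> b = u))"

text \<open>Replacing \<open>a\<close> by \<open>b \<oplus> c\<close> turns the equation into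
  \<open>c \<otimes> (b \<oplus> b \<oplus> c) = u\<close>, affine in \<open>b\<close>: each
  \<open>c \<noteq> \<zero>\<close> gives one solution, while \<open>c = \<zero>\<close> gives all
  \<open>b\<close> or none.\<close>

lemma hyperbola_eq:
  assumes u: "u \<in> carrier R"
  shows "hyperbola u = q - 1 + q * of_bool (u = \<zero>)"
proof -
  have "hyperbola u = (\<Sum>b\<in>carrier R. \<Sum>a\<in>carrier R. of_bool (a \<otimes> a \<ominus> b \<otimes> b = u))"
    unfolding hyperbola_def by (rule sum.swap)
  also have "\<dots> = (\<Sum>b\<in>carrier R. \<Sum>c\<in>carrier R. of_bool ((b \<oplus> c) \<otimes> (b \<oplus> c) \<ominus> b \<otimes> b = u))"
    by (intro sum.cong refl sum_shift[symmetric])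
  also have "\<dots> = (\<Sum>b\<in>carrier R. \<Sum>c\<in>carrier R. of_bool (c \<otimes> (b \<oplus> b \<oplus> c) = u))"
  proof (intro sum.cong refl)
    fix b c assume bc: "b \<in> carrier R" "c \<in> carrier R"
    then have "(b \<oplus> c) \<otimes> (b \<oplus> c) \<ominus> b \<otimes> b = c \<otimes> (b \<oplus> b \<oplus> c)" by algebra
    then show "of_bool ((b \<oplus> c) \<otimes> (b \<oplus> c) \<ominus> b \<otimes> b = u) = (of_bool (c \<otimes> (b \<oplus> b \<oplus> c) = u) :: real)"
      by simp
  qed
  also have "\<dots> = (\<Sum>c\<in>carrier R. \<Sum>b\<in>carrier R. of_bool (c \<otimes> (b \<oplus> b \<oplus> c) = u))"
    by (rule sum.swap)
  also have "\<dots> = (\<Sum>c\<in>carrier R. 1 + of_bool (c = \<zero>) * (q * of_bool (u = \<zero>) - 1))"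
  proof (intro sum.cong refl)
    fix c assume c: "c \<in> carrier R"
    show "(\<Sum>b\<in>carrier R. of_bool (c \<otimes> (b \<oplus> b \<oplus> c) = u)) = 1 + of_bool (c = \<zero>) * (q * of_bool (u = \<zero>) - 1)"
    proof (cases "c = \<zero>")
      case True
      have "(\<Sum>b\<in>carrier R. of_bool (c \<otimes> (b \<oplus> b \<oplus> c) = u)) = (\<Sum>b\<in>carrier R. of_bool (u = \<zero>) :: real)"
        using True by (intro sum.cong refl) auto
      then show ?thesis using True by (simp only: sum_const_carrier) simp
    next
      case False
      have "inj_on (\<lambda>b. c \<otimes> (b \<oplus> b \<oplus> c)) (carrier R)"
      proof (rule inj_onI)
        fix a b assume ab: "a \<in> carrier R" "b \<in> carrier R" "c \<otimes> (a \<oplus> a \<oplus> c) = c \<otimes> (b \<oplus> b \<oplus> c)"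
        then have "a \<oplus> a \<oplus> c = b \<oplus> b \<oplus> c" using c False by (simp add: m_lcancel)
        then have "a \<oplus> a = b \<oplus> b" using ab c by simp
        then show "a = b" using ab double_inj by blast
      qed
      then show ?thesis using False c u by (subst sum_of_bool_inj) auto
    qed
  qed
  also have "\<dots> = q + (q * of_bool (u = \<zero>) - 1)"
    using finite_carrier by (simp add: sum.distrib sum_const_carrier[of 1, simplified]
      sum_distrib_right[symmetric] of_bool_def)
  finally show ?thesis by simp
qed

lemma roots_0: "roots \<zero> = 1"
proof -
  have "roots \<zero> = (\<Sum>a\<in>carrier R. if a = \<zero> then 1 else 0)"
    unfolding roots_def using integral by (intro sum.cong refl) auto
  then show ?thesis using finite_carrier by simp
qed

lemma roots_nonneg: "0 \<le> roots u"
  by (simp add: roots_def sum_nonneg)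

lemma roots_eq_card: "roots u = real (card {a \<in> carrier R. a \<otimes> a = u})"
  by (simp add: roots_def of_bool_def sum.If_cases[OF finite_carrier] Int_def)

lemma minus_eq_0_iff: "a \<in> carrier R \<Longrightarrow> b \<in> carrier R \<Longrightarrow> a \<ominus> b = \<zero> \<longleftrightarrow> a = b"
  using minus_equality[of a "\<ominus> b"] by (auto simp: minus_eq r_neg)

lemma square_eq_imp: "a \<in> carrier R \<Longrightarrow> b \<in> carrier R \<Longrightarrow> a \<otimes> a = b \<otimes> b \<Longrightarrow> a = b \<or> a = \<ominus> b"
proof -
  assume ab: "a \<in> carrier R" "b \<in> carrier R" "a \<otimes> a = b \<otimes> b"
  have "(a \<ominus> b) \<otimes> (a \<oplus> b) = a \<otimes> a \<ominus> b \<otimes> b" using ab(1,2) by algebra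
  also have "\<dots> = \<zero>" unfolding ab(3) using ab(2) by (simp add: minus_eq_0_iff)
  finally have "a \<ominus> b = \<zero> \<or> a \<oplus> b = \<zero>" using ab(1,2) by (intro integral) auto
  then show ?thesis using ab(1,2) minus_equality[of a b] by (auto simp: minus_eq_0_iff)
qed

lemma roots_le_2: "roots u \<le> 2"
proof (cases "\<exists>a\<in>carrier R. a \<otimes> a = u")
  case True
  then obtain a where a: "a \<in> carrier R" "a \<otimes> a = u" by blast
  have "{b \<in> carrier R. b \<otimes> b = u} \<subseteq> {a, \<ominus> a}"
  proof
    fix b assume "b \<in> {b \<in> carrier R. b \<otimes> b = u}"
    then show "b \<in> {a, \<ominus> a}" using square_eq_imp[of b a] a by simp
  qed
  then have "card {b \<in> carrier R. b \<otimes> b = u} \<le> card {a, \<ominus> a}" by (intro card_mono) auto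
  also have "\<dots> \<le> 2" by (simp add: card_insert_if)
  finally show ?thesis by (simp add: roots_eq_card)
next
  case False
  then have empty: "{a \<in> carrier R. a \<otimes> a = u} = {}" by blast
  have "roots u = 0" unfolding roots_eq_card empty by simp
  then show ?thesis by simp
qed

lemma sum_roots: "(\<Sum>u\<in>carrier R. roots u) = q"
proof -
  have "(\<Sum>u\<in>carrier R. roots u) = (\<Sum>a\<in>carrier R. \<Sum>u\<in>carrier R. of_bool (a \<otimes> a = u))"
    unfolding roots_def by (rule sum.swap)
  also have "\<dots> = (\<Sum>a\<in>carrier R. 1)"
    using finite_carrier by (intro sum.cong refl) (simp add: of_bool_def)
  finally show ?thesis using sum_const_carrier[of 1] by simp
qed

lemma minus_inj: "inj_on (\<lambda>a. \<ominus> a) (carrier R)"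
  by (rule inj_onI) (metis minus_minus)

text \<open>\<open>\<sigma>\<close> is the quadratic character of \<open>\<ominus> \<one>\<close>.
  If \<open>\<ominus> \<one> = i \<otimes> i\<close>, scaling by \<open>i\<close> matches the roots
  of \<open>u\<close> and \<open>\<ominus> u\<close>. If there is no such \<open>i\<close>, then
  \<open>u\<close> and \<open>\<ominus> u\<close> cannot both be non-zero squares, whence
  \<open>roots u + roots (\<ominus> u) \<le> 2\<close>; summing over all \<open>u\<close> forces
  equality.\<close>

lemma obtain_sigma:
  obtains \<sigma> :: real where "\<sigma> = 1 \<or> \<sigma> = -1"
    "\<And>u. u \<in> carrier R \<Longrightarrow> roots (\<ominus> u) - 1 = \<sigma> * (roots u - 1)"
proof (cases "\<exists>i\<in>carrier R. i \<otimes> i = \<ominus> \<one>")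
  case True
  then obtain i where i: "i \<in> carrier R" "i \<otimes> i = \<ominus> \<one>" by blast
  have i0: "i \<noteq> \<zero>"
  proof
    assume "i = \<zero>"
    then have "\<ominus> \<one> = \<zero>" using i by simp
    then have "\<one> = \<ominus> \<zero>" by (metis minus_minus one_closed)
    then show False by simp
  qed
  have "roots (\<ominus> u) = roots u" if u: "u \<in> carrier R" for u
  proof -
    have "roots (\<ominus> u) = (\<Sum>a\<in>carrier R. of_bool ((i \<otimes> a) \<otimes> (i \<otimes> a) = \<ominus> u))"
      unfolding roots_def using i i0
      by (intro sum_reindex_carrier[symmetric]) (auto intro!: inj_onI simp: m_lcancel)
    also have "\<dots> = roots u" unfolding roots_def
    proof (intro sum.cong refl)
      fix a assume a: "a \<in> carrier R"
      have "(i \<otimes> a) \<otimes> (i \<otimes> a) = (i \<otimes> i) \<otimes> (a \<otimes> a)" using a i(1) by algebra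
      also have "\<dots> = \<ominus> (a \<otimes> a)" unfolding i(2) using a by (simp add: l_minus)
      finally have "(i \<otimes> a) \<otimes> (i \<otimes> a) = \<ominus> u \<longleftrightarrow> a \<otimes> a = u"
        using a u by (metis m_closed minus_minus)
      then show "of_bool ((i \<otimes> a) \<otimes> (i \<otimes> a) = \<ominus> u) = (of_bool (a \<otimes> a = u) :: real)" by simp
    qed
    finally show ?thesis .
  qed
  then show ?thesis by (intro that[of 1]) auto
next
  case False
  have le: "roots u + roots (\<ominus> u) \<le> 2" if u: "u \<in> carrier R" for u
  proof (cases "u = \<zero>")
    case True
    then show ?thesis by (simp add: roots_0)
  next
    case u0: False
    have "\<not> (roots u \<noteq> 0 \<and> roots (\<ominus> u) \<noteq> 0)"
    proof
      assume "roots u \<noteq> 0 \<and> roots (\<ominus> u) \<noteq> 0"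
      then obtain a b where ab: "a \<in> carrier R" "a \<otimes> a = u" "b \<in> carrier R" "b \<otimes> b = \<ominus> u"
        unfolding roots_eq_card by (auto simp: card_eq_0_iff)
      have a0: "a \<noteq> \<zero>" using ab u0 by auto
      then have inv: "inv a \<in> carrier R" "a \<otimes> inv a = \<one>" using ab field_Units by auto
      have "(b \<otimes> inv a) \<otimes> (b \<otimes> inv a) = (b \<otimes> b) \<otimes> (inv a \<otimes> inv a)"
        using ab(1,3) inv(1) by algebra
      also have "\<dots> = \<ominus> ((a \<otimes> a) \<otimes> (inv a \<otimes> inv a))" unfolding ab(2,4) using u inv(1) by (simp add: l_minus)
      also have "(a \<otimes> a) \<otimes> (inv a \<otimes> inv a) = (a \<otimes> inv a) \<otimes> (a \<otimes> inv a)"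
        using ab(1) inv(1) by algebra
      finally have "(b \<otimes> inv a) \<otimes> (b \<otimes> inv a) = \<ominus> \<one>" unfolding inv(2) by simp
      then show False using False ab inv by blast
    qed
    then show ?thesis using roots_le_2[of u] roots_le_2[of "\<ominus> u"] by auto
  qed
  have "(\<Sum>u\<in>carrier R. 2 - (roots u + roots (\<ominus> u))) = 0"
    using sum_reindex_carrier[OF minus_inj, of roots] sum_const_carrier[of 2]
    by (simp add: sum_subtractf sum.distrib sum_roots)
  then have "2 - (roots u + roots (\<ominus> u)) = 0" if "u \<in> carrier R" for u
    using sum_nonneg_eq_0_iff[OF finite_carrier, of "\<lambda>u. 2 - (roots u + roots (\<ominus> u))"] le that
    by (simp add: diff_ge_0_iff_ge)
  then show ?thesis by (intro that[of "-1"]) (auto simp: algebra_simps)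
qed

section \<open>Inner products and translations of vectors\<close>

definition dot :: "nat \<Rightarrow> (nat \<Rightarrow> 'a) \<Rightarrow> (nat \<Rightarrow> 'a) \<Rightarrow> 'a" where
  "dot n x y = (\<Oplus>i\<in>{..<n}. x i \<otimes> y i)"

definition axpy :: "nat \<Rightarrow> 'a \<Rightarrow> (nat \<Rightarrow> 'a) \<Rightarrow> (nat \<Rightarrow> 'a) \<Rightarrow> nat \<Rightarrow> 'a" where
  "axpy n a x y = (\<lambda>i\<in>{..<n}. x i \<oplus> a \<otimes> y i)"

lemma vecs_nth: "x \<in> vecs R n \<Longrightarrow> i < n \<Longrightarrow> x i \<in> carrier R"
  by (auto simp: vecs_def)

lemma vecs_ext: "x \<in> vecs R n \<Longrightarrow> y \<in> vecs R n \<Longrightarrow> (\<And>i. i < n \<Longrightarrow> x i = y i) \<Longrightarrow> x = y"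
  unfolding vecs_def by (rule PiE_ext) auto

lemma axpy_nth: "i < n \<Longrightarrow> axpy n a x y i = x i \<oplus> a \<otimes> y i"
  by (simp add: axpy_def)

lemma axpy_closed: "a \<in> carrier R \<Longrightarrow> x \<in> vecs R n \<Longrightarrow> y \<in> vecs R n \<Longrightarrow> axpy n a x y \<in> vecs R n"
  by (auto simp: axpy_def vecs_def)

lemma vec_minus_eq_axpy:
  "x \<in> vecs R n \<Longrightarrow> y \<in> vecs R n \<Longrightarrow> vec_minus R n x y = axpy n (\<ominus> \<one>) x y"
  unfolding vec_minus_def axpy_def by (rule restrict_ext) (auto simp: vecs_nth l_minus minus_eq)

lemma vec_minus_closed: "x \<in> vecs R n \<Longrightarrow> y \<in> vecs R n \<Longrightarrow> vec_minus R n x y \<in> vecs R n"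
  by (simp add: vec_minus_eq_axpy axpy_closed)

lemma dot_0: "dot 0 x y = \<zero>"
  by (simp add: dot_def)

lemma dot_closed: "(\<And>i. i < n \<Longrightarrow> x i \<in> carrier R) \<Longrightarrow> (\<And>i. i < n \<Longrightarrow> y i \<in> carrier R) \<Longrightarrow> dot n x y \<in> carrier R"
  unfolding dot_def by (rule finsum_closed) auto

lemma dot_vecs_closed: "x \<in> vecs R n \<Longrightarrow> y \<in> vecs R n \<Longrightarrow> dot n x y \<in> carrier R"
  by (rule dot_closed) (auto intro: vecs_nth)

lemma dot_Suc:
  assumes "\<And>i. i < Suc n \<Longrightarrow> x i \<in> carrier R" "\<And>i. i < Suc n \<Longrightarrow> y i \<in> carrier R"
  shows "dot (Suc n) x y = dot n x y \<oplus> x n \<otimes> y n"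
proof -
  have "dot (Suc n) x y = x n \<otimes> y n \<oplus> dot n x y"
    unfolding dot_def lessThan_Suc using assms by (intro finsum_insert) auto
  then show ?thesis using dot_closed[of n x y] assms by (simp add: a_comm)
qed

lemma dot_cong:
  assumes "\<And>i. i < n \<Longrightarrow> x i = x' i" "\<And>i. i < n \<Longrightarrow> y i = y' i"
    "\<And>i. i < n \<Longrightarrow> x' i \<in> carrier R" "\<And>i. i < n \<Longrightarrow> y' i \<in> carrier R"
  shows "dot n x y = dot n x' y'"
  unfolding dot_def using assms by (intro finsum_cong') auto

lemma dot_commute: "x \<in> vecs R n \<Longrightarrow> y \<in> vecs R n \<Longrightarrow> dot n x y = dot n y x"
  unfolding dot_def by (intro finsum_cong') (auto simp: vecs_nth m_comm)

text \<open>Stated for functions that take values in the carrier below \<open>n\<close> rather than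
  for \<open>vecs R n\<close>: in the induction on \<open>n\<close>, a vector of
  \<open>vecs R (Suc n)\<close> is not one of \<open>vecs R n\<close>.\<close>

lemma dot_linear:
  assumes "a \<in> carrier R" "\<And>i. i < n \<Longrightarrow> x i \<in> carrier R" "\<And>i. i < n \<Longrightarrow> y i \<in> carrier R"
    "\<And>i. i < n \<Longrightarrow> z i \<in> carrier R"
  shows "dot n (\<lambda>i. x i \<oplus> a \<otimes> y i) z = dot n x z \<oplus> a \<otimes> dot n y z"
  using assms(2-4)
proof (induction n)
  case 0
  then show ?case using assms(1) by (simp add: dot_0)
next
  case (Suc n)
  have c: "dot n x z \<in> carrier R" "dot n y z \<in> carrier R" "x n \<in> carrier R" "y n \<in> carrier R" "z n \<in> carrier R"
    using Suc.prems by (auto intro: dot_closed)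
  have "dot (Suc n) (\<lambda>i. x i \<oplus> a \<otimes> y i) z = dot n (\<lambda>i. x i \<oplus> a \<otimes> y i) z \<oplus> (x n \<oplus> a \<otimes> y n) \<otimes> z n"
    using Suc.prems assms(1) by (intro dot_Suc) auto
  also have "\<dots> = (dot n x z \<oplus> a \<otimes> dot n y z) \<oplus> (x n \<oplus> a \<otimes> y n) \<otimes> z n"
    using Suc by simp
  also have "\<dots> = (dot n x z \<oplus> x n \<otimes> z n) \<oplus> a \<otimes> (dot n y z \<oplus> y n \<otimes> z n)"
    using c assms(1) by algebra
  also have "\<dots> = dot (Suc n) x z \<oplus> a \<otimes> dot (Suc n) y z" using Suc.prems by (simp add: dot_Suc)
  finally show ?case .
qed

lemma dot_axpy:
  assumes "a \<in> carrier R" "x \<in> vecs R n" "y \<in> vecs R n" "z \<in> vecs R n"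
  shows "dot n (axpy n a x y) z = dot n x z \<oplus> a \<otimes> dot n y z"
proof -
  have "dot n (axpy n a x y) z = dot n (\<lambda>i. x i \<oplus> a \<otimes> y i) z"
    using assms by (intro dot_cong) (auto simp: axpy_nth vecs_nth)
  then show ?thesis using assms by (simp add: dot_linear vecs_nth)
qed

lemma sq_norm_eq_dot: "x \<in> vecs R n \<Longrightarrow> sq_norm R n x = dot n x x"
  unfolding sq_norm_def dot_def by (intro finsum_cong') (auto simp: vecs_nth pow_2_eq)

lemma sq_norm_closed: "x \<in> vecs R n \<Longrightarrow> sq_norm R n x \<in> carrier R"
  by (simp add: sq_norm_eq_dot dot_vecs_closed)

lemma sq_norm_axpy:
  assumes "a \<in> carrier R" "x \<in> vecs R n" "y \<in> vecs R n"
  shows "sq_norm R n (axpy n a x y) =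
    sq_norm R n x \<oplus> (a \<oplus> a) \<otimes> dot n x y \<oplus> (a \<otimes> a) \<otimes> sq_norm R n y"
proof -
  have c: "dot n x x \<in> carrier R" "dot n x y \<in> carrier R" "dot n y y \<in> carrier R"
    using assms by (auto intro: dot_vecs_closed)
  have "sq_norm R n (axpy n a x y) = dot n x (axpy n a x y) \<oplus> a \<otimes> dot n y (axpy n a x y)"
    using assms by (simp add: sq_norm_eq_dot axpy_closed dot_axpy)
  also have "dot n x (axpy n a x y) = dot n (axpy n a x y) x"
    using assms by (intro dot_commute axpy_closed)
  also have "dot n y (axpy n a x y) = dot n (axpy n a x y) y"
    using assms by (intro dot_commute axpy_closed)
  also have "dot n (axpy n a x y) x = dot n x x \<oplus> a \<otimes> dot n x y"
    using assms by (simp add: dot_axpy dot_commute[of y n x])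
  also have "dot n (axpy n a x y) y = dot n x y \<oplus> a \<otimes> dot n y y"
    using assms by (simp add: dot_axpy)
  also have "dot n x x \<oplus> a \<otimes> dot n x y \<oplus> a \<otimes> (dot n x y \<oplus> a \<otimes> dot n y y) =
      dot n x x \<oplus> (a \<oplus> a) \<otimes> dot n x y \<oplus> (a \<otimes> a) \<otimes> dot n y y"
    using c assms(1) by algebra
  finally show ?thesis using assms by (simp add: sq_norm_eq_dot)
qed

lemma axpy_axpy_minus:
  assumes "a \<in> carrier R" "x \<in> vecs R n" "z \<in> vecs R n"
  shows "axpy n (\<ominus> a) (axpy n a x z) z = x"
proof (rule vecs_ext)
  fix i assume i: "i < n"
  have "x i \<in> carrier R" "z i \<in> carrier R" using assms i by (auto intro: vecs_nth)
  then have "x i \<oplus> a \<otimes> z i \<oplus> \<ominus> a \<otimes> z i = x i" using assms(1) by algebra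
  then show "axpy n (\<ominus> a) (axpy n a x z) z i = x i" using i by (simp add: axpy_nth)
qed (use assms in \<open>auto intro: axpy_closed\<close>)

lemma sum_translate:
  assumes "a \<in> carrier R" "z \<in> vecs R n"
  shows "(\<Sum>x\<in>vecs R n. g (axpy n a x z)) = (\<Sum>x\<in>vecs R n. g x :: real)"
  using axpy_axpy_minus[of a _ n z] axpy_axpy_minus[of "\<ominus> a" _ n z] assms
  by (intro sum.reindex_bij_witness[where i = "\<lambda>x. axpy n (\<ominus> a) x z" and j = "\<lambda>x. axpy n a x z"])
    (auto intro: axpy_closed)

lemma vec_minus_vec_minus:
  assumes "x \<in> vecs R n" "z \<in> vecs R n"
  shows "vec_minus R n x (vec_minus R n x z) = z"
proof (rule vecs_ext)
  fix i assume i: "i < n"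
  have "x i \<in> carrier R" "z i \<in> carrier R" using assms i by (auto intro: vecs_nth)
  then have "x i \<ominus> (x i \<ominus> z i) = z i" by algebra
  then show "vec_minus R n x (vec_minus R n x z) i = z i" using i by (simp add: vec_minus_def)
qed (use assms in \<open>auto intro: vec_minus_closed\<close>)

lemma sum_reflect:
  assumes "x \<in> vecs R n"
  shows "(\<Sum>z\<in>vecs R n. g (vec_minus R n x z)) = (\<Sum>z\<in>vecs R n. g z :: real)"
  using assms
  by (intro sum.reindex_bij_witness[where i = "vec_minus R n x" and j = "vec_minus R n x"])
    (auto intro: vec_minus_closed vec_minus_vec_minus)

lemma finite_vectors: "finite (vecs R n)"
  using finite_carrier by (rule finite_vecs)

lemma card_vecs: "real (card (vecs R n)) = q ^ n"
  by (simp add: vecs_def card_PiE q_def order_def)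

section \<open>Numbers of points on spheres\<close>

definition cnt :: "nat \<Rightarrow> 'a \<Rightarrow> real" where
  "cnt n s = (\<Sum>x\<in>vecs R n. of_bool (sq_norm R n x = s))"

text \<open>The main term is written \<open>q ^ n / q\<close> rather than \<open>q ^ (n - 1)\<close>
  so that dimension 0, where the recurrence starts, is covered.\<close>

definition err :: "nat \<Rightarrow> 'a \<Rightarrow> real" where
  "err n s = cnt n s - q ^ n / q"

lemma card_sphere: "real (card (sphere R n s)) = cnt n s"
  by (simp only: cnt_def sphere_def sum_of_bool_eq_card[OF finite_vectors])

lemma sum_vecs_Suc:
  "(\<Sum>x\<in>vecs R (Suc n). g x) = (\<Sum>a\<in>carrier R. \<Sum>x\<in>vecs R n. g (x(n := a)) :: real)"
proof -
  have img: "vecs R (Suc n) = (\<lambda>(a, x). x(n := a)) ` (carrier R \<times> vecs R n)"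
    by (simp add: vecs_def lessThan_Suc PiE_insert_eq)
  have inj: "inj_on (\<lambda>(a, x). x(n := a)) (carrier R \<times> vecs R n)"
  proof (rule inj_onI, clarify)
    fix a x b y assume *: "x \<in> vecs R n" "y \<in> vecs R n" "x(n := a) = y(n := b)"
    then have "a = b" by (metis fun_upd_same)
    moreover have "x = y"
      using *(1,2) by (rule vecs_ext) (metis *(3) fun_upd_other less_irrefl)
    ultimately show "a = b \<and> x = y" by blast
  qed
  show ?thesis unfolding img sum.reindex[OF inj] by (simp add: sum.cartesian_product case_prod_unfold)
qed

lemma sq_norm_upd:
  assumes "x \<in> vecs R n" "a \<in> carrier R"
  shows "sq_norm R (Suc n) (x(n := a)) = sq_norm R n x \<oplus> a \<otimes> a"
proof -
  have "x(n := a) \<in> vecs R (Suc n)"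
    using assms by (auto simp: vecs_def PiE_iff extensional_def less_Suc_eq)
  note v = this and c = vecs_nth[OF this]
  have "sq_norm R (Suc n) (x(n := a)) = dot n (x(n := a)) (x(n := a)) \<oplus> a \<otimes> a"
    unfolding sq_norm_eq_dot[OF v] using dot_Suc[of n "x(n := a)" "x(n := a)", OF c c] by simp
  also have "dot n (x(n := a)) (x(n := a)) = dot n x x"
    using assms by (intro dot_cong) (auto intro: vecs_nth)
  finally show ?thesis unfolding sq_norm_eq_dot[OF assms(1)] .
qed

lemma add_eq_iff: "a \<in> carrier R \<Longrightarrow> b \<in> carrier R \<Longrightarrow> c \<in> carrier R \<Longrightarrow> a \<oplus> b = c \<longleftrightarrow> a = c \<ominus> b"
proof -
  assume abc: "a \<in> carrier R" "b \<in> carrier R" "c \<in> carrier R"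
  have "a \<oplus> b \<ominus> b = a" "c \<ominus> b \<oplus> b = c" using abc by algebra+
  then show ?thesis by metis
qed

lemma cnt_Suc: "s \<in> carrier R \<Longrightarrow> cnt (Suc n) s = (\<Sum>a\<in>carrier R. cnt n (s \<ominus> a \<otimes> a))"
  unfolding cnt_def sum_vecs_Suc
  by (intro sum.cong refl) (simp add: sq_norm_upd sq_norm_closed add_eq_iff)

lemma cnt_0: "cnt 0 s = of_bool (s = \<zero>)"
  by (simp add: cnt_def vecs_def sq_norm_def eq_commute)

lemma err_Suc: "s \<in> carrier R \<Longrightarrow> err (Suc n) s = (\<Sum>a\<in>carrier R. err n (s \<ominus> a \<otimes> a))"
  using q_pos by (simp add: err_def cnt_Suc sum_subtractf sum_const_carrier del: sum_constant)

lemma err_0: "err 0 s = of_bool (s = \<zero>) - 1 / q"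
  by (simp add: err_def cnt_0)

lemma err_1: "s \<in> carrier R \<Longrightarrow> err (Suc 0) s = roots s - 1"
proof -
  assume s: "s \<in> carrier R"
  have "cnt (Suc 0) s = roots s"
    unfolding cnt_Suc[OF s] cnt_0 roots_def using s
    by (intro sum.cong refl) (auto simp: minus_eq_0_iff)
  then show ?thesis using q_pos by (simp add: err_def)
qed

lemma sum_roots_shifted:
  assumes "c \<in> carrier R"
  shows "(\<Sum>b\<in>carrier R. roots (c \<oplus> b \<otimes> b)) = hyperbola c"
proof -
  have "hyperbola c = (\<Sum>b\<in>carrier R. \<Sum>a\<in>carrier R. of_bool (a \<otimes> a \<ominus> b \<otimes> b = c))"
    unfolding hyperbola_def by (rule sum.swap)
  also have "\<dots> = (\<Sum>b\<in>carrier R. roots (c \<oplus> b \<otimes> b))"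
    unfolding roots_def
  proof (intro sum.cong refl)
    fix a b assume "a \<in> carrier R" "b \<in> carrier R"
    then have "a \<otimes> a \<ominus> b \<otimes> b = c \<longleftrightarrow> a \<otimes> a = c \<oplus> b \<otimes> b"
      using assms add_eq_iff[of c "b \<otimes> b" "a \<otimes> a"] by auto
    then show "of_bool (a \<otimes> a \<ominus> b \<otimes> b = c) = (of_bool (a \<otimes> a = c \<oplus> b \<otimes> b) :: real)" by simp
  qed
  finally show ?thesis by simp
qed

text \<open>In dimension 2 the sign \<open>\<sigma>\<close> turns a sum of two squares into the
  hyperbola, whose counts are known. The relation passes to higher dimensions because
  \<open>err (Suc n)\<close> is a sum of shifts of \<open>err n\<close>.\<close>

lemma err_recurrence:
  obtains \<sigma> :: real where "\<sigma> = 1 \<or> \<sigma> = -1"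
    "\<And>u. u \<in> carrier R \<Longrightarrow> roots (\<ominus> u) - 1 = \<sigma> * (roots u - 1)"
    "\<And>n s. s \<in> carrier R \<Longrightarrow> err (n + 2) s = \<sigma> * q * err n s"
proof -
  obtain \<sigma> where \<sigma>: "\<sigma> = 1 \<or> \<sigma> = -1"
    "\<And>u. u \<in> carrier R \<Longrightarrow> roots (\<ominus> u) - 1 = \<sigma> * (roots u - 1)"
    using obtain_sigma by blast
  have rec: "err (n + 2) s = \<sigma> * q * err n s" if "s \<in> carrier R" for n s
    using that
  proof (induction n arbitrary: s)
    case 0
    have "err 2 s = (\<Sum>b\<in>carrier R. roots (s \<ominus> b \<otimes> b) - 1)"
      using 0 by (simp add: numeral_2_eq_2 err_Suc[of _ "Suc 0"] err_1)
    also have "\<dots> = (\<Sum>b\<in>carrier R. \<sigma> * (roots (\<ominus> s \<oplus> b \<otimes> b) - 1))"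
    proof (intro sum.cong refl)
      fix b assume b: "b \<in> carrier R"
      have "s \<ominus> b \<otimes> b = \<ominus> (\<ominus> s \<oplus> b \<otimes> b)" using b 0 by algebra
      then show "roots (s \<ominus> b \<otimes> b) - 1 = \<sigma> * (roots (\<ominus> s \<oplus> b \<otimes> b) - 1)"
        using \<sigma>(2)[of "\<ominus> s \<oplus> b \<otimes> b"] b 0 by simp
    qed
    also have "\<dots> = \<sigma> * (hyperbola (\<ominus> s) - q)"
      using 0 sum_const_carrier[of 1]
      by (simp add: sum_distrib_left[symmetric] sum_subtractf sum_roots_shifted del: sum_constant)
    also have "\<dots> = \<sigma> * q * err 0 s"
      using 0 q_pos by (simp add: hyperbola_eq err_0 algebra_simps)
    finally show ?case by (simp add: numeral_2_eq_2)
  next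
    case (Suc n)
    have "err (Suc n + 2) s = (\<Sum>a\<in>carrier R. err (n + 2) (s \<ominus> a \<otimes> a))"
      using err_Suc[OF Suc.prems, of "n + 2"] by simp
    also have "\<dots> = (\<Sum>a\<in>carrier R. \<sigma> * q * err n (s \<ominus> a \<otimes> a))"
      using Suc by (intro sum.cong refl Suc.IH) auto
    also have "\<dots> = \<sigma> * q * err (Suc n) s"
      using Suc.prems by (simp add: err_Suc sum_distrib_left)
    finally show ?case .
  qed
  show ?thesis by (rule that[OF \<sigma> rec])
qed

text \<open>Even dimensions see only whether \<open>s\<close> vanishes, odd ones its quadratic
  character. \<open>\<sigma>\<close> comes with its defining property, because the lower bound for
  equilateral triangles needs two such signs to cancel.\<close>

lemma err_even_odd:
  obtains \<sigma> :: real where "\<sigma> = 1 \<or> \<sigma> = -1"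
    "\<And>u. u \<in> carrier R \<Longrightarrow> roots (\<ominus> u) - 1 = \<sigma> * (roots u - 1)"
    "\<And>m s. s \<in> carrier R \<Longrightarrow> err (2 * m) s = \<sigma> ^ m * q ^ m * (of_bool (s = \<zero>) - 1 / q)"
    "\<And>m s. s \<in> carrier R \<Longrightarrow> err (2 * m + 1) s = \<sigma> ^ m * q ^ m * (roots s - 1)"
proof -
  obtain \<sigma> where \<sigma>: "\<sigma> = 1 \<or> \<sigma> = -1"
    "\<And>u. u \<in> carrier R \<Longrightarrow> roots (\<ominus> u) - 1 = \<sigma> * (roots u - 1)"
    "\<And>n s. s \<in> carrier R \<Longrightarrow> err (n + 2) s = \<sigma> * q * err n s"
    using err_recurrence by blast
  have even: "err (2 * m) s = \<sigma> ^ m * q ^ m * (of_bool (s = \<zero>) - 1 / q)" if "s \<in> carrier R" for m s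
  proof (induction m)
    case (Suc m)
    then show ?case using \<sigma>(3)[OF that, of "2 * m"] by simp
  qed (simp add: err_0)
  have odd: "err (2 * m + 1) s = \<sigma> ^ m * q ^ m * (roots s - 1)" if "s \<in> carrier R" for m s
  proof (induction m)
    case (Suc m)
    then show ?case using \<sigma>(3)[OF that, of "2 * m + 1"] by simp
  qed (use that in \<open>simp add: err_1\<close>)
  show ?thesis by (rule that[OF \<sigma>(1,2) even odd])
qed

section \<open>Hyperplane sections of spheres\<close>

lemma affine_inj:
  assumes "a \<in> carrier R" "b \<in> carrier R" "b \<noteq> \<zero>"
  shows "inj_on (\<lambda>l. a \<oplus> l \<otimes> b) (carrier R)"
  using assms by (auto intro!: inj_onI simp: m_rcancel)

lemma sum_affine_of_bool:
  assumes "a \<in> carrier R" "b \<in> carrier R" "b \<noteq> \<zero>" "c \<in> carrier R"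
  shows "(\<Sum>l\<in>carrier R. of_bool (a \<oplus> l \<otimes> b = c)) = (1::real)"
  using assms by (intro sum_of_bool_inj affine_inj) auto

text \<open>For every \<open>x\<close> exactly one multiple of \<open>z\<close> moves
  \<open>x\<close> into the hyperplane; averaging over these translations gives the density
  \<open>1 / q\<close>.\<close>

lemma hyperplane_card:
  assumes y: "y \<in> vecs R n" and z: "z \<in> vecs R n" "dot n z y \<noteq> \<zero>" and c: "c \<in> carrier R"
  shows "(\<Sum>x\<in>vecs R n. of_bool (dot n x y = c)) = q ^ n / q"
proof -
  have "q * (\<Sum>x\<in>vecs R n. of_bool (dot n x y = c)) =
      (\<Sum>l\<in>carrier R. \<Sum>x\<in>vecs R n. of_bool (dot n (axpy n l x z) y = c))"
    unfolding sum_const_carrier[symmetric]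
    using z by (intro sum.cong refl sum_translate[symmetric]) auto
  also have "\<dots> = (\<Sum>x\<in>vecs R n. \<Sum>l\<in>carrier R. of_bool (dot n (axpy n l x z) y = c))"
    by (rule sum.swap)
  also have "\<dots> = (\<Sum>x\<in>vecs R n. \<Sum>l\<in>carrier R. of_bool (dot n x y \<oplus> l \<otimes> dot n z y = c))"
    using y z by (intro sum.cong refl) (simp add: dot_axpy)
  also have "\<dots> = (\<Sum>x\<in>vecs R n. 1)"
    using y z c by (intro sum.cong refl sum_affine_of_bool) (auto intro: dot_vecs_closed)
  also have "\<dots> = q ^ n" by (simp add: card_vecs)
  finally show ?thesis using q_pos by (simp add: field_simps)
qed

lemma exists_dot_neq_0:
  assumes y: "y \<in> vecs R n" and i: "i < n" "y i \<noteq> \<zero>"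
  obtains z where "z \<in> vecs R n" "dot n z y \<noteq> \<zero>"
proof
  let ?z = "\<lambda>k\<in>{..<n}. if k = i then \<one> else \<zero>"
  show "?z \<in> vecs R n" by (auto simp: vecs_def)
  have "dot n ?z y = (\<Oplus>k\<in>{..<n}. if i = k then y k else \<zero>)"
    unfolding dot_def using y by (intro finsum_cong') (auto simp: vecs_nth)
  also have "\<dots> = y i" using y i by (intro finsum_singleton) (auto simp: vecs_nth)
  finally show "dot n ?z y \<noteq> \<zero>" using i by simp
qed

definition slice :: "nat \<Rightarrow> (nat \<Rightarrow> 'a) \<Rightarrow> 'a \<Rightarrow> 'a \<Rightarrow> real" where
  "slice n y c s = (\<Sum>x\<in>vecs R n. of_bool (dot n x y = c) * of_bool (sq_norm R n x = s))"

lemma sum_slice: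
  assumes y: "y \<in> vecs R n"
  shows "(\<Sum>c\<in>carrier R. slice n y c s) = cnt n s"
proof -
  have "(\<Sum>c\<in>carrier R. slice n y c s) =
      (\<Sum>x\<in>vecs R n. \<Sum>c\<in>carrier R. of_bool (dot n x y = c) * of_bool (sq_norm R n x = s))"
    unfolding slice_def by (rule sum.swap)
  also have "\<dots> = cnt n s" unfolding cnt_def
  proof (intro sum.cong refl)
    fix x assume "x \<in> vecs R n"
    then have d: "dot n x y \<in> carrier R" using y by (rule dot_vecs_closed)
    have "(\<Sum>c\<in>carrier R. of_bool (dot n x y = c)) = (1::real)"
      using d finite_carrier by (simp add: of_bool_def)
    then show "(\<Sum>c\<in>carrier R. of_bool (dot n x y = c) * of_bool (sq_norm R n x = s)) =
        (of_bool (sq_norm R n x = s) :: real)"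
      by (simp only: sum_distrib_right[symmetric])
  qed
  finally show ?thesis .
qed

lemma sum_slice_norms:
  "(\<Sum>s\<in>carrier R. slice n y c s) = (\<Sum>x\<in>vecs R n. of_bool (dot n x y = c))"
proof -
  have "(\<Sum>s\<in>carrier R. slice n y c s) =
      (\<Sum>x\<in>vecs R n. \<Sum>s\<in>carrier R. of_bool (dot n x y = c) * of_bool (sq_norm R n x = s))"
    unfolding slice_def by (rule sum.swap)
  also have "\<dots> = (\<Sum>x\<in>vecs R n. of_bool (dot n x y = c))"
  proof (intro sum.cong refl)
    fix x assume "x \<in> vecs R n"
    then have "(\<Sum>s\<in>carrier R. of_bool (sq_norm R n x = s)) = (1::real)"
      using sq_norm_closed finite_carrier by (simp add: of_bool_def)
    then show "(\<Sum>s\<in>carrier R. of_bool (dot n x y = c) * of_bool (sq_norm R n x = s)) =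
        (of_bool (dot n x y = c) :: real)"
      by (simp only: sum_distrib_left[symmetric])
  qed
  finally show ?thesis .
qed

lemma double_neq_0: "a \<in> carrier R \<Longrightarrow> a \<noteq> \<zero> \<Longrightarrow> a \<oplus> a \<noteq> \<zero>"
  using double_inj[of a \<zero>] by auto

text \<open>Translating along an isotropic vector \<open>y\<close> changes the norm of \<open>x\<close> by a multiple of
  \<open>dot n x y\<close>, so all spheres meet an affine hyperplane \<open>dot n x y = c \<noteq> \<zero>\<close> equally often.\<close>

lemma slice_isotropic:
  assumes y: "y \<in> vecs R n" "sq_norm R n y = \<zero>" and z: "z \<in> vecs R n" "dot n z y \<noteq> \<zero>"
    and c: "c \<in> carrier R" "c \<noteq> \<zero>" and s: "s \<in> carrier R"
  shows "slice n y c s = q ^ n / q\<^sup>2"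
proof -
  have yy: "dot n y y = \<zero>" using y by (simp add: sq_norm_eq_dot)
  have "q * slice n y c s = (\<Sum>l\<in>carrier R. \<Sum>x\<in>vecs R n.
      of_bool (dot n (axpy n l x y) y = c) * of_bool (sq_norm R n (axpy n l x y) = s))"
    unfolding sum_const_carrier[symmetric] slice_def
    using y by (intro sum.cong refl sum_translate[symmetric]) auto
  also have "\<dots> = (\<Sum>x\<in>vecs R n. \<Sum>l\<in>carrier R.
      of_bool (dot n (axpy n l x y) y = c) * of_bool (sq_norm R n (axpy n l x y) = s))"
    by (rule sum.swap)
  also have "\<dots> = (\<Sum>x\<in>vecs R n. \<Sum>l\<in>carrier R.
      of_bool (dot n x y = c) * of_bool (sq_norm R n x \<oplus> l \<otimes> (c \<oplus> c) = s))"
  proof (intro sum.cong refl)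
    fix x l assume x: "x \<in> vecs R n" and l: "l \<in> carrier R"
    note cl = sq_norm_closed[OF x] dot_vecs_closed[OF x y(1)]
    have 1: "dot n (axpy n l x y) y = dot n x y"
      using x l y yy cl by (simp add: dot_axpy)
    have 2: "sq_norm R n (axpy n l x y) = sq_norm R n x \<oplus> l \<otimes> (dot n x y \<oplus> dot n x y)"
    proof -
      have "sq_norm R n (axpy n l x y) = sq_norm R n x \<oplus> (l \<oplus> l) \<otimes> dot n x y"
        using x l y cl by (simp add: sq_norm_axpy)
      also have "(l \<oplus> l) \<otimes> dot n x y = l \<otimes> (dot n x y \<oplus> dot n x y)" using l cl(2) by algebra
      finally show ?thesis .
    qed
    show "of_bool (dot n (axpy n l x y) y = c) * of_bool (sq_norm R n (axpy n l x y) = s) =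
        (of_bool (dot n x y = c) * of_bool (sq_norm R n x \<oplus> l \<otimes> (c \<oplus> c) = s) :: real)"
      unfolding 1 2 by auto
  qed
  also have "\<dots> = (\<Sum>x\<in>vecs R n. of_bool (dot n x y = c))"
  proof (intro sum.cong refl)
    fix x assume x: "x \<in> vecs R n"
    have "(\<Sum>l\<in>carrier R. of_bool (sq_norm R n x \<oplus> l \<otimes> (c \<oplus> c) = s)) = (1::real)"
      using c s x double_neq_0 by (intro sum_affine_of_bool) (auto intro: sq_norm_closed)
    then show "(\<Sum>l\<in>carrier R. of_bool (dot n x y = c) * of_bool (sq_norm R n x \<oplus> l \<otimes> (c \<oplus> c) = s)) =
        (of_bool (dot n x y = c) :: real)"
      by (simp only: sum_distrib_left[symmetric])
  qed
  also have "\<dots> = q ^ n / q" using y(1) z c(1) by (rule hyperplane_card)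
  finally show ?thesis using q_pos by (simp add: field_simps power2_eq_square)
qed

text \<open>All slices with \<open>c \<noteq> \<zero>\<close> are exactly uniform, so the one
  through the origin absorbs the whole error of the sphere.\<close>

lemma slice_0_isotropic:
  assumes y: "y \<in> vecs R n" "sq_norm R n y = \<zero>" and z: "z \<in> vecs R n" "dot n z y \<noteq> \<zero>"
    and s: "s \<in> carrier R"
  shows "slice n y \<zero> s = q ^ n / q\<^sup>2 + err n s"
proof -
  have "cnt n s = slice n y \<zero> s + (\<Sum>c\<in>carrier R - {\<zero>}. slice n y c s)"
    using sum_slice[OF y(1), of s] finite_carrier by (simp add: sum.remove[of _ \<zero>])
  also have "(\<Sum>c\<in>carrier R - {\<zero>}. slice n y c s) = (\<Sum>c\<in>carrier R - {\<zero>}. q ^ n / q\<^sup>2)"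
    using assms by (intro sum.cong refl slice_isotropic) auto
  also have "\<dots> = (\<Sum>c\<in>carrier R. q ^ n / q\<^sup>2) - q ^ n / q\<^sup>2"
    using finite_carrier by (subst sum_diff1) auto
  also have "\<dots> = q * (q ^ n / q\<^sup>2) - q ^ n / q\<^sup>2" by (simp only: sum_const_carrier)
  finally show ?thesis using q_pos by (simp add: err_def field_simps power2_eq_square)
qed

text \<open>Adding \<open>l\<close> times \<open>y\<close> carries the hyperplane through the origin
  to a parallel one; on the former the cross term vanishes, so the norm changes by the constant
  \<open>l \<otimes> l \<otimes> sq_norm R n y\<close>.\<close>

lemma slice_translate:
  assumes y: "y \<in> vecs R n" and l: "l \<in> carrier R" and s: "s \<in> carrier R"
  shows "slice n y (l \<otimes> sq_norm R n y) s = slice n y \<zero> (s \<ominus> l \<otimes> l \<otimes> sq_norm R n y)"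
proof -
  let ?b = "sq_norm R n y"
  have b: "?b \<in> carrier R" "dot n y y = ?b" using y sq_norm_closed sq_norm_eq_dot by metis+
  have "slice n y (l \<otimes> ?b) s = (\<Sum>x\<in>vecs R n.
      of_bool (dot n (axpy n l x y) y = l \<otimes> ?b) * of_bool (sq_norm R n (axpy n l x y) = s))"
    unfolding slice_def using y l by (intro sum_translate[symmetric]) auto
  also have "\<dots> = slice n y \<zero> (s \<ominus> l \<otimes> l \<otimes> ?b)" unfolding slice_def
  proof (intro sum.cong refl)
    fix x assume x: "x \<in> vecs R n"
    note cl = sq_norm_closed[OF x] dot_vecs_closed[OF x y]
    have 1: "dot n (axpy n l x y) y = l \<otimes> ?b \<longleftrightarrow> dot n x y = \<zero>"
      using x l y b cl by (simp add: dot_axpy)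
    have 2: "sq_norm R n (axpy n l x y) = s \<longleftrightarrow> sq_norm R n x = s \<ominus> l \<otimes> l \<otimes> ?b" if "dot n x y = \<zero>"
      using x l y b cl s that by (simp add: sq_norm_axpy add_eq_iff)
    show "of_bool (dot n (axpy n l x y) y = l \<otimes> ?b) * of_bool (sq_norm R n (axpy n l x y) = s) =
        (of_bool (dot n x y = \<zero>) * of_bool (sq_norm R n x = s \<ominus> l \<otimes> l \<otimes> ?b) :: real)"
      unfolding 1 using 2 by auto
  qed
  finally show ?thesis .
qed

text \<open>Convolving twice with the one-dimensional form \<open>l \<mapsto> l\<^sup>2 b\<close>, once with each sign,
  is convolution with a hyperbolic plane, which is almost uniform; this inverts the relation
  between \<open>cnt n\<close> and the sections of the hyperplane orthogonal to \<open>y\<close>.\<close>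

lemma slice_0_anisotropic:
  assumes y: "y \<in> vecs R n" "sq_norm R n y \<noteq> \<zero>" and s: "s \<in> carrier R"
  shows "slice n y \<zero> s =
    q ^ n / q\<^sup>2 + (\<Sum>m\<in>carrier R. err n (s \<oplus> m \<otimes> m \<otimes> sq_norm R n y)) / q"
proof -
  define b where "b = sq_norm R n y"
  have b: "b \<in> carrier R" "b \<noteq> \<zero>" using y by (auto simp: b_def sq_norm_closed)
  define M where "M = slice n y \<zero>"
  have cnt: "cnt n u = (\<Sum>l\<in>carrier R. M (u \<ominus> l \<otimes> l \<otimes> b))" if u: "u \<in> carrier R" for u
  proof -
    have "cnt n u = (\<Sum>c\<in>carrier R. slice n y c u)" using sum_slice[OF y(1)] by simp
    also have "\<dots> = (\<Sum>l\<in>carrier R. slice n y (l \<otimes> b) u)"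
      using b by (intro sum_reindex_carrier[symmetric]) (auto intro!: inj_onI simp: m_rcancel)
    also have "\<dots> = (\<Sum>l\<in>carrier R. M (u \<ominus> l \<otimes> l \<otimes> b))"
      unfolding M_def b_def using y(1) u by (intro sum.cong refl slice_translate) auto
    finally show ?thesis .
  qed
  have sumM: "(\<Sum>v\<in>carrier R. M (s \<oplus> v \<otimes> b)) = q ^ n / q"
  proof -
    have "(\<Sum>v\<in>carrier R. M (s \<oplus> v \<otimes> b)) = (\<Sum>u\<in>carrier R. M u)"
      using s b by (intro sum_reindex_carrier affine_inj) auto
    also have "\<dots> = q ^ n / q" unfolding M_def sum_slice_norms
      using y by (intro hyperplane_card) (auto simp: sq_norm_eq_dot)
    finally show ?thesis .
  qed
  have "(\<Sum>m\<in>carrier R. cnt n (s \<oplus> m \<otimes> m \<otimes> b)) =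
      (\<Sum>m\<in>carrier R. \<Sum>l\<in>carrier R. M (s \<oplus> (m \<otimes> m \<ominus> l \<otimes> l) \<otimes> b))"
  proof (intro sum.cong refl)
    fix m assume m: "m \<in> carrier R"
    have "cnt n (s \<oplus> m \<otimes> m \<otimes> b) = (\<Sum>l\<in>carrier R. M (s \<oplus> m \<otimes> m \<otimes> b \<ominus> l \<otimes> l \<otimes> b))"
      using s m b by (intro cnt) auto
    also have "\<dots> = (\<Sum>l\<in>carrier R. M (s \<oplus> (m \<otimes> m \<ominus> l \<otimes> l) \<otimes> b))"
    proof (intro sum.cong refl)
      fix l assume l: "l \<in> carrier R"
      have "s \<oplus> m \<otimes> m \<otimes> b \<ominus> l \<otimes> l \<otimes> b = s \<oplus> (m \<otimes> m \<ominus> l \<otimes> l) \<otimes> b"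
        using s m l b(1) by algebra
      then show "M (s \<oplus> m \<otimes> m \<otimes> b \<ominus> l \<otimes> l \<otimes> b) = M (s \<oplus> (m \<otimes> m \<ominus> l \<otimes> l) \<otimes> b)" by simp
    qed
    finally show "cnt n (s \<oplus> m \<otimes> m \<otimes> b) = (\<Sum>l\<in>carrier R. M (s \<oplus> (m \<otimes> m \<ominus> l \<otimes> l) \<otimes> b))" .
  qed
  also have "\<dots> = (\<Sum>m\<in>carrier R. \<Sum>l\<in>carrier R. \<Sum>v\<in>carrier R.
      of_bool (m \<otimes> m \<ominus> l \<otimes> l = v) * M (s \<oplus> v \<otimes> b))"
  proof (intro sum.cong refl)
    fix m l assume "m \<in> carrier R" "l \<in> carrier R"
    then have c: "m \<otimes> m \<ominus> l \<otimes> l \<in> carrier R" by simp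
    have "(\<Sum>v\<in>carrier R. of_bool (m \<otimes> m \<ominus> l \<otimes> l = v) * M (s \<oplus> v \<otimes> b)) =
        (\<Sum>v\<in>carrier R. if v = m \<otimes> m \<ominus> l \<otimes> l then M (s \<oplus> v \<otimes> b) else 0)"
      by (intro sum.cong refl) auto
    also have "\<dots> = M (s \<oplus> (m \<otimes> m \<ominus> l \<otimes> l) \<otimes> b)" using c finite_carrier by simp
    finally show "M (s \<oplus> (m \<otimes> m \<ominus> l \<otimes> l) \<otimes> b) =
        (\<Sum>v\<in>carrier R. of_bool (m \<otimes> m \<ominus> l \<otimes> l = v) * M (s \<oplus> v \<otimes> b))" by simp
  qed
  also have "\<dots> = (\<Sum>m\<in>carrier R. \<Sum>v\<in>carrier R. \<Sum>l\<in>carrier R.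
      of_bool (m \<otimes> m \<ominus> l \<otimes> l = v) * M (s \<oplus> v \<otimes> b))"
    by (intro sum.cong refl sum.swap)
  also have "\<dots> = (\<Sum>v\<in>carrier R. \<Sum>m\<in>carrier R. \<Sum>l\<in>carrier R.
      of_bool (m \<otimes> m \<ominus> l \<otimes> l = v) * M (s \<oplus> v \<otimes> b))"
    by (rule sum.swap)
  also have "\<dots> = (\<Sum>v\<in>carrier R. hyperbola v * M (s \<oplus> v \<otimes> b))"
    by (simp only: hyperbola_def sum_distrib_right)
  \<comment> \<open>The hyperbola has \<open>q - 1\<close> points for each
    \<open>v \<noteq> \<zero>\<close>, so the sum involves only the total of \<open>M\<close>, known
    from the hyperplane count, and the single value \<open>M s\<close> to be found.\<close>
  also have "\<dots> = (\<Sum>v\<in>carrier R. (q - 1) * M (s \<oplus> v \<otimes> b) + (if v = \<zero> then q * M (s \<oplus> v \<otimes> b) else 0))"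
    by (intro sum.cong refl) (simp add: hyperbola_eq algebra_simps)
  also have "\<dots> = (q - 1) * (q ^ n / q) + q * M s"
    using finite_carrier s b by (simp add: sum.distrib sum_distrib_left[symmetric] sumM)
  finally have "(q - 1) * (q ^ n / q) + q * M s = (\<Sum>m\<in>carrier R. cnt n (s \<oplus> m \<otimes> m \<otimes> b))" by simp
  also have "\<dots> = (\<Sum>m\<in>carrier R. q ^ n / q + err n (s \<oplus> m \<otimes> m \<otimes> b))"
    by (simp add: err_def)
  also have "\<dots> = q * (q ^ n / q) + (\<Sum>m\<in>carrier R. err n (s \<oplus> m \<otimes> m \<otimes> b))"
    by (simp only: sum.distrib sum_const_carrier)
  finally have "q * M s = q ^ n / q + (\<Sum>m\<in>carrier R. err n (s \<oplus> m \<otimes> m \<otimes> b))"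
    unfolding left_diff_distrib by linarith
  then show ?thesis using q_pos unfolding M_def b_def
    by (simp add: field_simps power2_eq_square)
qed

section \<open>Intersections of two spheres\<close>

definition codeg :: "nat \<Rightarrow> 'a \<Rightarrow> (nat \<Rightarrow> 'a) \<Rightarrow> real" where
  "codeg n t y = (\<Sum>z\<in>vecs R n. of_bool (sq_norm R n z = t) * of_bool (sq_norm R n (vec_minus R n z y) = t))"

lemma obtain_half:
  obtains h where "h \<in> carrier R" "h \<oplus> h = \<one>"
proof
  have u: "\<one> \<oplus> \<one> \<in> Units R" using two_neq_0 field_Units by auto
  show "inv (\<one> \<oplus> \<one>) \<in> carrier R" using u by simp
  have "(\<one> \<oplus> \<one>) \<otimes> inv (\<one> \<oplus> \<one>) = inv (\<one> \<oplus> \<one>) \<oplus> inv (\<one> \<oplus> \<one>)"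
    using u by (subst l_distr) auto
  then show "inv (\<one> \<oplus> \<one>) \<oplus> inv (\<one> \<oplus> \<one>) = \<one>" using u by simp
qed

text \<open>Subtracting the equations of the two spheres leaves that of the perpendicular bisector,
  \<open>dot n z y = h \<otimes> sq_norm R n y\<close>, where \<open>h\<close> is one half.\<close>

lemma codeg_eq_slice:
  assumes y: "y \<in> vecs R n" and t: "t \<in> carrier R" and h: "h \<in> carrier R" "h \<oplus> h = \<one>"
  shows "codeg n t y = slice n y (h \<otimes> sq_norm R n y) t"
  unfolding codeg_def slice_def
proof (intro sum.cong refl)
  fix z assume z: "z \<in> vecs R n"
  let ?b = "sq_norm R n y" and ?p = "dot n z y"
  have b: "?b \<in> carrier R" and p: "?p \<in> carrier R" using y z by (auto intro: sq_norm_closed dot_vecs_closed)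
  have eq: "sq_norm R n (vec_minus R n z y) = t \<oplus> (?b \<ominus> (?p \<oplus> ?p))" if "sq_norm R n z = t"
  proof -
    have "sq_norm R n (vec_minus R n z y) = t \<oplus> (\<ominus> \<one> \<oplus> \<ominus> \<one>) \<otimes> ?p \<oplus> (\<ominus> \<one> \<otimes> \<ominus> \<one>) \<otimes> ?b"
      using y z that by (simp add: vec_minus_eq_axpy sq_norm_axpy)
    also have "\<dots> = t \<oplus> (?b \<ominus> (?p \<oplus> ?p))" using t b p by algebra
    finally show ?thesis .
  qed
  have "t \<oplus> (?b \<ominus> (?p \<oplus> ?p)) = t \<longleftrightarrow> ?b \<ominus> (?p \<oplus> ?p) = \<zero>"
    using t b p by simp
  also have "\<dots> \<longleftrightarrow> ?b = ?p \<oplus> ?p" using b p by (simp add: minus_eq_0_iff)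
  also have "\<dots> \<longleftrightarrow> ?p = h \<otimes> ?b"
  proof
    assume "?b = ?p \<oplus> ?p"
    then have "h \<otimes> ?b = (h \<oplus> h) \<otimes> ?p" using h(1) p by (simp add: l_distr r_distr)
    then show "?p = h \<otimes> ?b" using h p by simp
  next
    assume "?p = h \<otimes> ?b"
    then have "?p \<oplus> ?p = (h \<oplus> h) \<otimes> ?b" using h(1) b by (simp add: l_distr)
    then show "?b = ?p \<oplus> ?p" using h b by simp
  qed
  finally have iff: "t \<oplus> (?b \<ominus> (?p \<oplus> ?p)) = t \<longleftrightarrow> ?p = h \<otimes> ?b" .
  show "of_bool (sq_norm R n z = t) * of_bool (sq_norm R n (vec_minus R n z y) = t) =
      (of_bool (?p = h \<otimes> ?b) * of_bool (sq_norm R n z = t) :: real)"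
    using eq iff by auto
qed

text \<open>The bisector of an isotropic \<open>y\<close> passes through the origin, so this is the
  one slice that carries an error.\<close>

lemma codeg_isotropic:
  assumes y: "y \<in> vecs R n" "sq_norm R n y = \<zero>" "i < n" "y i \<noteq> \<zero>" and t: "t \<in> carrier R"
  shows "codeg n t y = q ^ n / q\<^sup>2 + err n t"
proof -
  obtain h where h: "h \<in> carrier R" "h \<oplus> h = \<one>" using obtain_half .
  obtain z where z: "z \<in> vecs R n" "dot n z y \<noteq> \<zero>" using exists_dot_neq_0[OF y(1,3,4)] .
  show ?thesis
    using codeg_eq_slice[OF y(1) t h] slice_0_isotropic[OF y(1,2) z t] h y(2) by simp
qed

text \<open>Seen from the midpoint, \<open>h\<close> times \<open>y\<close>, the intersection is a
  sphere in the hyperplane orthogonal to \<open>y\<close>, with the radius lowered by a quarter of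
  \<open>sq_norm R n y\<close>.\<close>

lemma codeg_anisotropic:
  assumes y: "y \<in> vecs R n" "sq_norm R n y \<noteq> \<zero>" and t: "t \<in> carrier R"
    and h: "h \<in> carrier R" "h \<oplus> h = \<one>"
  shows "codeg n t y = q ^ n / q\<^sup>2 +
    (\<Sum>m\<in>carrier R. err n (t \<ominus> h \<otimes> h \<otimes> sq_norm R n y \<oplus> m \<otimes> m \<otimes> sq_norm R n y)) / q"
proof -
  have "codeg n t y = slice n y \<zero> (t \<ominus> h \<otimes> h \<otimes> sq_norm R n y)"
    using codeg_eq_slice[OF y(1) t h] slice_translate[OF y(1) h(1) t] by simp
  then show ?thesis using y t h by (subst (asm) slice_0_anisotropic) (auto intro: sq_norm_closed)
qed

section \<open>Bounds for spheres and their intersections\<close>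

lemma q_ge_3: "3 \<le> q"
proof -
  have "\<one> \<oplus> \<one> \<noteq> \<one>" using add.l_cancel_one'[of \<one> \<one>] by auto
  then have "card {\<zero>, \<one>, \<one> \<oplus> \<one>} = 3" using two_neq_0 by auto
  moreover have "card {\<zero>, \<one>, \<one> \<oplus> \<one>} \<le> card (carrier R)"
    using finite_carrier by (intro card_mono) auto
  ultimately show ?thesis by (simp add: q_def order_def)
qed

lemma abs_sigma_power: "\<sigma> = 1 \<or> \<sigma> = -1 \<Longrightarrow> \<bar>\<sigma> ^ m * q ^ m\<bar> = q ^ m" for \<sigma> :: real
  using q_pos by (auto simp: abs_mult power_abs)

lemma abs_roots_minus_1: "\<bar>roots s - 1\<bar> \<le> 1"
  using roots_nonneg[of s] roots_le_2[of s] by (auto simp: abs_if)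

text \<open>In even dimension \<open>2 * m\<close> the factor \<open>1 / q\<close>, present because
  \<open>s \<noteq> \<zero>\<close>, lowers the exponent from \<open>m\<close> to
  \<open>m - 1\<close>; in odd dimension \<open>2 * m + 1\<close> it is \<open>m\<close>. Both are
  \<open>(n - 1) div 2\<close>.\<close>

lemma abs_err_le:
  assumes s: "s \<in> carrier R" "s \<noteq> \<zero>" and n: "1 \<le> n"
  shows "\<bar>err n s\<bar> \<le> q ^ ((n - 1) div 2)"
proof -
  obtain \<sigma> :: real where \<sigma>: "\<sigma> = 1 \<or> \<sigma> = -1"
    and even: "\<And>m s. s \<in> carrier R \<Longrightarrow> err (2 * m) s = \<sigma> ^ m * q ^ m * (of_bool (s = \<zero>) - 1 / q)"
    and odd: "\<And>m s. s \<in> carrier R \<Longrightarrow> err (2 * m + 1) s = \<sigma> ^ m * q ^ m * (roots s - 1)"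
    using err_even_odd by metis
  show ?thesis
  proof (cases "even n")
    case True
    then obtain m where m: "n = 2 * Suc m" using n by (metis dvdE not0_implies_Suc mult_0_right not_one_le_zero)
    have "\<bar>err n s\<bar> = \<bar>\<sigma> ^ Suc m * q ^ Suc m\<bar> * (1 / q)"
      unfolding m even[OF s(1)] abs_mult using s q_pos by simp
    also have "\<dots> = q ^ m" unfolding abs_sigma_power[OF \<sigma>] using q_pos by simp
    finally show ?thesis by (simp add: m)
  next
    case False
    then obtain m where m: "n = 2 * m + 1" by (rule oddE)
    have "\<bar>err n s\<bar> = \<bar>\<sigma> ^ m * q ^ m\<bar> * \<bar>roots s - 1\<bar>" unfolding m odd[OF s(1)] by (rule abs_mult)
    also have "\<dots> \<le> q ^ m * 1" unfolding abs_sigma_power[OF \<sigma>]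
      using q_pos abs_roots_minus_1 by (intro mult_left_mono) auto
    finally show ?thesis by (simp add: m)
  qed
qed

lemma sum_roots_indicator:
  assumes s: "s \<in> carrier R" and b: "b \<in> carrier R" "b \<noteq> \<zero>"
  shows "(\<Sum>m\<in>carrier R. of_bool (s \<oplus> m \<otimes> m \<otimes> b = \<zero>)) = roots (\<ominus> s \<otimes> inv b)"
  unfolding roots_def
proof (intro sum.cong refl)
  fix m assume m: "m \<in> carrier R"
  have i: "inv b \<in> carrier R" "b \<otimes> inv b = \<one>" using b field_Units by auto
  have "s \<oplus> m \<otimes> m \<otimes> b = \<zero> \<longleftrightarrow> m \<otimes> m \<otimes> b = \<ominus> s"
    using s m b minus_equality[of "m \<otimes> m \<otimes> b" s] by (auto simp: r_neg a_comm)
  also have "\<dots> \<longleftrightarrow> m \<otimes> m = \<ominus> s \<otimes> inv b"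
  proof
    assume *: "m \<otimes> m \<otimes> b = \<ominus> s"
    have "\<ominus> s \<otimes> inv b = m \<otimes> m \<otimes> (b \<otimes> inv b)" unfolding *[symmetric] using m b i(1) by (simp add: m_assoc)
    then show "m \<otimes> m = \<ominus> s \<otimes> inv b" using m i(2) by simp
  next
    assume "m \<otimes> m = \<ominus> s \<otimes> inv b"
    then have "m \<otimes> m \<otimes> b = \<ominus> s \<otimes> (b \<otimes> inv b)" using s b i(1) by (simp add: m_assoc m_comm[of b])
    then show "m \<otimes> m \<otimes> b = \<ominus> s" using s i(2) by simp
  qed
  finally show "of_bool (s \<oplus> m \<otimes> m \<otimes> b = \<zero>) = (of_bool (m \<otimes> m = \<ominus> s \<otimes> inv b) :: real)" by simp
qed

text \<open>\<open>s \<oplus> m \<otimes> m \<otimes> b\<close> may vanish, and there the error in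
  even dimension is larger by about a factor \<open>q\<close>. This happens for at most two
  \<open>m\<close>, and their number is again a value of \<open>roots\<close>, so the average keeps
  the exponent of \<open>abs_err_le\<close>. In odd dimension the terms are bounded one by
  one.\<close>

lemma abs_sum_err_le:
  assumes s: "s \<in> carrier R" and b: "b \<in> carrier R" "b \<noteq> \<zero>" and n: "1 \<le> n"
  shows "\<bar>\<Sum>m\<in>carrier R. err n (s \<oplus> m \<otimes> m \<otimes> b)\<bar> \<le> q * q ^ ((n - 1) div 2)"
proof -
  obtain \<sigma> :: real where \<sigma>: "\<sigma> = 1 \<or> \<sigma> = -1"
    and even: "\<And>m s. s \<in> carrier R \<Longrightarrow> err (2 * m) s = \<sigma> ^ m * q ^ m * (of_bool (s = \<zero>) - 1 / q)"
    and odd: "\<And>m s. s \<in> carrier R \<Longrightarrow> err (2 * m + 1) s = \<sigma> ^ m * q ^ m * (roots s - 1)"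
    using err_even_odd by metis
  have c: "s \<oplus> m \<otimes> m \<otimes> b \<in> carrier R" if "m \<in> carrier R" for m using that s b by simp
  show ?thesis
  proof (cases "even n")
    case True
    then obtain k where k: "n = 2 * Suc k" using n by (metis dvdE not0_implies_Suc mult_0_right not_one_le_zero)
    have "(\<Sum>m\<in>carrier R. err n (s \<oplus> m \<otimes> m \<otimes> b)) =
        (\<Sum>m\<in>carrier R. \<sigma> ^ Suc k * q ^ Suc k * (of_bool (s \<oplus> m \<otimes> m \<otimes> b = \<zero>) - 1 / q))"
      unfolding k by (intro sum.cong refl even c)
    also have "\<dots> = \<sigma> ^ Suc k * q ^ Suc k * (roots (\<ominus> s \<otimes> inv b) - q * (1 / q))"
      by (simp only: sum_distrib_left[symmetric] sum_subtractf sum_roots_indicator[OF s b] sum_const_carrier)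
    also have "q * (1 / q) = 1" using q_pos by simp
    finally have "\<bar>\<Sum>m\<in>carrier R. err n (s \<oplus> m \<otimes> m \<otimes> b)\<bar> = q ^ Suc k * \<bar>roots (\<ominus> s \<otimes> inv b) - 1\<bar>"
      by (simp only: abs_mult[of _ "_ - 1"] abs_sigma_power[OF \<sigma>])
    also have "\<dots> \<le> q ^ Suc k * 1" using abs_roots_minus_1 q_pos by (intro mult_left_mono) auto
    finally show ?thesis by (simp add: k)
  next
    case False
    then obtain k where k: "n = 2 * k + 1" by (rule oddE)
    have "\<bar>\<Sum>m\<in>carrier R. err n (s \<oplus> m \<otimes> m \<otimes> b)\<bar> \<le> (\<Sum>m\<in>carrier R. \<bar>err n (s \<oplus> m \<otimes> m \<otimes> b)\<bar>)"
      by (rule sum_abs)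
    also have "\<dots> \<le> (\<Sum>m\<in>carrier R. q ^ k)"
    proof (rule sum_mono)
      fix m assume m: "m \<in> carrier R"
      have "\<bar>err n (s \<oplus> m \<otimes> m \<otimes> b)\<bar> = q ^ k * \<bar>roots (s \<oplus> m \<otimes> m \<otimes> b) - 1\<bar>"
        unfolding k odd[OF c[OF m]] by (simp only: abs_mult[of _ "_ - 1"] abs_sigma_power[OF \<sigma>])
      also have "\<dots> \<le> q ^ k * 1" using abs_roots_minus_1 q_pos by (intro mult_left_mono) auto
      finally show "\<bar>err n (s \<oplus> m \<otimes> m \<otimes> b)\<bar> \<le> q ^ k" by simp
    qed
    finally show ?thesis by (simp add: k sum_const_carrier del: sum_constant)
  qed
qed

lemma codeg_le:
  assumes y: "y \<in> vecs R n" "i < n" "y i \<noteq> \<zero>" and t: "t \<in> carrier R" "t \<noteq> \<zero>"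
  shows "codeg n t y \<le> q ^ n / q\<^sup>2 + q ^ ((n - 1) div 2)"
proof (cases "sq_norm R n y = \<zero>")
  case True
  then show ?thesis using codeg_isotropic[OF y(1) True y(2,3) t(1)] abs_err_le[OF t, of n] y(2) by auto
next
  case False
  obtain h where h: "h \<in> carrier R" "h \<oplus> h = \<one>" using obtain_half .
  have b: "sq_norm R n y \<in> carrier R" using y by (rule_tac sq_norm_closed)
  have s: "t \<ominus> h \<otimes> h \<otimes> sq_norm R n y \<in> carrier R" using t h b by simp
  have "(\<Sum>m\<in>carrier R. err n (t \<ominus> h \<otimes> h \<otimes> sq_norm R n y \<oplus> m \<otimes> m \<otimes> sq_norm R n y)) \<le>
      q * q ^ ((n - 1) div 2)"
    using abs_sum_err_le[OF s b False, of n] y(2) by linarith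
  then show ?thesis unfolding codeg_anisotropic[OF y(1) False t(1) h]
    using q_pos by (simp add: pos_divide_le_eq mult.commute)
qed

lemma abs_err_le_third:
  assumes "t \<in> carrier R" "t \<noteq> \<zero>" and n: "2 \<le> n"
  shows "\<bar>err n t\<bar> \<le> q ^ (n - 1) / 3"
proof -
  have "\<bar>err n t\<bar> \<le> q ^ ((n - 1) div 2)" using assms by (intro abs_err_le) auto
  also have "\<dots> \<le> q ^ (n - 2)" using n q_ge_3 by (intro power_increasing) auto
  also have "\<dots> * 3 \<le> q ^ (n - 2) * q" using q_ge_3 by (intro mult_left_mono) auto
  also have "q ^ (n - 2) * q = q ^ (n - 1)" using n by (auto simp: le_iff_add mult.commute)
  finally show ?thesis by simp
qed

lemma cnt_eq: "1 \<le> n \<Longrightarrow> cnt n t = q ^ (n - 1) + err n t"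
  using q_pos by (cases n) (auto simp: err_def)

lemma cnt_bounds:
  assumes "t \<in> carrier R" "t \<noteq> \<zero>" and n: "2 \<le> n"
  shows "q ^ (n - 1) / 2 \<le> cnt n t" "cnt n t \<le> 2 * q ^ (n - 1)"
proof -
  have "0 < q ^ (n - 1)" using q_pos by simp
  then show "q ^ (n - 1) / 2 \<le> cnt n t" "cnt n t \<le> 2 * q ^ (n - 1)"
    using abs_err_le_third[OF assms] cnt_eq[of n t] n by (auto simp: abs_if split: if_splits)
qed

text \<open>The side condition \<open>w \<otimes> w = 3\<close> guarantees equilateral triangles of side 1 in the plane.\<close>

lemma codeg_ge:
  assumes y: "y \<in> vecs R n" "sq_norm R n y = \<one>" and n: "2 \<le> n"
    and w: "w \<in> carrier R" "w \<noteq> \<zero>" "w \<otimes> w = \<one> \<oplus> \<one> \<oplus> \<one>"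
  shows "q ^ n / q\<^sup>2 / 2 \<le> codeg n \<one> y"
proof -
  obtain h where h: "h \<in> carrier R" "h \<oplus> h = \<one>" using obtain_half .
  obtain \<sigma> :: real where \<sigma>: "\<sigma> = 1 \<or> \<sigma> = -1"
    and neg: "\<And>u. u \<in> carrier R \<Longrightarrow> roots (\<ominus> u) - 1 = \<sigma> * (roots u - 1)"
    and even: "\<And>m s. s \<in> carrier R \<Longrightarrow> err (2 * m) s = \<sigma> ^ m * q ^ m * (of_bool (s = \<zero>) - 1 / q)"
    and odd: "\<And>m s. s \<in> carrier R \<Longrightarrow> err (2 * m + 1) s = \<sigma> ^ m * q ^ m * (roots s - 1)"
    using err_even_odd by metis
  \<comment> \<open>Three quarters, the squared height of an equilateral triangle of side 1; the
    height itself is \<open>w \<otimes> h\<close>.\<close>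
  define s where "s = \<one> \<ominus> h \<otimes> h"
  have sc: "s \<in> carrier R" using h by (simp add: s_def)
  have h0: "h \<noteq> \<zero>" using h by auto
  have ws: "(w \<otimes> h) \<otimes> (w \<otimes> h) = s"
  proof -
    have "(w \<otimes> h) \<otimes> (w \<otimes> h) = (w \<otimes> w) \<otimes> (h \<otimes> h)" using w(1) h(1) by algebra
    also have "\<dots> = (h \<oplus> h) \<otimes> (h \<oplus> h) \<ominus> h \<otimes> h" unfolding w(3) using h(1) by algebra
    finally show ?thesis unfolding s_def h(2) by simp
  qed
  have s0: "s \<noteq> \<zero>"
    unfolding ws[symmetric] using w h h0 by (auto simp: integral_iff)
  have "card {w \<otimes> h} \<le> card {a \<in> carrier R. a \<otimes> a = s}"
    using ws w(1) h(1) finite_carrier by (intro card_mono) auto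
  then have rs: "1 \<le> roots s" by (simp add: roots_eq_card)
  have cod: "codeg n \<one> y = q ^ n / q\<^sup>2 + (\<Sum>m\<in>carrier R. err n (s \<oplus> m \<otimes> m)) / q"
  proof -
    have "(\<Sum>m\<in>carrier R. err n (\<one> \<ominus> h \<otimes> h \<otimes> \<one> \<oplus> m \<otimes> m \<otimes> \<one>)) =
        (\<Sum>m\<in>carrier R. err n (s \<oplus> m \<otimes> m))"
      using h(1) by (intro sum.cong refl) (simp add: s_def)
    then show ?thesis using codeg_anisotropic[OF y(1) _ one_closed h] y(2) by simp
  qed
  show ?thesis
  proof (cases "even n")
    case True
    then obtain k where k: "n = 2 * Suc k" using n by (metis dvdE not0_implies_Suc mult_0_right not_numeral_le_zero)
    have "(\<Sum>m\<in>carrier R. err n (s \<oplus> m \<otimes> m)) =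
        (\<Sum>m\<in>carrier R. \<sigma> ^ Suc k * q ^ Suc k * (of_bool (s \<oplus> m \<otimes> m \<otimes> \<one> = \<zero>) - 1 / q))"
      unfolding k using sc by (intro sum.cong refl) (subst even, auto)
    also have "\<dots> = \<sigma> ^ Suc k * q ^ Suc k * (roots (\<ominus> s \<otimes> inv \<one>) - q * (1 / q))"
      by (simp only: sum_distrib_left[symmetric] sum_subtractf
        sum_roots_indicator[OF sc one_closed one_not_zero] sum_const_carrier)
    also have "\<dots> = q * (\<sigma> ^ k * q ^ k * (roots s - 1))"
    proof -
      have "roots (\<ominus> s \<otimes> inv \<one>) - q * (1 / q) = \<sigma> * (roots s - 1)"
        using neg[OF sc] sc q_pos by simp
      moreover have "\<sigma> ^ Suc k * q ^ Suc k * (\<sigma> * (roots s - 1)) =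
          (\<sigma> * \<sigma>) * (q * (\<sigma> ^ k * q ^ k * (roots s - 1)))" by simp
      moreover have "\<sigma> * \<sigma> = 1" using \<sigma> by auto
      ultimately show ?thesis by (simp only: mult_1)
    qed
    finally have sum: "(\<Sum>m\<in>carrier R. err n (s \<oplus> m \<otimes> m)) = q * (\<sigma> ^ k * q ^ k * (roots s - 1))" .
    have eq: "codeg n \<one> y = q ^ (2 * k) + \<sigma> ^ k * q ^ k * (roots s - 1)"
      unfolding cod sum using q_pos by (simp add: k power2_eq_square)
    \<comment> \<open>In the plane, \<open>k = 0\<close>, the count is \<open>roots s\<close>
      itself, which is at least 1 because \<open>s\<close> is a square; in higher even dimension the
      error is at most half the main term.\<close>
    show ?thesis
    proof (cases "k = 0")
      case True
      then show ?thesis using eq rs q_pos by (simp add: k power2_eq_square)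
    next
      case False
      have "\<bar>\<sigma> ^ k * q ^ k * (roots s - 1)\<bar> \<le> q ^ k * 1"
        unfolding abs_mult[of _ "_ - 1"] abs_sigma_power[OF \<sigma>]
        using abs_roots_minus_1 q_pos by (intro mult_left_mono) auto
      moreover have "2 * q ^ k \<le> q ^ k * q ^ k"
      proof -
        have "2 \<le> q" using q_ge_3 by simp
        also have "q \<le> q ^ k" using power_increasing[of 1 k q] False q_ge_3 by simp
        finally show ?thesis using q_pos by (intro mult_right_mono) auto
      qed
      moreover have "q ^ k * q ^ k = q ^ (2 * k)" by (simp only: mult_2 power_add)
      ultimately have "q ^ (2 * k) / 2 \<le> codeg n \<one> y" unfolding eq by linarith
      then show ?thesis using q_pos by (simp add: k power2_eq_square)
    qed
  next
    case False
    then obtain k0 where k0: "n = 2 * k0 + 1" by (rule oddE)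
    then obtain k where k: "n = 2 * Suc k + 1" using n by (cases k0) auto
    have "(\<Sum>m\<in>carrier R. err n (s \<oplus> m \<otimes> m)) =
        (\<Sum>m\<in>carrier R. \<sigma> ^ Suc k * q ^ Suc k * (roots (s \<oplus> m \<otimes> m) - 1))"
      unfolding k using sc by (intro sum.cong refl odd) auto
    also have "\<dots> = \<sigma> ^ Suc k * q ^ Suc k * (hyperbola s - q * 1)"
      by (simp only: sum_distrib_left[symmetric] sum_subtractf sum_roots_shifted[OF sc] sum_const_carrier)
    \<comment> \<open>\<open>s \<noteq> \<zero>\<close> enters here: the hyperbola has
      \<open>q - 1\<close> points.\<close>
    also have "hyperbola s - q * 1 = -1" using sc s0 by (simp add: hyperbola_eq)
    finally have sum: "(\<Sum>m\<in>carrier R. err n (s \<oplus> m \<otimes> m)) = \<sigma> ^ Suc k * q ^ Suc k * -1" .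
    have cod_eq: "codeg n \<one> y = q ^ (2 * k + 1) - \<sigma> ^ Suc k * q ^ Suc k / q"
      unfolding cod sum using q_pos by (simp add: k power2_eq_square)
    have "\<sigma> ^ Suc k * q ^ Suc k / q \<le> q ^ k"
    proof -
      have "\<sigma> ^ Suc k * q ^ Suc k / q \<le> \<bar>\<sigma> ^ Suc k * q ^ Suc k\<bar> / q"
        using q_pos by (intro divide_right_mono abs_ge_self) auto
      then show ?thesis unfolding abs_sigma_power[OF \<sigma>] using q_pos by simp
    qed
    then have "q ^ (2 * k + 1) - q ^ k \<le> codeg n \<one> y" unfolding cod_eq by linarith
    moreover have "2 * q ^ k \<le> q ^ (2 * k + 1)"
    proof -
      have "2 * q ^ k \<le> q * q ^ k" using q_ge_3 q_pos by (intro mult_right_mono) auto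
      also have "\<dots> = q ^ (k + 1)" by simp
      also have "\<dots> \<le> q ^ (2 * k + 1)" using q_ge_3 by (intro power_increasing) auto
      finally show ?thesis .
    qed
    ultimately have "q ^ (2 * k + 1) / 2 \<le> codeg n \<one> y" by linarith
    then show ?thesis using q_pos by (simp add: k power2_eq_square)
  qed
qed

section \<open>Spheres as neighbourhoods\<close>

lemma sq_norm_vec_minus_commute:
  assumes "x \<in> vecs R n" "y \<in> vecs R n"
  shows "sq_norm R n (vec_minus R n x y) = sq_norm R n (vec_minus R n y x)"
  unfolding sq_norm_def
proof (intro finsum_cong')
  fix i assume "i \<in> {..<n}"
  then have i: "i < n" "x i \<in> carrier R" "y i \<in> carrier R" using assms by (auto intro: vecs_nth)
  then have "(x i \<ominus> y i) \<otimes> (x i \<ominus> y i) = (y i \<ominus> x i) \<otimes> (y i \<ominus> x i)" by algebra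
  then show "vec_minus R n x y i [^] (2::nat) = vec_minus R n y x i [^] (2::nat)"
    using i by (simp add: vec_minus_def pow_2_eq)
qed (use assms in \<open>auto simp: vec_minus_def vecs_nth\<close>)

lemma mem_sphere: "z \<in> vecs R n \<Longrightarrow> z \<in> sphere R n t \<longleftrightarrow> sq_norm R n z = t"
  by (simp add: sphere_def)

lemma card_sphere_at:
  assumes x: "x \<in> vecs R n"
  shows "real (card {z \<in> vecs R n. vec_minus R n x z \<in> sphere R n t}) = cnt n t"
proof -
  have "real (card {z \<in> vecs R n. vec_minus R n x z \<in> sphere R n t}) =
      (\<Sum>z\<in>vecs R n. of_bool (vec_minus R n x z \<in> sphere R n t))"
    by (simp only: sum_of_bool_eq_card[OF finite_vectors])
  also have "\<dots> = (\<Sum>z\<in>vecs R n. of_bool (z \<in> sphere R n t))" using x by (rule sum_reflect)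
  also have "\<dots> = cnt n t" unfolding cnt_def by (intro sum.cong refl) (simp add: mem_sphere)
  finally show ?thesis .
qed

text \<open>The reflection of \<open>z\<close> to \<open>x - z\<close> moves \<open>x\<close> to the
  origin and \<open>y\<close> to \<open>x - y\<close>.\<close>

lemma card_sphere_inter:
  assumes x: "x \<in> vecs R n" and y: "y \<in> vecs R n"
  shows "real (card {z \<in> vecs R n. vec_minus R n x z \<in> sphere R n t \<and> vec_minus R n y z \<in> sphere R n t})
    = codeg n t (vec_minus R n x y)"
proof -
  let ?S = "sphere R n t"
  have "real (card {z \<in> vecs R n. vec_minus R n x z \<in> ?S \<and> vec_minus R n y z \<in> ?S}) =
      (\<Sum>z\<in>vecs R n. of_bool (vec_minus R n x z \<in> ?S \<and> vec_minus R n y z \<in> ?S))"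
    by (simp only: sum_of_bool_eq_card[OF finite_vectors])
  also have "\<dots> = (\<Sum>z\<in>vecs R n. of_bool (vec_minus R n x (vec_minus R n x z) \<in> ?S \<and>
      vec_minus R n y (vec_minus R n x z) \<in> ?S))"
    using x by (rule sum_reflect[symmetric])
  also have "\<dots> = codeg n t (vec_minus R n x y)" unfolding codeg_def
  proof (intro sum.cong refl)
    fix z assume z: "z \<in> vecs R n"
    have "vec_minus R n y (vec_minus R n x z) = vec_minus R n z (vec_minus R n x y)"
    proof (rule vecs_ext)
      fix i assume i: "i < n"
      then have "x i \<in> carrier R" "y i \<in> carrier R" "z i \<in> carrier R" using x y z by (auto intro: vecs_nth)
      then have "y i \<ominus> (x i \<ominus> z i) = z i \<ominus> (x i \<ominus> y i)" by algebra
      then show "vec_minus R n y (vec_minus R n x z) i = vec_minus R n z (vec_minus R n x y) i"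
        using i by (simp add: vec_minus_def)
    qed (use x y z in \<open>auto intro: vec_minus_closed\<close>)
    then show "of_bool (vec_minus R n x (vec_minus R n x z) \<in> ?S \<and> vec_minus R n y (vec_minus R n x z) \<in> ?S) =
        (of_bool (sq_norm R n z = t) * of_bool (sq_norm R n (vec_minus R n z (vec_minus R n x y)) = t) :: real)"
      using x y z by (simp add: vec_minus_vec_minus mem_sphere vec_minus_closed of_bool_conj)
  qed
  finally show ?thesis .
qed

text \<open>Recentres the count at \<open>(cnt n t)\<^sup>2 / q ^ n\<close>, as the variance
  identity requires: \<open>cnt n t\<close> is within \<open>a\<close> of \<open>Q\<close>, so the
  new centre falls below \<open>Q / q\<close> by at most \<open>2 * a / q\<close>. The constant 4
  leaves room and has an integral square root.\<close>

lemma codeg_le_graph: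
  assumes y: "y \<in> vecs R n" "i < n" "y i \<noteq> \<zero>" and t: "t \<in> carrier R" "t \<noteq> \<zero>" and n: "2 \<le> n"
  shows "codeg n t y \<le> (cnt n t)\<^sup>2 / q ^ n + 4 * q ^ ((n - 1) div 2)"
proof -
  define a where "a = q ^ ((n - 1) div 2)"
  define Q where "Q = q ^ (n - 1)"
  have Q: "0 < Q" "0 < a" using q_pos by (auto simp: Q_def a_def)
  have qn: "q ^ n = q * Q" using n by (cases n) (auto simp: Q_def)
  have e: "\<bar>err n t\<bar> \<le> a" unfolding a_def using t n by (intro abs_err_le) auto
  have "Q\<^sup>2 - 2 * Q * a \<le> Q\<^sup>2 + 2 * Q * err n t"
    using e Q by (simp add: abs_le_iff mult.assoc) (smt (verit) mult_left_mono mult_minus_right)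
  also have "\<dots> \<le> (cnt n t)\<^sup>2" using n by (simp add: cnt_eq Q_def power2_sum)
  finally have "(Q\<^sup>2 - 2 * Q * a) / (q * Q) \<le> (cnt n t)\<^sup>2 / (q * Q)"
    using Q q_pos by (intro divide_right_mono) auto
  moreover have "(Q\<^sup>2 - 2 * Q * a) / (q * Q) = Q / q - 2 * a / q"
    using Q q_pos by (simp add: field_simps power2_eq_square)
  moreover have "2 * a / q \<le> a" using Q q_ge_3 by (simp add: field_simps)
  moreover have "codeg n t y \<le> Q / q + a"
    using codeg_le[OF y t] q_pos by (simp add: qn a_def power2_eq_square)
  ultimately show ?thesis unfolding qn a_def[symmetric] using Q by linarith
qed

end

section \<open>The forms of the triangle and of the path\<close>

definition recip :: "ereal \<Rightarrow> real" where
  "recip p = (if p = \<infinity> then 0 else 1 / real_of_ereal p)"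

lemma recip_bounds: "1 \<le> p \<Longrightarrow> 0 \<le> recip p \<and> recip p \<le> 1"
  by (cases p) (auto simp: recip_def)

context odd_finite_field
begin

lemma distance_graph_sphere:
  assumes t: "t \<in> carrier R" "t \<noteq> \<zero>" and d: "2 \<le> d"
  shows "distance_graph (vecs R d) (\<lambda>x z. vec_minus R d x z \<in> sphere R d t) q (cnt d t) d"
proof (unfold_locales)
  show "real (card (vecs R d)) = q ^ d" by (rule card_vecs)
  show "vec_minus R d y x \<in> sphere R d t"
    if "x \<in> vecs R d" "y \<in> vecs R d" "vec_minus R d x y \<in> sphere R d t" for x y
    using that sq_norm_vec_minus_commute[of x d y] by (simp add: mem_sphere vec_minus_closed)
  show "real (card {z \<in> vecs R d. vec_minus R d x z \<in> sphere R d t}) = cnt d t"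
    if "x \<in> vecs R d" for x using that by (rule card_sphere_at)
  fix x y assume xy: "x \<in> vecs R d" "y \<in> vecs R d" "x \<noteq> y"
  obtain i where i: "i < d" "x i \<noteq> y i" using vecs_ext[OF xy(1,2)] xy(3) by blast
  have "vec_minus R d x y i \<noteq> \<zero>"
    using i xy by (simp add: vec_minus_def minus_eq_0_iff vecs_nth)
  then show "real (card {z \<in> vecs R d. vec_minus R d x z \<in> sphere R d t \<and> vec_minus R d y z \<in> sphere R d t})
      \<le> (cnt d t)\<^sup>2 / q ^ d + 4 * q ^ ((d - 1) div 2)"
    unfolding card_sphere_inter[OF xy(1,2)]
    using codeg_le_graph[OF vec_minus_closed[OF xy(1,2)] i(1) _ t d] by simp
qed (use finite_vectors q_ge_3 d cnt_bounds[OF t d] in auto)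

section \<open>Upper bound for the path form\<close>

lemma zero_vec: "(\<lambda>i\<in>{..<d}. \<zero>) \<in> vecs R d"
  by (auto simp: vecs_def)

lemma vecs_nonempty: "vecs R d \<noteq> {}"
  using zero_vec by blast

text \<open>\<open>F = 1 + (f / N) powr r\<close>, where \<open>r\<close> is the real value of
  \<open>p\<close> and \<open>N\<close> the norm; the summand 1 makes \<open>F\<close> at least 1
  and raises the mean from 1 to 2. If \<open>p = \<infinity>\<close> or the norm is 0, the constant
  function 1 does.\<close>

lemma normalize:
  assumes p: "1 \<le> p" and f: "\<And>x. x \<in> vecs R d \<Longrightarrow> 0 \<le> f x"
  obtains F where "\<And>x. x \<in> vecs R d \<Longrightarrow> 1 \<le> F x" "(\<Sum>x\<in>vecs R d. F x) \<le> 2 * q ^ d"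
    "\<And>x. x \<in> vecs R d \<Longrightarrow> f x \<le> lp_norm R d p f * F x powr recip p"
proof (cases "p = \<infinity> \<or> lp_norm R d p f = 0")
  case True
  have "f x \<le> lp_norm R d p f" if x: "x \<in> vecs R d" for x
  proof (cases "p = \<infinity>")
    case True
    then have "\<bar>f x\<bar> \<le> lp_norm R d p f" using x finite_vectors by (simp add: lp_norm_def)
    then show ?thesis by simp
  next
    case False
    obtain M where "\<bar>f x\<bar> \<le> M * lp_norm R d p f"
      using pointwise_le_lp_norm[OF finite_carrier _ p, of d] x by blast
    then show ?thesis using False True by simp
  qed
  then show ?thesis using q_pos by (intro that[of "\<lambda>_. 1"]) (auto simp: card_vecs)
next
  case False
  define N where "N = lp_norm R d p f"
  define r where "r = real_of_ereal p"
  have r: "1 \<le> r" using p False by (cases p) (auto simp: r_def)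
  have N: "0 < N" using False lp_norm_nonneg[OF finite_vectors vecs_nonempty, of d p f] by (simp add: N_def less_le)
  have rec: "recip p = 1 / r" using False by (simp add: recip_def r_def)
  define S where "S = (\<Sum>x\<in>vecs R d. f x powr r)"
  have S0: "0 \<le> S" by (simp add: S_def sum_nonneg)
  have "N = (1 / q ^ d * S) powr (1 / r)"
    using False f by (simp add: N_def lp_norm_def r_def S_def q_def)
  then have "N powr r = 1 / q ^ d * S" using r S0 q_pos by (simp add: powr_powr)
  then have S: "S = N powr r * q ^ d" using q_pos by (simp add: field_simps)
  define F where "F = (\<lambda>x. 1 + (f x / N) powr r)"
  show ?thesis
  proof (rule that[of F])
    show "1 \<le> F x" for x by (simp add: F_def)
    have "(\<Sum>x\<in>vecs R d. F x) = q ^ d + S / N powr r"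
      using f N by (simp add: F_def sum.distrib card_vecs powr_divide sum_divide_distrib S_def)
    also have "\<dots> = 2 * q ^ d" using N by (simp add: S)
    finally show "(\<Sum>x\<in>vecs R d. F x) \<le> 2 * q ^ d" by simp
    fix x assume x: "x \<in> vecs R d"
    have "f x = N * ((f x / N) powr r) powr (1 / r)" using r N f[OF x] by (simp add: powr_powr)
    also have "\<dots> \<le> N * F x powr (1 / r)"
      using r N by (intro mult_left_mono powr_mono2) (auto simp: F_def)
    finally show "f x \<le> lp_norm R d p f * F x powr recip p" by (simp add: rec N_def)
  qed
qed

lemma P2_form_le:
  assumes t: "t \<in> carrier R" "t \<noteq> \<zero>" and d: "2 \<le> d" and p: "1 \<le> p1" "1 \<le> p2" "1 \<le> p3"
    and le: "real d * recip p1 + recip p2 + recip p3 \<le> real d"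
      "recip p1 + real d * recip p2 + recip p3 \<le> real d"
      "recip p1 + recip p2 + real d * recip p3 \<le> real d"
  shows "distance_graph.path_const d \<in> bound_consts R d (P2_form R d t) p1 p2 p3"
  unfolding bound_consts_def
proof (intro CollectI allI impI)
  fix f1 f2 f3 :: "(nat \<Rightarrow> 'a) \<Rightarrow> real"
  assume f: "\<forall>x\<in>vecs R d. 0 \<le> f1 x \<and> 0 \<le> f2 x \<and> 0 \<le> f3 x"
  interpret G: distance_graph "vecs R d" "\<lambda>x z. vec_minus R d x z \<in> sphere R d t" q "cnt d t" d
    using t d by (rule distance_graph_sphere)
  define N1 N2 N3 where "N1 = lp_norm R d p1 f1" and "N2 = lp_norm R d p2 f2" and "N3 = lp_norm R d p3 f3"
  have N: "0 \<le> N1" "0 \<le> N2" "0 \<le> N3"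
    unfolding N1_def N2_def N3_def by (rule lp_norm_nonneg[OF finite_vectors vecs_nonempty])+
  obtain F1 where F1: "\<And>x. x \<in> vecs R d \<Longrightarrow> 1 \<le> F1 x" "(\<Sum>x\<in>vecs R d. F1 x) \<le> 2 * q ^ d"
    "\<And>x. x \<in> vecs R d \<Longrightarrow> f1 x \<le> N1 * F1 x powr recip p1"
    unfolding N1_def using normalize[OF p(1), of d f1] f by metis
  obtain F2 where F2: "\<And>x. x \<in> vecs R d \<Longrightarrow> 1 \<le> F2 x" "(\<Sum>x\<in>vecs R d. F2 x) \<le> 2 * q ^ d"
    "\<And>x. x \<in> vecs R d \<Longrightarrow> f2 x \<le> N2 * F2 x powr recip p2"
    unfolding N2_def using normalize[OF p(2), of d f2] f by metis
  obtain F3 where F3: "\<And>x. x \<in> vecs R d \<Longrightarrow> 1 \<le> F3 x" "(\<Sum>x\<in>vecs R d. F3 x) \<le> 2 * q ^ d"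
    "\<And>x. x \<in> vecs R d \<Longrightarrow> f3 x \<le> N3 * F3 x powr recip p3"
    unfolding N3_def using normalize[OF p(3), of d f3] f by metis
  let ?P = "G.path_sum (\<lambda>x. F1 x powr recip p1) (\<lambda>x. F2 x powr recip p2) (\<lambda>x. F3 x powr recip p3)"
  have den: "0 < q ^ d * (cnt d t)\<^sup>2" using q_pos G.D_pos by simp
  have "P2_form R d t f1 f2 f3 = G.path_sum f1 f2 f3 / (q ^ d * (cnt d t)\<^sup>2)"
    by (simp add: P2_form_def G.path_sum_def indicator_def of_bool_def card_sphere q_def)
  also have "\<dots> \<le> (N1 * N2 * N3 * ?P) / (q ^ d * (cnt d t)\<^sup>2)"
  proof (rule divide_right_mono)
    have "G.path_sum f1 f2 f3 \<le> G.path_sum (\<lambda>x. N1 * F1 x powr recip p1)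
        (\<lambda>x. N2 * F2 x powr recip p2) (\<lambda>x. N3 * F3 x powr recip p3)"
      unfolding G.path_sum_def using F1(3) F2(3) F3(3) f N
      by (intro sum_mono mult_left_mono mult_mono) auto
    also have "\<dots> = N1 * N2 * N3 * ?P"
      unfolding G.path_sum_def by (simp add: sum_distrib_left mult_ac)
    finally show "G.path_sum f1 f2 f3 \<le> N1 * N2 * N3 * ?P" .
  qed (use den in simp)
  also have "\<dots> \<le> (N1 * N2 * N3 * (G.path_const * ((cnt d t)\<^sup>2 * q ^ d))) / (q ^ d * (cnt d t)\<^sup>2)"
    using N den recip_bounds[OF p(1)] recip_bounds[OF p(2)] recip_bounds[OF p(3)] le
    by (intro divide_right_mono mult_left_mono G.path_sum_le F1 F2 F3) auto
  also have "\<dots> = G.path_const * (N1 * N2 * N3)" using q_pos G.D_pos by simp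
  finally show "P2_form R d t f1 f2 f3 \<le>
      G.path_const * (lp_norm R d p1 f1 * lp_norm R d p2 f2 * lp_norm R d p3 f3)"
    by (simp only: N1_def N2_def N3_def)
qed

section \<open>Test functions for the triangle form\<close>

lemma sphere_subset: "sphere R d t \<subseteq> vecs R d"
  by (auto simp: sphere_def)

lemma lp_norm_indicator:
  assumes p: "1 \<le> p" and E: "E \<subseteq> vecs R d" "E \<noteq> {}"
  shows "lp_norm R d p (indicat_real E) = (real (card E) / q ^ d) powr recip p"
proof (cases "p = \<infinity>")
  case True
  obtain x where x: "x \<in> E" using E(2) by blast
  have "Max ((\<lambda>x. \<bar>indicat_real E x\<bar>) ` vecs R d) = 1"
    using finite_vectors x E(1) by (intro Max_eqI) (force simp: indicator_def)+
  \<comment> \<open>\<open>powr 0\<close> gives 1 only for a non-zero base; \<open>0 powr 0\<close>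
    is 0.\<close>
  moreover have "real (card E) / q ^ d \<noteq> 0"
    using E finite_subset[OF E(1) finite_vectors] q_pos by (simp add: card_eq_0_iff)
  ultimately show ?thesis using True by (simp add: lp_norm_def recip_def)
next
  case False
  then have r: "1 \<le> real_of_ereal p" using p by (cases p) auto
  have "(\<Sum>x\<in>vecs R d. \<bar>indicat_real E x\<bar> powr real_of_ereal p) = (\<Sum>x\<in>vecs R d. indicat_real E x)"
    using r by (intro sum.cong refl) (auto simp: indicator_def)
  also have "\<dots> = real (card E)"
  proof -
    have "(\<Sum>x\<in>vecs R d. indicat_real E x) = (\<Sum>x\<in>vecs R d. of_bool (x \<in> E))"
      by (simp add: indicator_def of_bool_def)
    also have "\<dots> = real (card {x \<in> vecs R d. x \<in> E})" by (rule sum_of_bool_eq_card[OF finite_vectors])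
    also have "{x \<in> vecs R d. x \<in> E} = E" using E(1) by blast
    finally show ?thesis .
  qed
  finally show ?thesis using False by (simp add: lp_norm_def recip_def q_def)
qed

text \<open>Moves the point mass to the leading slot, so that one test configuration yields all
  three inequalities.\<close>

lemma K3_form_cyclic: "K3_form R d t f1 f2 f3 = K3_form R d t f2 f3 f1"
proof -
  let ?g = "\<lambda>x1 x2 x3. indicat_real (sphere R d t) (vec_minus R d x1 x2) *
       indicat_real (sphere R d t) (vec_minus R d x2 x3) *
       indicat_real (sphere R d t) (vec_minus R d x3 x1) * (f1 x1 * f2 x2 * f3 x3)"
  have "(\<Sum>x1\<in>vecs R d. \<Sum>x2\<in>vecs R d. \<Sum>x3\<in>vecs R d. ?g x1 x2 x3) =
      (\<Sum>x2\<in>vecs R d. \<Sum>x1\<in>vecs R d. \<Sum>x3\<in>vecs R d. ?g x1 x2 x3)" by (rule sum.swap)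
  also have "\<dots> = (\<Sum>x2\<in>vecs R d. \<Sum>x3\<in>vecs R d. \<Sum>x1\<in>vecs R d. ?g x1 x2 x3)"
    by (intro sum.cong refl sum.swap)
  finally show ?thesis unfolding K3_form_def by (simp add: mult_ac)
qed

text \<open>With one vertex at the origin the sum runs over \<open>x2\<close> on the sphere and over
  the common neighbours of the origin and \<open>x2\<close>. Of the constant 4, one factor 2 is the
  loss in \<open>codeg_ge\<close>, the other the upper bound \<open>2 * q ^ (d - 2)\<close> for the
  normalizing number.\<close>

lemma K3_form_triangles_ge:
  assumes d: "2 \<le> d" and w: "w \<in> carrier R" "w \<noteq> \<zero>" "w \<otimes> w = \<one> \<oplus> \<one> \<oplus> \<one>"
  shows "1 / (4 * q ^ d) \<le> K3_form R d \<one> (indicat_real {\<lambda>i\<in>{..<d}. \<zero>})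
    (indicat_real (sphere R d \<one>)) (indicat_real (sphere R d \<one>))"
proof -
  let ?V = "vecs R d" and ?S = "sphere R d \<one>" and ?o = "\<lambda>i\<in>{..<d}. \<zero>"
  have minus_0: "vec_minus R d x ?o = x" if "x \<in> ?V" for x
  proof (rule vecs_ext)
    show "vec_minus R d x ?o \<in> ?V" using that zero_vec by (rule vec_minus_closed)
    show "vec_minus R d x ?o i = x i" if "i < d" for i
      using that vecs_nth[OF \<open>x \<in> ?V\<close>] by (simp add: vec_minus_def minus_eq)
  qed (rule that)
  have zero_minus: "vec_minus R d ?o x \<in> ?S \<longleftrightarrow> x \<in> ?S" if x: "x \<in> ?V" for x
    using sq_norm_vec_minus_commute[OF zero_vec x] minus_0[OF x] x zero_vec
    by (simp add: mem_sphere vec_minus_closed)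
  define T where "T = (\<Sum>x1\<in>?V. \<Sum>x2\<in>?V. \<Sum>x3\<in>?V.
       indicat_real ?S (vec_minus R d x1 x2) * indicat_real ?S (vec_minus R d x2 x3) *
       indicat_real ?S (vec_minus R d x3 x1) *
       (indicat_real {?o} x1 * indicat_real ?S x2 * indicat_real ?S x3))"
  have "T = (\<Sum>x1\<in>{?o}. \<Sum>x2\<in>?V. \<Sum>x3\<in>?V.
       indicat_real ?S (vec_minus R d x1 x2) * indicat_real ?S (vec_minus R d x2 x3) *
       indicat_real ?S (vec_minus R d x3 x1) *
       (indicat_real {?o} x1 * indicat_real ?S x2 * indicat_real ?S x3))"
    unfolding T_def using zero_vec finite_vectors by (intro sum.mono_neutral_right) auto
  also have "\<dots> = (\<Sum>x2\<in>?V. \<Sum>x3\<in>?V. of_bool (x2 \<in> ?S) *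
      (of_bool (sq_norm R d x3 = \<one>) * of_bool (sq_norm R d (vec_minus R d x3 x2) = \<one>)))"
    by (simp add: indicator_def of_bool_def, intro sum.cong refl)
      (auto simp: minus_0 zero_minus mem_sphere vec_minus_closed sq_norm_vec_minus_commute)
  also have "\<dots> = (\<Sum>x2\<in>?V. of_bool (x2 \<in> ?S) * codeg d \<one> x2)"
    by (simp only: codeg_def sum_distrib_left)
  also have "\<dots> \<ge> (\<Sum>x2\<in>?V. of_bool (x2 \<in> ?S) * (q ^ d / q\<^sup>2 / 2))"
  proof (rule sum_mono)
    fix x assume "x \<in> ?V"
    then show "of_bool (x \<in> ?S) * (q ^ d / q\<^sup>2 / 2) \<le> of_bool (x \<in> ?S) * codeg d \<one> x"
      using codeg_ge[of x d w] d w by (auto simp: mem_sphere)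
  qed
  also have "(\<Sum>x2\<in>?V. of_bool (x2 \<in> ?S) * (q ^ d / q\<^sup>2 / 2)) = cnt d \<one> * (q ^ d / q\<^sup>2 / 2)"
    unfolding cnt_def sum_distrib_right[symmetric]
    by (intro arg_cong2[where f = "(*)"] refl sum.cong) (simp add: mem_sphere)
  finally have T: "cnt d \<one> * (q ^ d / q\<^sup>2 / 2) \<le> T" .
  define s where "s = real (sub_sphere_size R d \<one>)"
  \<comment> \<open>Positivity matters: division by 0 yields 0, so \<open>s = 0\<close> would make
    the form vanish.\<close>
  have s: "0 < s" "s \<le> 2 * (q ^ d / q\<^sup>2)"
  proof -
    show "0 < s"
    proof (cases "d = 2")
      case False
      have "0 < q ^ (d - 1 - 1) / 2" using q_pos by simp
      also have "\<dots> \<le> cnt (d - 1) \<one>" using d False by (intro cnt_bounds) auto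
      finally show ?thesis using False by (simp add: s_def sub_sphere_size_def card_sphere)
    qed (simp add: s_def sub_sphere_size_def)
    show "s \<le> 2 * (q ^ d / q\<^sup>2)"
    proof (cases "d = 2")
      case True
      then show ?thesis using q_pos by (simp add: s_def sub_sphere_size_def)
    next
      case False
      have "cnt (d - 1) \<one> \<le> 2 * q ^ (d - 1 - 1)" using d False by (intro cnt_bounds) auto
      also have "q ^ (d - 1 - 1) = q ^ d / q\<^sup>2"
        using d q_pos by (auto simp: le_iff_add power_add power2_eq_square)
      finally show ?thesis using False by (simp add: s_def sub_sphere_size_def card_sphere)
    qed
  qed
  define c where "c = cnt d \<one>"
  have c: "0 < c"
    using cnt_bounds(1)[of \<one> d] d q_pos by (smt (verit) c_def divide_pos_pos one_closed one_not_zero zero_less_power)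
  define Q where "Q = q ^ d / q\<^sup>2"
  have Q: "0 < Q" using q_pos by (simp add: Q_def)
  have T0: "0 \<le> T"
  proof (rule order_trans)
    show "0 \<le> cnt d \<one> * (q ^ d / q\<^sup>2 / 2)" using c q_pos by (simp add: c_def)
  qed (rule T)
  have "1 / (4 * q ^ d) = (c * (Q / 2)) / (q ^ d * c * (2 * Q))"
    using c Q q_pos by (simp add: field_simps)
  also have "\<dots> \<le> T / (q ^ d * c * s)"
    using T T0 c s Q q_pos by (intro frac_le mult_left_mono) (auto simp: c_def Q_def)
  also have "\<dots> = K3_form R d \<one> (indicat_real {?o}) (indicat_real ?S) (indicat_real ?S)"
    by (simp add: K3_form_def T_def s_def c_def card_sphere q_def)
  finally show ?thesis .
qed

text \<open>The point has norm \<open>q powr (- (d * u))\<close>, a sphere at most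
  \<open>2 * q powr (- u')\<close>; comparison with the value \<open>1 / (4 * q ^ d)\<close> gives
  the exponent and the constant \<open>16 = 4 * 2 * 2\<close>.\<close>

lemma K3_necessary:
  assumes d: "2 \<le> d" and w: "w \<in> carrier R" "w \<noteq> \<zero>" "w \<otimes> w = \<one> \<oplus> \<one> \<oplus> \<one>"
    and p: "1 \<le> p" "1 \<le> p'" "1 \<le> p''" and C: "0 \<le> C"
    and bound: "K3_form R d \<one> (indicat_real {\<lambda>i\<in>{..<d}. \<zero>})
      (indicat_real (sphere R d \<one>)) (indicat_real (sphere R d \<one>)) \<le>
      C * (lp_norm R d p (indicat_real {\<lambda>i\<in>{..<d}. \<zero>}) *
        (lp_norm R d p' (indicat_real (sphere R d \<one>)) * lp_norm R d p'' (indicat_real (sphere R d \<one>))))"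
  shows "q powr (real d * recip p + recip p' + recip p'' - real d) \<le> 16 * C"
proof -
  define u u' u'' where "u = recip p" and "u' = recip p'" and "u'' = recip p''"
  have cb: "q ^ (d - 1) / 2 \<le> cnt d \<one>" "cnt d \<one> \<le> 2 * q ^ (d - 1)"
    using cnt_bounds[of \<one> d] d by auto
  have c: "0 < cnt d \<one>" using cb q_pos by (smt (verit) divide_pos_pos zero_less_power)
  then have ne: "sphere R d \<one> \<noteq> {}" using card_sphere[of d \<one>] by auto
  have sph: "lp_norm R d s (indicat_real (sphere R d \<one>)) \<le> 2 * q powr (- recip s)" if s: "1 \<le> s" for s
  proof -
    have "lp_norm R d s (indicat_real (sphere R d \<one>)) = (cnt d \<one> / q ^ d) powr recip s"
      using lp_norm_indicator[OF s sphere_subset ne] by (simp add: card_sphere)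
    also have "\<dots> \<le> (2 / q) powr recip s"
    proof (rule powr_mono2)
      have "cnt d \<one> / q ^ d \<le> 2 * q ^ (d - 1) / q ^ d"
        using cb(2) q_pos by (intro divide_right_mono) auto
      also have "\<dots> = 2 / q" using d q_pos by (cases d) auto
      finally show "cnt d \<one> / q ^ d \<le> 2 / q" .
    qed (use recip_bounds[OF s] c q_pos in auto)
    also have "\<dots> = 2 powr recip s * q powr (- recip s)"
      using q_pos by (simp add: powr_divide powr_minus_divide)
    also have "\<dots> \<le> 2 powr 1 * q powr (- recip s)"
      using recip_bounds[OF s] by (intro mult_right_mono powr_mono) auto
    finally show ?thesis by simp
  qed
  have pt: "lp_norm R d p (indicat_real {\<lambda>i\<in>{..<d}. \<zero>}) = q powr (- (real d * u))"
  proof -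
    have "lp_norm R d p (indicat_real {\<lambda>i\<in>{..<d}. \<zero>}) = (1 / q ^ d) powr u"
      using lp_norm_indicator[OF p(1), of "{\<lambda>i\<in>{..<d}. \<zero>}" d] zero_vec by (simp add: u_def)
    also have "\<dots> = (q powr - real d) powr u"
      using q_pos by (simp add: powr_minus powr_realpow divide_inverse)
    finally show ?thesis by (simp add: powr_powr)
  qed
  have "1 / (4 * q ^ d) \<le> C * (q powr (- (real d * u)) * ((2 * q powr (- u')) * (2 * q powr (- u''))))"
    using order_trans[OF K3_form_triangles_ge[OF d w] bound] unfolding pt
    using sph[OF p(2)] sph[OF p(3)] C lp_norm_nonneg[OF finite_vectors vecs_nonempty]
    by (elim order_trans) (intro mult_left_mono mult_mono, auto simp: u'_def u''_def)
  also have "\<dots> = 4 * C * q powr (- (real d * u) + - u' + - u'')"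
    by (simp only: powr_add)
  finally have "1 \<le> 16 * C * (q powr real d * q powr (- (real d * u) + - u' + - u''))"
    using q_pos by (simp add: field_simps powr_realpow)
  also have "q powr real d * q powr (- (real d * u) + - u' + - u'') = q powr (- (real d * u + u' + u'' - real d))"
    by (simp add: powr_add[symmetric] algebra_simps)
  also have "\<dots> = 1 / q powr (real d * u + u' + u'' - real d)" by (rule powr_minus_divide)
  finally show ?thesis using q_pos by (simp add: field_simps u_def u'_def u''_def)
qed

end

section \<open>Admissible fields\<close>

lemma odd_finite_field_admissible:
  assumes "admissible_field F d"
  shows "odd_finite_field F"
proof -
  interpret field F using assms by (simp add: admissible_field_def)
  obtain p k :: nat where pk: "prime p" "odd p" "order F = p ^ k"
    using assms by (auto simp: admissible_field_def)
  have odd: "odd (order F)" using pk by simp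
  have "order F \<noteq> 0" using pk by (simp add: prime_gt_0_nat)
  then have fin: "finite (carrier F)" by (auto simp: order_def card_gt_0_iff)
  show ?thesis
  proof unfold_locales
    show "finite (carrier F)" by (rule fin)
    show "\<one>\<^bsub>F\<^esub> \<oplus>\<^bsub>F\<^esub> \<one>\<^bsub>F\<^esub> \<noteq> \<zero>\<^bsub>F\<^esub>"
    proof
      assume two: "\<one>\<^bsub>F\<^esub> \<oplus>\<^bsub>F\<^esub> \<one>\<^bsub>F\<^esub> = \<zero>\<^bsub>F\<^esub>"
      \<comment> \<open>In characteristic 2 adding 1 is an involution without fixed points; it
        splits the carrier into pairs, contradicting the odd order.\<close>
      let ?g = "\<lambda>a. a \<oplus>\<^bsub>F\<^esub> \<one>\<^bsub>F\<^esub>"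
      have inv: "?g (?g a) = a" if "a \<in> carrier F" for a
        using that two by (simp add: a_assoc)
      have ne: "?g a \<noteq> a" if "a \<in> carrier F" for a
        using that by (metis a_comm add.l_cancel_one' one_closed one_not_zero)
      have "even (card (carrier F))"
      proof -
        let ?P = "(\<lambda>a. {a, ?g a}) ` carrier F"
        have "card (\<Union> ?P) = (\<Sum>A\<in>?P. card A)"
        proof (rule card_Union_disjoint)
          show "pairwise disjnt ?P"
          proof (intro pairwiseI)
            fix A B assume AB: "A \<in> ?P" "B \<in> ?P" "A \<noteq> B"
            then obtain a b where ab: "a \<in> carrier F" "b \<in> carrier F" "A = {a, ?g a}" "B = {b, ?g b}" by blast
            have "a \<noteq> b" using AB ab by auto
            moreover have "a \<noteq> ?g b" using AB ab inv[of b] by auto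
            moreover have "?g a \<noteq> b" using AB ab inv[of a] by auto
            moreover have "?g a \<noteq> ?g b" using \<open>a \<noteq> b\<close> ab by simp
            ultimately show "disjnt A B" using ab by (auto simp: disjnt_def)
          qed
        qed auto
        also have "\<dots> = (\<Sum>A\<in>?P. 2)" using ne by (intro sum.cong refl) (auto simp: card_insert_if)
        also have "\<Union> ?P = carrier F" by auto
        finally show ?thesis by simp
      qed
      then show False using odd by (simp add: order_def)
    qed
  qed
qed

text \<open>Uniformity is quantified over \<open>nat ring\<close>, so a test field needs a carrier
  of natural numbers: the residues themselves, with the reduction built into the operations.\<close>

definition zmod :: "nat \<Rightarrow> nat ring" where
  "zmod p = \<lparr>carrier = {..<p}, monoid.mult = \<lambda>a b. a * b mod p, one = 1, zero = 0, add = \<lambda>a b. (a + b) mod p\<rparr>"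

lemma field_zmod:
  assumes p: "prime p"
  shows "field (zmod p)"
proof -
  have p1: "1 < p" using p by (rule prime_gt_1_nat)
  have "cring (zmod p)"
  proof (rule cringI)
    show "abelian_group (zmod p)"
    proof (rule abelian_groupI)
      fix x assume "x \<in> carrier (zmod p)"
      then have x: "x < p" by (simp add: zmod_def)
      show "\<exists>y\<in>carrier (zmod p). y \<oplus>\<^bsub>zmod p\<^esub> x = \<zero>\<^bsub>zmod p\<^esub>"
        using x p1 by (intro bexI[of _ "(p - x) mod p"]) (auto simp: zmod_def mod_simps)
    qed (use p1 in \<open>auto simp: zmod_def mod_simps add_ac\<close>)
    show "comm_monoid (zmod p)"
      by (rule comm_monoidI) (use p1 in \<open>auto simp: zmod_def mod_simps mult_ac\<close>)
  qed (use p1 in \<open>auto simp: zmod_def mod_simps algebra_simps\<close>)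
  then show ?thesis
  proof (rule cring.cring_fieldI2)
    show "\<zero>\<^bsub>zmod p\<^esub> \<noteq> \<one>\<^bsub>zmod p\<^esub>" by (simp add: zmod_def)
    fix a assume "a \<in> carrier (zmod p)" "a \<noteq> \<zero>\<^bsub>zmod p\<^esub>"
    then have a: "a < p" "0 < a" by (auto simp: zmod_def)
    then have "\<not> p dvd a" by (auto dest: dvd_imp_le)
    then have "coprime a p" using p prime_imp_coprime coprime_commute by blast
    then obtain x where "[a * x = Suc 0] (mod p)" using cong_solve_coprime_nat by blast
    then have "a * (x mod p) mod p = 1" using p1 by (simp add: cong_def mod_simps)
    then show "\<exists>b\<in>carrier (zmod p). a \<otimes>\<^bsub>zmod p\<^esub> b = \<one>\<^bsub>zmod p\<^esub>"
      using p1 by (intro bexI[of _ "x mod p"]) (auto simp: zmod_def)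
  qed
qed

text \<open>A prime divisor \<open>p\<close> of \<open>3 (N!)\<^sup>2 - 1\<close> exceeds \<open>N\<close>, and \<open>3\<close> is the square of \<open>3 N!\<close> modulo \<open>p\<close>.\<close>

lemma exists_large_field:
  fixes N d :: nat
  obtains F :: "nat ring" and w where "admissible_field F d" "N \<le> order F"
    "w \<in> carrier F" "w \<noteq> \<zero>\<^bsub>F\<^esub>" "w \<otimes>\<^bsub>F\<^esub> w = \<one>\<^bsub>F\<^esub> \<oplus>\<^bsub>F\<^esub> \<one>\<^bsub>F\<^esub> \<oplus>\<^bsub>F\<^esub> \<one>\<^bsub>F\<^esub>"
proof -
  \<comment> \<open>\<open>N + 3\<close> also forces the prime \<open>p\<close> above 3, so that
    \<open>p\<close> is odd and 3 is a reduced, non-zero residue.\<close>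
  define x :: nat where "x = fact (N + 3)"
  have x1: "1 \<le> x" unfolding x_def by (rule fact_ge_1)
  have "3 * x\<^sup>2 - 1 \<noteq> 1" using x1 by (cases x) (auto simp: power2_eq_square)
  then obtain p where p: "prime p" "p dvd 3 * x\<^sup>2 - 1" using prime_factor_nat by blast
  have pN: "N + 3 < p"
  proof (rule ccontr)
    assume "\<not> N + 3 < p"
    then have "p dvd x" unfolding x_def using prime_gt_0_nat[OF p(1)] by (intro dvd_fact) auto
    then have "p dvd 3 * x\<^sup>2" by (simp add: power2_eq_square)
    moreover have "3 * x\<^sup>2 - (3 * x\<^sup>2 - 1) = 1" using x1 by simp
    ultimately have "p dvd 1" using dvd_diff_nat[of p "3 * x\<^sup>2" "3 * x\<^sup>2 - 1"] p(2) by simp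
    then show False using p(1) by simp
  qed
  have odd: "odd p" using p(1) pN prime_odd_nat by auto
  define w where "w = 3 * x mod p"
  obtain k where k: "3 * x\<^sup>2 - 1 = p * k" using p(2) by blast
  have "3 * x\<^sup>2 = p * k + 1" using k x1 by (cases x) (auto simp: power2_eq_square)
  then have "3 * x * (3 * x) = 3 + p * (3 * k)" by (simp add: power2_eq_square algebra_simps)
  then have "3 * x * (3 * x) mod p = 3 mod p" by simp
  then have ww: "w * w mod p = 3" using pN by (simp add: w_def mod_simps)
  have zp: "carrier (zmod p) = {..<p}" "order (zmod p) = p" by (auto simp: zmod_def order_def)
  have wc: "w \<in> carrier (zmod p)" using pN by (simp add: zp w_def)
  have w0: "w \<noteq> \<zero>\<^bsub>zmod p\<^esub>" using ww by (cases w) (auto simp: zmod_def)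
  have three: "\<one>\<^bsub>zmod p\<^esub> \<oplus>\<^bsub>zmod p\<^esub> \<one>\<^bsub>zmod p\<^esub> \<oplus>\<^bsub>zmod p\<^esub> \<one>\<^bsub>zmod p\<^esub> = 3"
    using pN by (simp add: zmod_def)
  have wsq: "w \<otimes>\<^bsub>zmod p\<^esub> w = 3" using ww by (simp add: zmod_def)
  interpret field "zmod p" using p(1) by (rule field_zmod)
  have "admissible_field (zmod p) d"
    unfolding admissible_field_def Let_def three
  proof (intro conjI impI)
    show "field (zmod p)" by (rule field_axioms)
    show "\<exists>r k. prime (r::nat) \<and> odd r \<and> 1 \<le> k \<and> order (zmod p) = r ^ k"
      using p(1) odd zp(2) by (intro exI[of _ p] exI[of _ 1]) simp
    show "3 \<noteq> \<zero>\<^bsub>zmod p\<^esub>" by (simp add: zmod_def)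
    show "\<exists>a\<in>carrier (zmod p). a [^]\<^bsub>zmod p\<^esub> (2::nat) = 3"
      using wc wsq pow_2_eq by metis
  qed
  moreover have "N \<le> order (zmod p)" using pN by (simp add: zp)
  ultimately show ?thesis using that wc w0 wsq three by metis
qed

text \<open>A violated inequality would make a fixed positive power of \<open>q\<close> bounded by
  \<open>16 * C\<close> over arbitrarily large fields. The three exponents are merged into their
  maximum, so that one field refutes any violation; the radius \<open>t = 1\<close> is
  enough.\<close>

lemma K3_bounded_imp:
  assumes d: "2 \<le> d" and p: "1 \<le> p1" "1 \<le> p2" "1 \<le> p3" and K: "lesssim_one K3_form d p1 p2 p3"
  shows "real d * recip p1 + recip p2 + recip p3 \<le> real d"
    "recip p1 + real d * recip p2 + recip p3 \<le> real d"
    "recip p1 + recip p2 + real d * recip p3 \<le> real d"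
proof -
  obtain C where C: "1 \<le> C" and best: "\<forall>F :: nat ring. admissible_field F d \<longrightarrow>
      (\<forall>t\<in>carrier F - {\<zero>\<^bsub>F\<^esub>}. best_const F d (K3_form F d t) p1 p2 p3 \<le> C)"
    using K unfolding lesssim_one_def by blast
  have *: "max (real d * recip p1 + recip p2 + recip p3 - real d)
      (max (real d * recip p2 + recip p3 + recip p1 - real d)
        (real d * recip p3 + recip p1 + recip p2 - real d)) \<le> 0" (is "?m \<le> 0")
  proof (rule ccontr)
    assume "\<not> ?m \<le> 0"
    then have m: "0 < ?m" by (rule not_le_imp_less)
    \<comment> \<open>Chosen so that \<open>q \<ge> N\<close> gives
      \<open>q powr ?m \<ge> 16 * C + 1\<close>.\<close>
    obtain N :: nat where N: "(16 * C + 1) powr (1 / ?m) \<le> real N" using real_arch_simple by blast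
    obtain F :: "nat ring" and w where F: "admissible_field F d" "N \<le> order F"
      and w: "w \<in> carrier F" "w \<noteq> \<zero>\<^bsub>F\<^esub>" "w \<otimes>\<^bsub>F\<^esub> w = \<one>\<^bsub>F\<^esub> \<oplus>\<^bsub>F\<^esub> \<one>\<^bsub>F\<^esub> \<oplus>\<^bsub>F\<^esub> \<one>\<^bsub>F\<^esub>"
      by (rule exists_large_field)
    interpret odd_finite_field F using F(1) by (rule odd_finite_field_admissible)
    let ?o = "indicat_real {\<lambda>i\<in>{..<d}. \<zero>\<^bsub>F\<^esub>}" and ?s = "indicat_real (sphere F d \<one>\<^bsub>F\<^esub>)"
    have bound: "K3_form F d \<one>\<^bsub>F\<^esub> f1 f2 f3 \<le> C * (lp_norm F d p1 f1 * lp_norm F d p2 f2 * lp_norm F d p3 f3)"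
      if "\<And>x. 0 \<le> f1 x" "\<And>x. 0 \<le> f2 x" "\<And>x. 0 \<le> f3 x" for f1 f2 f3
    proof -
      let ?N = "lp_norm F d p1 f1 * lp_norm F d p2 f2 * lp_norm F d p3 f3"
      have "K3_form F d \<one>\<^bsub>F\<^esub> f1 f2 f3 \<le> best_const F d (K3_form F d \<one>\<^bsub>F\<^esub>) p1 p2 p3 * ?N"
        using K3_best_const_least(1)[OF finite_carrier _ p, of d "\<one>\<^bsub>F\<^esub>"] that
        unfolding bound_consts_def by fastforce
      also have "\<dots> \<le> C * ?N"
        using best[rule_format, OF F(1), of "\<one>\<^bsub>F\<^esub>"] lp_norm_nonneg[OF finite_vectors vecs_nonempty]
        by (intro mult_right_mono) auto
      finally show ?thesis .
    qed
    have i: "0 \<le> indicat_real A x" for A and x :: "nat \<Rightarrow> nat" by simp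
    have 1: "q powr (real d * recip p1 + recip p2 + recip p3 - real d) \<le> 16 * C"
      using bound[of ?o ?s ?s, OF i i i] C
      by (intro K3_necessary[OF d w p]) (auto simp: mult_ac)
    have 2: "q powr (real d * recip p2 + recip p3 + recip p1 - real d) \<le> 16 * C"
      using bound[of ?s ?o ?s, OF i i i] C
      by (intro K3_necessary[OF d w p(2,3,1)]) (auto simp: mult_ac K3_form_cyclic[of d _ ?s ?o ?s])
    have 3: "q powr (real d * recip p3 + recip p1 + recip p2 - real d) \<le> 16 * C"
      using bound[of ?s ?s ?o, OF i i i] C
      by (intro K3_necessary[OF d w p(3,1,2)]) (auto simp: mult_ac K3_form_cyclic[of d _ ?o ?s ?s])
    have "16 * C + 1 = ((16 * C + 1) powr (1 / ?m)) powr ?m" using m C by (simp add: powr_powr)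
    also have "\<dots> \<le> q powr ?m"
      using N F(2) m by (intro powr_mono2) (auto simp: q_def)
    also have "\<dots> \<le> 16 * C"
      using 1 2 3 by (simp only: max_def simp_thms split: if_split)
    finally show False by simp
  qed
  then show "real d * recip p1 + recip p2 + recip p3 \<le> real d"
    "recip p1 + real d * recip p2 + recip p3 \<le> real d"
    "recip p1 + recip p2 + real d * recip p3 \<le> real d" by simp_all
qed

theorem theorem5p6:
  fixes d :: nat and p1 p2 p3 :: ereal
  assumes "2 \<le> d"
    and "1 \<le> p1" and "1 \<le> p2" and "1 \<le> p3"
    and "lesssim_one K3_form d p1 p2 p3"
  shows "lesssim_one P2_form d p1 p2 p3"
  unfolding lesssim_one_def
\<comment> \<open>The maximum with 1 is taken because \<open>lesssim_one\<close> asks for a constant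
  of at least 1.\<close>
proof (intro exI[of _ "max 1 (distance_graph.path_const d)"] conjI allI impI ballI)
  fix F :: "nat ring" and t
  assume F: "admissible_field F d" and t: "t \<in> carrier F - {\<zero>\<^bsub>F\<^esub>}"
  interpret odd_finite_field F using F by (rule odd_finite_field_admissible)
  have "best_const F d (P2_form F d t) p1 p2 p3 \<le> distance_graph.path_const d"
  proof (rule P2_best_const_least(2)[OF finite_carrier _ assms(2-4)])
    show "carrier F \<noteq> {}" using zero_closed by blast
    show "distance_graph.path_const d \<in> bound_consts F d (P2_form F d t) p1 p2 p3"
      using t by (intro P2_form_le assms K3_bounded_imp[OF assms]) auto
  qed
  then show "best_const F d (P2_form F d t) p1 p2 p3 \<le> max 1 (distance_graph.path_const d)" by simp
qed simp

end
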